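(* Let $\phi_1,\phi_2,\phi_3\in\mathbb{R}$ with $(\phi_1,\phi_2,\phi_3)\neq(0,0,0)$ and let $(Z_{\mathbf t})_{\mathbf t\in\mathbb{Z}^2}$ be an i.i.d. complex-valued random field. Then the spatial autoregressive model $$Y_{t_1,t_2}-\phi_1Y_{t_1-1,t_2}-\phi_2Y_{t_1,t_2-1}-\phi_3Y_{t_1-1,t_2-1}=Z_{t_1,t_2},\qquad (t_1,t_2)\in\mathbb{Z}^2,$$ admits a causal solution $(Y_{t_1,t_2})_{(t_1,t_2)\in\mathbb{Z}^2}$ if and only if (i) the polynomial $\Phi(z_1,z_2)=1-\phi_1z_1-\phi_2z_2-\phi_3z_1z_2$ has no zero on $\overline{\mathbb{D}}^2=\{(z_1,z_2)\in\mathbb{C}^2:|z_1|\le1,|z_2|\le1\}$, and (ii) if at least two of the coefficients $\phi_1,\phi_2,\phi_3$ are not equal to zero, then $\mathbb{E}\log_+^2|Z_{\mathbf 0}|<\infty$; otherwise $\mathbb{E}\log_+|Z_{\mathbf 0}|<\infty$. If those conditions hold and the distribution of $Z_{\mathbf 0}$ is symmetric, then the unique symmetric causal solution is given by $Y_{\mathbf t}=\sum_{\mathbf k\in\mathbb{N}_0^2}\psi_{\mathbf k}Z_{\mathbf t-\mathbf k}$, $\mathbf t\in\mathbb{Z}^2$, where $$\psi_{\mathbf k}=\sum_{j=0}^{k_1}\binom{k_2}{j}\binom{k_1+k_2-j}{k_2}\phi_1^{k_1-j}\phi_2^{k_2-j}\phi_3^{j},\qquad \mathbf k=(k_1,k_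2)\in\mathbb{N}_0^2.$$
   Context: For $\mathbf s,\mathbf t\in\mathbb{Z}^2$, $\mathbf s\le\mathbf t$ means $s_i\le t_i$ for $i=1,2$. A strictly stationary complex-valued random field $(Y_{\mathbf t})_{\mathbf t\in\mathbb{Z}^2}$ fulfilling the model equation is called a causal solution if $Y_{\mathbf t}$ is measurable with respect to $\sigma(Z_{\mathbf s}:\mathbf s\le\mathbf t)$ for each $\mathbf t\in\mathbb{Z}^2$. The distribution of $X$ is symmetric if $X$ and $-X$ have the same distribution; a solution is symmetric if $Y_{\mathbf 0}$ has symmetric distribution. Uniqueness is up to almost sure equality. $\log_+(z)=\max(\log z,0)$ for $z\ge0$ (with $\log_+(0)=0$), $\log_+^2(z)=(\log_+z)^2$. In the formula for $\psi_{\mathbf k}$, $0^0=1$ and terms with $j>k_2$ are zero.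
   Formalization: The equivalence is proved for noise Z_0 that is not almost surely constant; for constant noise Z=c the "only if" part fails, e.g. φ=(2,0,0), Y=-c. The "if" part and the symmetric/uniqueness part hold without this restriction. *)

theory Defs
  imports "HOL-Probability.Probability"
begin

text \<open>
  Random fields are indexed by \<^typ>\<open>int \<times> int\<close>, whose addition and order are the
  componentwise ones of \<^theory>\<open>HOL-Library.Product_Plus\<close> and
  \<^theory>\<open>HOL-Library.Product_Order\<close>; in particular \<open>{..t}\<close> is the lower quadrant of all
  \<open>s\<close> with \<open>fst s \<le> fst t\<close> and \<open>snd s \<le> snd t\<close>.
\<close>

definition iid_field :: "'w measure \<Rightarrow> (int \<times> int \<Rightarrow> 'w \<Rightarrow> complex) \<Rightarrow> bool" where
  "iid_field M Z \<longleftrightarrow>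
     prob_space.indep_vars M (\<lambda>_. borel) Z UNIV \<and>
     (\<forall>t. distr M borel (Z t) = distr M borel (Z (0, 0)))"

text \<open>Strict stationarity: shift invariance of all finite-dimensional distributions.\<close>

definition strictly_stationary :: "'w measure \<Rightarrow> (int \<times> int \<Rightarrow> 'w \<Rightarrow> complex) \<Rightarrow> bool" where
  "strictly_stationary M Y \<longleftrightarrow>
     (\<forall>t. Y t \<in> borel_measurable M) \<and>
     (\<forall>h J. finite J \<longrightarrow>
        distr M (\<Pi>\<^sub>M t\<in>J. borel) (\<lambda>\<omega>. \<lambda>t\<in>J. Y (t + h) \<omega>) =
        distr M (\<Pi>\<^sub>M t\<in>J. borel) (\<lambda>\<omega>. \<lambda>t\<in>J. Y t \<omega>))"

definition past_algebra ::
  "'w measure \<Rightarrow> (int \<times> int \<Rightarrow> 'w \<Rightarrow> complex) \<Rightarrow> int \<times> int \<Rightarrow> 'w measure" where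
  "past_algebra M Z t =
     sigma (space M) (\<Union>s\<in>{..t}. {Z s -` A \<inter> space M | A. A \<in> sets borel})"

text \<open>Identities between random variables are understood almost surely.\<close>

definition spatial_ar_equation ::
  "'w measure \<Rightarrow> real \<Rightarrow> real \<Rightarrow> real \<Rightarrow> (int \<times> int \<Rightarrow> 'w \<Rightarrow> complex) \<Rightarrow>
   (int \<times> int \<Rightarrow> 'w \<Rightarrow> complex) \<Rightarrow> bool" where
  "spatial_ar_equation M \<phi>1 \<phi>2 \<phi>3 Z Y \<longleftrightarrow>
     (\<forall>t1 t2. AE \<omega> in M.
        Y (t1, t2) \<omega> - of_real \<phi>1 * Y (t1 - 1, t2) \<omega> - of_real \<phi>2 * Y (t1, t2 - 1) \<omega>
          - of_real \<phi>3 * Y (t1 - 1, t2 - 1) \<omega> = Z (t1, t2) \<omega>)"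

definition causal_solution ::
  "'w measure \<Rightarrow> real \<Rightarrow> real \<Rightarrow> real \<Rightarrow> (int \<times> int \<Rightarrow> 'w \<Rightarrow> complex) \<Rightarrow>
   (int \<times> int \<Rightarrow> 'w \<Rightarrow> complex) \<Rightarrow> bool" where
  "causal_solution M \<phi>1 \<phi>2 \<phi>3 Z Y \<longleftrightarrow>
     strictly_stationary M Y \<and>
     spatial_ar_equation M \<phi>1 \<phi>2 \<phi>3 Z Y \<and>
     (\<forall>t. Y t \<in> borel_measurable (past_algebra M Z t))"

definition symmetric_rv :: "'w measure \<Rightarrow> ('w \<Rightarrow> complex) \<Rightarrow> bool" where
  "symmetric_rv M X \<longleftrightarrow> distr M borel X = distr M borel (\<lambda>\<omega>. - X \<omega>)"

definition log_plus :: "real \<Rightarrow> real" where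
  "log_plus z = (if z = 0 then 0 else max (ln z) 0)"

definition ar_poly :: "real \<Rightarrow> real \<Rightarrow> real \<Rightarrow> complex \<Rightarrow> complex \<Rightarrow> complex" where
  "ar_poly \<phi>1 \<phi>2 \<phi>3 z1 z2 =
     1 - of_real \<phi>1 * z1 - of_real \<phi>2 * z2 - of_real \<phi>3 * z1 * z2"

definition no_zero_on_closed_bidisc :: "real \<Rightarrow> real \<Rightarrow> real \<Rightarrow> bool" where
  "no_zero_on_closed_bidisc \<phi>1 \<phi>2 \<phi>3 \<longleftrightarrow>
     (\<forall>z1 z2. cmod z1 \<le> 1 \<and> cmod z2 \<le> 1 \<longrightarrow> ar_poly \<phi>1 \<phi>2 \<phi>3 z1 z2 \<noteq> 0)"

definition at_least_two_nonzero :: "real \<Rightarrow> real \<Rightarrow> real \<Rightarrow> bool" where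
  "at_least_two_nonzero \<phi>1 \<phi>2 \<phi>3 \<longleftrightarrow>
     (\<phi>1 \<noteq> 0 \<and> \<phi>2 \<noteq> 0) \<or> (\<phi>1 \<noteq> 0 \<and> \<phi>3 \<noteq> 0) \<or> (\<phi>2 \<noteq> 0 \<and> \<phi>3 \<noteq> 0)"

definition log_moment_condition ::
  "'w measure \<Rightarrow> real \<Rightarrow> real \<Rightarrow> real \<Rightarrow> ('w \<Rightarrow> complex) \<Rightarrow> bool" where
  "log_moment_condition M \<phi>1 \<phi>2 \<phi>3 X \<longleftrightarrow>
     (if at_least_two_nonzero \<phi>1 \<phi>2 \<phi>3
      then (\<integral>\<^sup>+ \<omega>. ennreal ((log_plus (cmod (X \<omega>)))\<^sup>2) \<partial>M) < \<infinity>
      else (\<integral>\<^sup>+ \<omega>. ennreal (log_plus (cmod (X \<omega>))) \<partial>M) < \<infinity>)"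

text \<open>
  For \<open>j > k2\<close> the truncated exponent \<open>k2 - j\<close> is harmless, because then
  \<open>k2 choose j = 0\<close>.
\<close>

definition psi :: "real \<Rightarrow> real \<Rightarrow> real \<Rightarrow> nat \<times> nat \<Rightarrow> real" where
  "psi \<phi>1 \<phi>2 \<phi>3 = (\<lambda>(k1, k2).
     \<Sum>j=0..k1. real (k2 choose j) * real ((k1 + k2 - j) choose k2)
       * \<phi>1 ^ (k1 - j) * \<phi>2 ^ (k2 - j) * \<phi>3 ^ j)"

definition ma_term ::
  "real \<Rightarrow> real \<Rightarrow> real \<Rightarrow> (int \<times> int \<Rightarrow> 'w \<Rightarrow> complex) \<Rightarrow> int \<times> int \<Rightarrow> 'w \<Rightarrow> nat \<times> nat \<Rightarrow> complex"
where
  "ma_term \<phi>1 \<phi>2 \<phi>3 Z t \<omega> k =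
     of_real (psi \<phi>1 \<phi>2 \<phi>3 k) * Z (fst t - int (fst k), snd t - int (snd k)) \<omega>"

text \<open>
  The series is an unordered (for complex terms: equivalently, absolutely convergent) sum;
  the junk value of \<^const>\<open>infsum\<close> is 0 where the terms are not summable, so statements
  about \<open>ma_field\<close> should be accompanied by almost sure summability of \<open>ma_term\<close>.
\<close>

definition ma_field ::
  "real \<Rightarrow> real \<Rightarrow> real \<Rightarrow> (int \<times> int \<Rightarrow> 'w \<Rightarrow> complex) \<Rightarrow> int \<times> int \<Rightarrow> 'w \<Rightarrow> complex" where
  "ma_field \<phi>1 \<phi>2 \<phi>3 Z t \<omega> = (\<Sum>\<^sub>\<infinity>k\<in>UNIV. ma_term \<phi>1 \<phi>2 \<phi>3 Z t \<omega> k)"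

text \<open>
  An almost surely constant noise \<open>Z = c\<close> has to be set apart: with
  \<open>(\<phi>1, \<phi>2, \<phi>3) = (2, 0, 0)\<close> the constant field \<open>Y = - c\<close> is a causal
  solution although the polynomial vanishes at \<open>(1/2, 0)\<close>.
\<close>

definition nondeterministic :: "'w measure \<Rightarrow> ('w \<Rightarrow> complex) \<Rightarrow> bool" where
  "nondeterministic M X \<longleftrightarrow> \<not> (\<exists>c. AE \<omega> in M. X \<omega> = c)"

end

theory Submission
  imports Defs "HOL-Complex_Analysis.Laurent_Convergence"
begin

text \<open>
  The \<open>\<psi>\<^sub>k\<close> are the power series coefficients of \<open>1 / \<Phi>\<close>. If \<open>\<Phi>\<close> has no zero on the closed
  bidisc they decay exponentially (Cauchy's inequality, column by column), and the logarithmic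
  moment makes the series \<open>\<Sum> \<psi>\<^sub>k Z\<^bsub>t-k\<^esub>\<close> converge absolutely almost surely.

  Conversely, iterating the model equation \<open>n\<close> times writes a causal solution as the partial sum
  of this series over \<open>\<bar>k\<bar> < n\<close> plus a remainder that depends only on the noise at distance at
  least \<open>n\<close>, hence is independent of the partial sum. So the characteristic functions of the
  partial sums are bounded below by that of the solution near the origin, and averaging
  \<open>1 - cos\<close> over small frequencies gives
  \<open>\<Sum> E min (1, (\<psi>\<^sub>k (Z - Z'))\<^sup>2) < \<infinity>\<close> for independent copies \<open>Z\<close>, \<open>Z'\<close> of (the real or imaginary
  part of) the noise. Two consequences are drawn. First, \<open>\<psi>\<close> is square summable, so
  \<open>\<Sum> \<bar>\<psi>\<^sub>k\<bar> r\<^bsup>\<bar>k\<bar>\<^esup> = o(1 / (1 - r))\<close>, whereas a zero \<open>z\<close> of \<open>\<Phi>\<close> would give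
  \<open>\<Phi>(r z) = O(1 - r)\<close> and contradict \<open>(1 / \<Phi>)(r z) \<Phi>(r z) = 1\<close>. Second, \<open>\<bar>\<psi>\<^sub>k\<bar> \<ge> r\<^bsup>\<bar>k\<bar>\<^esup>\<close> for
  some \<open>r > 0\<close> and a positive proportion of the possible \<open>k\<close>, which turns the estimate into the
  logarithmic moment.

  The difference of a causal solution and the series is the limit of the remainders, hence tail
  measurable and constant by Kolmogorov's 0-1 law; symmetry forces the constant to vanish.
\<close>

text \<open>Passing to Z - Z' removes the location, and truncating its square at 1 gives a quantity
  that characteristic functions control, because |char|^2 is the characteristic function of Z - Z'.
  The exponent in condition (ii) is a dimension. Exponential decay of \<open>psi\<close> allows
  |\<open>psi\<close> k| |y| \<ge> 1 only for |k| of order at most log |y|, so the number of such k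
  is at most of order (log |y|)^q, where q is 2 in general and 1 when a single coefficient is
  nonzero and \<open>psi\<close> lives on a ray. This count bounds the exceptional terms of the
  series in one direction and has to be bounded below in the other. The lower bound is the delicate
  point, since coefficients of mixed sign can make single \<open>psi\<close> k vanish. The way out
  is to count rather than to estimate each k: for c1 \<noteq> 0 column m is c1^i times a polynomial
  in i of degree at most m with known top coefficient, so if that coefficient is nonzero at most m
  entries of the column are too small; the remaining cases have closed forms.\<close>

section \<open>The coefficients and their exponential decay\<close>

text \<open>The coefficient of z2^m in 1 / \<Phi>: as \<Phi> = (1 - c1 z1) - z2 (c2 + c3 z1), the
  geometric series in z2 gives (c2 + c3 z1)^m / (1 - c1 z1)^(m + 1). Univariate power series in z1
  thus suffice for the bivariate reciprocal.\<close>

definition psi_column :: "real \<Rightarrow> real \<Rightarrow> real \<Rightarrow> nat \<Rightarrow> complex fps" where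
  "psi_column c1 c2 c3 m =
     (fps_const (of_real c2) + fps_const (of_real c3) * fps_X) ^ m
     * inverse ((1 - fps_const (of_real c1) * fps_X) ^ Suc m)"

lemma fps_nth_linear_power:
  fixes a b :: "'a :: field_char_0"
  shows "fps_nth ((fps_const a + fps_const b * fps_X) ^ m) j = of_nat (m choose j) * a ^ (m - j) * b ^ j"
proof -
  have "(fps_const a + fps_const b * fps_X) ^ m =
      (\<Sum>k\<le>m. of_nat (m choose k) * (fps_const b * fps_X) ^ k * fps_const a ^ (m - k))"
    by (subst add.commute, subst binomial_ring) simp
  also have "\<dots> = (\<Sum>k\<le>m. fps_const (of_nat (m choose k) * b ^ k * a ^ (m - k)) * fps_X ^ k)"
    by (intro sum.cong refl)
       (simp add: power_mult_distrib fps_of_nat[symmetric] fps_const_mult[symmetric]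
          fps_const_power[symmetric] mult_ac del: fps_const_mult fps_const_power)
  finally show ?thesis
    by (simp add: fps_sum_nth if_distrib[of "\<lambda>x. _ * x"] sum.delta' mult_ac
        cong: if_cong)
qed

lemma fps_nth_psi_column: "fps_nth (psi_column c1 c2 c3 m) i = of_real (psi c1 c2 c3 (i, m))"
proof -
  have "fps_nth (psi_column c1 c2 c3 m) i =
      (\<Sum>j=0..i. of_nat (m choose j) * of_real c2 ^ (m - j) * of_real c3 ^ j *
        (of_nat ((m + (i - j)) choose (i - j)) * of_real c1 ^ (i - j)))"
    unfolding psi_column_def
    by (subst one_minus_const_fps_X_neg_power') (simp_all add: fps_mult_nth fps_nth_linear_power)
  also have "\<dots> = (\<Sum>j=0..i. of_nat (m choose j) * of_real c2 ^ (m - j) * of_real c3 ^ j *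
        (of_nat ((i + m - j) choose m) * of_real c1 ^ (i - j)))"
  proof (intro sum.cong refl)
    fix j assume "j \<in> {0..i}"
    then have "(m + (i - j)) choose (i - j) = (i + m - j) choose m"
      using binomial_symmetric[of "i - j" "m + (i - j)"] \<open>j \<in> {0..i}\<close> by (simp add: add.commute)
    then show "of_nat (m choose j) * of_real c2 ^ (m - j) * of_real c3 ^ j *
        (of_nat ((m + (i - j)) choose (i - j)) * of_real c1 ^ (i - j)) =
      (of_nat (m choose j) * of_real c2 ^ (m - j) * of_real c3 ^ j *
        (of_nat ((i + m - j) choose m) * of_real c1 ^ (i - j)) :: complex)"
      by simp
  qed
  finally show ?thesis by (simp add: psi_def mult_ac)
qed

lemma inverse_linear_fps:
  "(1 - fps_const c * fps_X) ^ m * inverse ((1 - fps_const c * fps_X) ^ m) = (1 :: complex fps)"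
  by (rule inverse_mult_eq_1') (simp add: fps_power_zeroth)

lemma psi_column_0: "(1 - fps_const (of_real c1) * fps_X) * psi_column c1 c2 c3 0 = 1"
  using inverse_linear_fps[of "of_real c1" 1] by (simp add: psi_column_def)

lemma psi_column_Suc:
  "(1 - fps_const (of_real c1) * fps_X) * psi_column c1 c2 c3 (Suc m) =
   (fps_const (of_real c2) + fps_const (of_real c3) * fps_X) * psi_column c1 c2 c3 m"
proof -
  define A B where "A = 1 - fps_const (complex_of_real c1) * fps_X"
    and "B = fps_const (complex_of_real c2) + fps_const (of_real c3) * fps_X"
  have *: "A ^ k * inverse (A ^ k) = 1" for k
    unfolding A_def by (rule inverse_linear_fps)
  have "A * (B ^ Suc m * inverse (A ^ Suc (Suc m))) =
      A * (B ^ Suc m * inverse (A ^ Suc (Suc m))) * (A ^ Suc m * inverse (A ^ Suc m))"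
    by (simp only: *) simp
  also have "\<dots> = B * (B ^ m * inverse (A ^ Suc m)) * (A ^ Suc (Suc m) * inverse (A ^ Suc (Suc m)))"
    by (simp only: power_Suc mult_ac)
  also have "\<dots> = B * (B ^ m * inverse (A ^ Suc m))"
    by (simp only: *) simp
  finally show ?thesis
    by (simp only: psi_column_def A_def B_def)
qed

lemma fps_nth_linear_mult:
  fixes a b :: "'a :: comm_ring_1"
  shows "fps_nth ((fps_const a + fps_const b * fps_X) * F) 0 = a * fps_nth F 0"
    and "fps_nth ((fps_const a + fps_const b * fps_X) * F) (Suc i)
      = a * fps_nth F (Suc i) + b * fps_nth F i"
  by (simp_all add: distrib_right mult.assoc)

lemma fps_nth_one_minus_mult:
  fixes a :: "'a :: comm_ring_1"
  shows "fps_nth ((1 - fps_const a * fps_X) * F) 0 = fps_nth F 0"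
    and "fps_nth ((1 - fps_const a * fps_X) * F) (Suc i) = fps_nth F (Suc i) - a * fps_nth F i"
  by (simp_all add: left_diff_distrib mult.assoc)

lemma psi_0_0 [simp]: "psi c1 c2 c3 (0, 0) = 1"
  by (simp add: psi_def)

text \<open>This and the next two recursions equate coefficients in \<Phi> times its reciprocal
  series with those of 1: off the origin \<open>psi\<close> solves the homogeneous model equation,
  with terms missing on the axes.\<close>

lemma psi_Suc_0: "psi c1 c2 c3 (Suc i, 0) = c1 * psi c1 c2 c3 (i, 0)"
proof -
  have "complex_of_real (psi c1 c2 c3 (Suc i, 0) - c1 * psi c1 c2 c3 (i, 0)) = of_real 0"
    using arg_cong[OF psi_column_0[of c1 c2 c3], of "\<lambda>F. fps_nth F (Suc i)"]
    by (simp only: fps_nth_one_minus_mult fps_nth_psi_column) simp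
  then show ?thesis
    by (simp only: of_real_eq_iff right_minus_eq)
qed

lemma psi_0_Suc: "psi c1 c2 c3 (0, Suc m) = c2 * psi c1 c2 c3 (0, m)"
  by (simp add: psi_def)

lemma psi_Suc_Suc: "psi c1 c2 c3 (Suc i, Suc m) =
    c1 * psi c1 c2 c3 (i, Suc m) + c2 * psi c1 c2 c3 (Suc i, m) + c3 * psi c1 c2 c3 (i, m)"
proof -
  have "complex_of_real (psi c1 c2 c3 (Suc i, Suc m) - c1 * psi c1 c2 c3 (i, Suc m)) =
      of_real (c2 * psi c1 c2 c3 (Suc i, m) + c3 * psi c1 c2 c3 (i, m))"
    using arg_cong[OF psi_column_Suc[of c1 c2 c3 m], of "\<lambda>F. fps_nth F (Suc i)"]
    by (simp only: fps_nth_one_minus_mult fps_nth_linear_mult fps_nth_psi_column) simp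
  then show ?thesis
    by (simp only: of_real_eq_iff diff_eq_eq add_ac)
qed

text \<open>Makes the coefficients Taylor coefficients at 0 of a holomorphic function, so that
  Cauchy's inequality applies.\<close>

lemma psi_column_has_fps_expansion:
  "(\<lambda>z. (of_real c2 + of_real c3 * z) ^ m * inverse ((1 - of_real c1 * z) ^ Suc m))
     has_fps_expansion psi_column c1 c2 c3 m"
  unfolding psi_column_def
  by (intro fps_expansion_intros) (simp add: fps_power_zeroth)

text \<open>For fixed z the polynomial is affine in its second variable, a - b w, and its root a / b
  has to lie outside the closed disc.\<close>

lemma no_zero_imp_gap:
  assumes "no_zero_on_closed_bidisc c1 c2 c3" and z: "cmod z \<le> 1"
  shows "cmod (of_real c2 + of_real c3 * z) < cmod (1 - of_real c1 * z)"
proof (rule ccontr)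
  define a b where "a = 1 - of_real c1 * z" and "b = of_real c2 + of_real c3 * z"
  assume "\<not> ?thesis"
  then have ab: "cmod a \<le> cmod b" by (simp add: a_def b_def)
  \<comment> \<open>If b = 0 then a = 0 too, and division by zero gives w = 0, which is still a root
    in the disc.\<close>
  define w where "w = a / b"
  have "cmod w \<le> 1" using ab by (simp add: w_def norm_divide divide_le_eq_1)
  moreover have "ar_poly c1 c2 c3 z w = a - b * w"
    by (simp add: ar_poly_def a_def b_def algebra_simps)
  moreover have "a - b * w = 0"
    using ab by (cases "b = 0") (auto simp: w_def)
  ultimately show False
    using assms by (auto simp: no_zero_on_closed_bidisc_def)
qed

text \<open>Compactness gives a gap of 2 \<epsilon> on the closed unit disc. The two moduli are
  Lipschitz with constants |c1| and |c3|, so moving outward by \<epsilon> / L loses at most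
  \<epsilon>. A radius above 1 is what yields decay in the first index.\<close>

lemma no_zero_imp_uniform_gap:
  assumes "no_zero_on_closed_bidisc c1 c2 c3"
  obtains R \<epsilon> where "R > 1" "\<epsilon> > 0" "\<And>z. cmod z \<le> R \<Longrightarrow>
    cmod (of_real c2 + of_real c3 * z) + \<epsilon> \<le> cmod (1 - of_real c1 * z)"
proof -
  define g where "g z = cmod (1 - of_real c1 * z) - cmod (of_real c2 + of_real c3 * z)" for z
  have "\<exists>x\<in>cball 0 1. \<forall>y\<in>cball 0 1. g x \<le> g y"
    unfolding g_def by (intro continuous_attains_inf) (auto intro!: continuous_intros)
  then obtain x where x: "cmod x \<le> 1" and min: "\<And>y. cmod y \<le> 1 \<Longrightarrow> g x \<le> g y"
    by (auto simp: dist_norm)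
  define \<epsilon> L where "\<epsilon> = g x / 2" and "L = \<bar>c1\<bar> + \<bar>c3\<bar> + 1"
  have eps: "\<epsilon> > 0"
    using no_zero_imp_gap[OF assms x] by (simp add: \<epsilon>_def g_def)
  have L: "L > 0" by (simp add: L_def add_nonneg_pos)
  show thesis
  proof (rule that[of "1 + \<epsilon> / L" \<epsilon>])
    show "1 + \<epsilon> / L > 1" using eps L by simp
    fix z assume z: "cmod z \<le> 1 + \<epsilon> / L"
    obtain w where w: "cmod w \<le> 1" "cmod (z - w) \<le> \<epsilon> / L"
    proof (cases "cmod z \<le> 1")
      case True
      then show thesis using that[of z] eps L by simp
    next
      case False
      then have "z \<noteq> 0" by auto
      have "z - z / of_real (cmod z) = of_real (1 - 1 / cmod z) * z"
        by (simp add: algebra_simps)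
      then have "cmod (z - z / of_real (cmod z)) = \<bar>1 - 1 / cmod z\<bar> * cmod z"
        by (simp only: norm_mult norm_of_real)
      also have "\<dots> = cmod z - 1"
        using False \<open>z \<noteq> 0\<close> by (simp add: abs_if field_simps)
      finally show thesis
        using that[of "z / of_real (cmod z)"] \<open>z \<noteq> 0\<close> z by (simp add: norm_divide)
    qed
    have "1 - of_real c1 * w = (1 - of_real c1 * z) + of_real c1 * (z - w)"
      by (simp add: algebra_simps)
    then have 1: "cmod (1 - of_real c1 * w) \<le> cmod (1 - of_real c1 * z) + \<bar>c1\<bar> * cmod (z - w)"
      by (metis norm_triangle_ineq norm_mult norm_of_real)
    have "of_real c2 + of_real c3 * z = (of_real c2 + of_real c3 * w) + of_real c3 * (z - w)"
      by (simp add: algebra_simps)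
    then have 2: "cmod (of_real c2 + of_real c3 * z)
        \<le> cmod (of_real c2 + of_real c3 * w) + \<bar>c3\<bar> * cmod (z - w)"
      by (metis norm_triangle_ineq norm_mult norm_of_real)
    have "(\<bar>c1\<bar> + \<bar>c3\<bar>) * cmod (z - w) \<le> L * (\<epsilon> / L)"
      using w(2) by (intro mult_mono) (auto simp: L_def)
    then have "(\<bar>c1\<bar> + \<bar>c3\<bar>) * cmod (z - w) \<le> \<epsilon>"
      using L by simp
    then have "\<bar>c1\<bar> * cmod (z - w) + \<bar>c3\<bar> * cmod (z - w) \<le> \<epsilon>"
      by (simp add: distrib_right)
    moreover have "2 * \<epsilon> \<le> cmod (1 - of_real c1 * w) - cmod (of_real c2 + of_real c3 * w)"
      using min[OF w(1)] by (simp add: \<epsilon>_def g_def)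
    ultimately show "cmod (of_real c2 + of_real c3 * z) + \<epsilon> \<le> cmod (1 - of_real c1 * z)"
      using 1 2 by linarith
  qed (use eps in auto)
qed

lemma psi_exponential_decay:
  assumes "no_zero_on_closed_bidisc c1 c2 c3"
  obtains C \<rho> where "C > 0" "0 < \<rho>" "\<rho> < 1" "\<And>i m. \<bar>psi c1 c2 c3 (i, m)\<bar> \<le> C * \<rho> ^ (i + m)"
proof -
  obtain R \<epsilon> where R: "R > 1" and eps: "\<epsilon> > 0" and gap: "\<And>z. cmod z \<le> R \<Longrightarrow>
      cmod (of_real c2 + of_real c3 * z) + \<epsilon> \<le> cmod (1 - of_real c1 * z)"
    using no_zero_imp_uniform_gap[OF assms] by blast
  \<comment> \<open>\<open>H\<close> bounds a = |1 - c1 z| on the circle of radius R, so b = |c2 +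
    c3 z| satisfies b \<le> a - \<epsilon> \<le> (1 - \<epsilon> / H) a. The extra \<epsilon> in
    \<open>H\<close> keeps \<theta> positive. Decay in m comes from \<theta>, decay in i from 1 /
    R.\<close>
  define H \<theta> \<rho> where "H = 1 + \<bar>c1\<bar> * R + \<epsilon>" and "\<theta> = 1 - \<epsilon> / H" and "\<rho> = max \<theta> (1 / R)"
  have H: "H > \<epsilon>" using R eps by (simp add: H_def add_pos_nonneg)
  have \<theta>: "0 < \<theta>" "\<theta> < 1" using H eps by (auto simp: \<theta>_def)
  have \<rho>: "0 < \<rho>" "\<rho> < 1" using \<theta> R by (auto simp: \<rho>_def)
  have bound: "\<bar>psi c1 c2 c3 (i, m)\<bar> \<le> 1 / \<epsilon> * \<rho> ^ (i + m)" for i m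
  proof -
    define f where "f z = (of_real c2 + of_real c3 * z) ^ m * inverse ((1 - of_real c1 * z) ^ Suc m)"
      for z :: complex
    have nz: "1 - of_real c1 * z \<noteq> 0" if "cmod z \<le> R" for z
      using gap[OF that] eps norm_ge_zero[of "of_real c2 + of_real c3 * z"]
      by (metis add_nonneg_pos norm_zero not_less)
    have hol: "f holomorphic_on cball 0 R"
      unfolding f_def using nz by (intro holomorphic_intros) auto
    have f_bound: "cmod (f z) \<le> \<theta> ^ m / \<epsilon>" if z: "cmod z = R" for z
    proof -
      define a b where "a = cmod (1 - of_real c1 * z)" and "b = cmod (of_real c2 + of_real c3 * z)"
      have ba: "b + \<epsilon> \<le> a" "0 \<le> b" using gap[of z] z by (auto simp: a_def b_def)
      have "a \<le> 1 + \<bar>c1\<bar> * R"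
        unfolding a_def by (rule order.trans[OF norm_triangle_ineq4]) (simp add: norm_mult z)
      then have aH: "a \<le> H" using eps by (simp add: H_def)
      have "\<epsilon> / H * a \<le> \<epsilon> / a * a"
        using aH ba eps by (intro mult_right_mono divide_left_mono) auto
      also have "\<dots> = \<epsilon>" using ba eps by simp
      finally have "b \<le> \<theta> * a" using ba by (simp add: \<theta>_def algebra_simps)
      then have b_le: "b / a \<le> \<theta>" using ba eps by (simp add: divide_le_eq)
      have "cmod (f z) = (b / a) ^ m * (1 / a)"
        unfolding f_def norm_mult norm_power norm_inverse a_def[symmetric] b_def[symmetric]
        by (simp add: field_simps)
      also have "\<dots> \<le> \<theta> ^ m * (1 / \<epsilon>)"
        using b_le ba eps \<theta> by (intro mult_mono power_mono divide_left_mono) auto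
      finally show ?thesis by simp
    qed
    have "of_real (psi c1 c2 c3 (i, m)) = (deriv ^^ i) f 0 / fact i"
      using fps_nth_fps_expansion[OF psi_column_has_fps_expansion[of c2 c3 m c1], of i]
      unfolding fps_nth_psi_column f_def .
    moreover have "cmod ((deriv ^^ i) f 0) \<le> fact i * (\<theta> ^ m / \<epsilon>) / R ^ i"
      using hol R f_bound
      by (intro Cauchy_inequality) (auto intro: holomorphic_on_subset holomorphic_on_imp_continuous_on)
    ultimately have "\<bar>psi c1 c2 c3 (i, m)\<bar> \<le> fact i * (\<theta> ^ m / \<epsilon>) / R ^ i / fact i"
      by (metis norm_of_real norm_divide norm_fact divide_right_mono fact_ge_zero)
    also have "\<dots> = 1 / \<epsilon> * ((1 / R) ^ i * \<theta> ^ m)"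
      by (simp add: field_simps)
    also have "\<dots> \<le> 1 / \<epsilon> * (\<rho> ^ i * \<rho> ^ m)"
      using eps R \<theta> \<rho> by (intro mult_left_mono mult_mono power_mono) (auto simp: \<rho>_def)
    finally show ?thesis by (simp add: power_add)
  qed
  show thesis
    by (rule that[OF _ \<rho> bound]) (use eps in auto)
qed

section \<open>Square summable coefficients exclude zeros on the closed bidisc\<close>

text \<open>Extension by zero gives the fundamental solution of the difference operator on the whole
  lattice, which absorbs the boundary cases on the axes.\<close>

definition psi_ext :: "real \<Rightarrow> real \<Rightarrow> real \<Rightarrow> int \<times> int \<Rightarrow> real" where
  "psi_ext c1 c2 c3 = (\<lambda>(x, y). if 0 \<le> x \<and> 0 \<le> y then psi c1 c2 c3 (nat x, nat y) else 0)"

lemma psi_ext_recursion: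
  "psi_ext c1 c2 c3 (x, y) - c1 * psi_ext c1 c2 c3 (x - 1, y) - c2 * psi_ext c1 c2 c3 (x, y - 1)
     - c3 * psi_ext c1 c2 c3 (x - 1, y - 1) = (if (x, y) = (0, 0) then 1 else 0)"
proof (cases "0 \<le> x \<and> 0 \<le> y")
  case False
  then show ?thesis by (auto simp: psi_ext_def)
next
  case True
  then obtain i m where xy: "x = int i" "y = int m"
    by (metis nonneg_int_cases)
  have *: "psi_ext c1 c2 c3 (int i, int m) = psi c1 c2 c3 (i, m)" for i m
    by (simp add: psi_ext_def)
  show ?thesis
  proof (cases i; cases m)
    assume "i = 0" "m = 0"
    then show ?thesis by (simp add: xy psi_ext_def)
  next
    fix i' assume "i = Suc i'" "m = 0"
    then show ?thesis
      using *[of "Suc i'" 0] *[of i' 0] by (simp add: xy psi_Suc_0) (simp add: psi_ext_def)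
  next
    fix m' assume "i = 0" "m = Suc m'"
    then show ?thesis
      using *[of 0 "Suc m'"] *[of 0 m'] by (simp add: xy psi_0_Suc) (simp add: psi_ext_def)
  next
    fix i' m' assume "i = Suc i'" "m = Suc m'"
    then show ?thesis
      using *[of "Suc i'" "Suc m'"] *[of "Suc i'" m'] *[of i' "Suc m'"] *[of i' m']
      by (simp add: xy psi_Suc_Suc)
  qed
qed

text \<open>Pulling the shift into the coefficients turns the model equation into the recursion for them.\<close>

lemma has_sum_psi_ext_iff:
  fixes z :: "int \<times> int \<Rightarrow> complex"
  shows "((\<lambda>k. of_real (psi c1 c2 c3 k) * z (x - int (fst k), y - int (snd k))) has_sum S) UNIV \<longleftrightarrow>
     ((\<lambda>s. of_real (psi_ext c1 c2 c3 (x - fst s, y - snd s)) * z s) has_sum S) UNIV"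
proof -
  define h where "h k = (x - int (fst k), y - int (snd k))" for k :: "nat \<times> nat"
  have bij: "bij_betw h UNIV ({..x} \<times> {..y})"
    by (rule bij_betwI[where g = "\<lambda>s. (nat (x - fst s), nat (y - snd s))"]) (auto simp: h_def)
  have "((\<lambda>s. of_real (psi_ext c1 c2 c3 (x - fst s, y - snd s)) * z s) has_sum S) UNIV \<longleftrightarrow>
      ((\<lambda>s. of_real (psi_ext c1 c2 c3 (x - fst s, y - snd s)) * z s) has_sum S) ({..x} \<times> {..y})"
    by (rule has_sum_cong_neutral) (auto simp: psi_ext_def)
  also have "\<dots> \<longleftrightarrow> ((\<lambda>k. of_real (psi_ext c1 c2 c3 (x - fst (h k), y - snd (h k))) * z (h k)) has_sum S) UNIV"
    by (rule has_sum_reindex_bij_betw[OF bij, symmetric])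
  also have "(\<lambda>k. of_real (psi_ext c1 c2 c3 (x - fst (h k), y - snd (h k))) * z (h k)) =
      (\<lambda>k. of_real (psi c1 c2 c3 k) * z (x - int (fst k), y - int (snd k)))"
    by (auto simp: h_def psi_ext_def)
  finally show ?thesis by simp
qed

text \<open>Kept deterministic because it serves twice: pathwise, to verify the model equation for
  the moving average, and with powers in place of noise, to multiply \<Phi> by its reciprocal
  series.\<close>

lemma convolution_solves_ar:
  fixes z :: "int \<times> int \<Rightarrow> complex" and c1 c2 c3 :: real
  defines "F \<equiv> \<lambda>x y k. of_real (psi c1 c2 c3 k) * z (x - int (fst k), y - int (snd k))"
  assumes "(F x y has_sum S) UNIV" "(F (x - 1) y has_sum S1) UNIV"
    "(F x (y - 1) has_sum S2) UNIV" "(F (x - 1) (y - 1) has_sum S3) UNIV"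
  shows "S - of_real c1 * S1 - of_real c2 * S2 - of_real c3 * S3 = z (x, y)"
proof -
  let ?G = "\<lambda>x y s. of_real (psi_ext c1 c2 c3 (x - fst s, y - snd s)) * z s"
  have G: "(?G x y has_sum S) UNIV" "(?G (x - 1) y has_sum S1) UNIV"
    "(?G x (y - 1) has_sum S2) UNIV" "(?G (x - 1) (y - 1) has_sum S3) UNIV"
    using assms(2-5) unfolding F_def has_sum_psi_ext_iff by simp_all
  have "((\<lambda>s. ?G x y s - of_real c1 * ?G (x - 1) y s - of_real c2 * ?G x (y - 1) s
      - of_real c3 * ?G (x - 1) (y - 1) s) has_sum
      (S - of_real c1 * S1 - of_real c2 * S2 - of_real c3 * S3)) UNIV"
    by (simp only: diff_conv_add_uminus) (intro has_sum_add has_sum_cmult_right G iffD2[OF has_sum_uminus] | simp)+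
  moreover have "?G x y s - of_real c1 * ?G (x - 1) y s - of_real c2 * ?G x (y - 1) s
      - of_real c3 * ?G (x - 1) (y - 1) s = (if s = (x, y) then z s else 0)" for s
  proof -
    let ?p = "psi_ext c1 c2 c3"
    have "?G x y s - of_real c1 * ?G (x - 1) y s - of_real c2 * ?G x (y - 1) s
        - of_real c3 * ?G (x - 1) (y - 1) s =
      of_real (?p (x - fst s, y - snd s) - c1 * ?p (x - fst s - 1, y - snd s)
        - c2 * ?p (x - fst s, y - snd s - 1) - c3 * ?p (x - fst s - 1, y - snd s - 1)) * z s"
      by (simp add: algebra_simps)
    also have "\<dots> = (if s = (x, y) then z s else 0)"
      unfolding psi_ext_recursion by (cases s) auto
    finally show ?thesis .
  qed
  ultimately have "((\<lambda>s. if s = (x, y) then z s else 0) has_sum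
      (S - of_real c1 * S1 - of_real c2 * S2 - of_real c3 * S3)) UNIV"
    by simp
  moreover have "((\<lambda>s. if s = (x, y) then z s else 0) has_sum z (x, y)) UNIV"
    by (rule has_sum_finite_neutralI[of "{(x, y)}"]) auto
  ultimately show ?thesis by (rule has_sum_unique)
qed

lemma psi_summable_ar_poly:
  assumes "(\<lambda>k. \<bar>psi c1 c2 c3 k\<bar> * r ^ (fst k + snd k)) summable_on UNIV"
    and "cmod w1 \<le> r" "cmod w2 \<le> r" "0 \<le> r"
  obtains S where "S * ar_poly c1 c2 c3 w1 w2 = 1"
    and "cmod S \<le> (\<Sum>\<^sub>\<infinity>k. \<bar>psi c1 c2 c3 k\<bar> * r ^ (fst k + snd k))"
proof -
  \<comment> \<open>On this array a unit shift of a coordinate multiplies the convolution by w1 or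
    w2, so the model equation at the origin reads S \<Phi>(w1, w2) = 1. \<open>nat\<close> is
    harmless, as only indices with nonpositive coordinates occur.\<close>
  define z where "z s = w1 ^ nat (- fst s) * w2 ^ nat (- snd s)" for s :: "int \<times> int"
  define f where "f k = of_real (psi c1 c2 c3 k) * w1 ^ fst k * w2 ^ snd k" for k
  have norm_f: "norm (f k) \<le> \<bar>psi c1 c2 c3 k\<bar> * r ^ (fst k + snd k)" for k
  proof -
    have "cmod w1 ^ fst k * cmod w2 ^ snd k \<le> r ^ fst k * r ^ snd k"
      using assms by (intro mult_mono power_mono) auto
    then show ?thesis
      by (simp add: f_def norm_mult norm_power power_add mult.assoc mult_left_mono)
  qed
  have abs: "(\<lambda>k. norm (f k)) summable_on UNIV"
    by (rule summable_on_comparison_test[OF assms(1)]) (use norm_f in auto)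
  then have "f summable_on UNIV"
    by (rule abs_summable_summable)
  then have S: "(f has_sum (\<Sum>\<^sub>\<infinity>k. f k)) UNIV"
    by (rule has_sum_infsum)
  have z_pow: "z (- int a - int i, - int b - int j) = w1 ^ a * w2 ^ b * (w1 ^ i * w2 ^ j)" for a b i j
  proof -
    have "nat (int i + int a) = i + a" "nat (int j + int b) = j + b" by auto
    then show ?thesis by (simp add: z_def power_add mult_ac)
  qed
  have shifted: "((\<lambda>k. of_real (psi c1 c2 c3 k) * z (- int a - int (fst k), - int b - int (snd k)))
      has_sum (w1 ^ a * w2 ^ b * (\<Sum>\<^sub>\<infinity>k. f k))) UNIV" for a b
    using has_sum_cmult_right[OF S, of "w1 ^ a * w2 ^ b"]
    unfolding z_pow by (simp add: f_def mult_ac)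
  have "(\<Sum>\<^sub>\<infinity>k. f k) - of_real c1 * (w1 * (\<Sum>\<^sub>\<infinity>k. f k)) - of_real c2 * (w2 * (\<Sum>\<^sub>\<infinity>k. f k))
      - of_real c3 * (w1 * w2 * (\<Sum>\<^sub>\<infinity>k. f k)) = z (0, 0)"
    by (rule convolution_solves_ar)
       (use shifted[of 0 0] shifted[of 1 0] shifted[of 0 1] shifted[of 1 1] in simp_all)
  then have "(\<Sum>\<^sub>\<infinity>k. f k) * ar_poly c1 c2 c3 w1 w2 = 1"
    by (simp add: ar_poly_def z_def algebra_simps)
  moreover have "cmod (\<Sum>\<^sub>\<infinity>k. f k) \<le> (\<Sum>\<^sub>\<infinity>k. \<bar>psi c1 c2 c3 k\<bar> * r ^ (fst k + snd k))"
    by (rule order.trans[OF norm_infsum_bound]) (auto intro: infsum_mono abs assms(1) norm_f)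
  ultimately show thesis by (rule that)
qed

lemma sum_product_geometric_le:
  fixes q :: real
  assumes q: "0 \<le> q" "q < 1" and "finite F"
  shows "(\<Sum>k\<in>F. q ^ (fst k + snd k)) \<le> 1 / (1 - q)\<^sup>2"
proof -
  have F: "F \<subseteq> fst ` F \<times> snd ` F" by (auto simp: image_iff) force+
  have geo: "(\<Sum>i\<in>A. q ^ i) \<le> 1 / (1 - q)" if "finite A" for A
    using sum_le_suminf[OF summable_geometric that, of q] q suminf_geometric[of q] by simp
  have "(\<Sum>k\<in>F. q ^ (fst k + snd k)) \<le> (\<Sum>k\<in>fst ` F \<times> snd ` F. q ^ (fst k + snd k))"
    using F assms by (intro sum_mono2) auto
  also have "\<dots> = (\<Sum>i\<in>fst ` F. q ^ i) * (\<Sum>j\<in>snd ` F. q ^ j)"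
    by (simp add: sum_product sum.cartesian_product power_add split_def)
  also have "\<dots> \<le> 1 / (1 - q) * (1 / (1 - q))"
    using assms by (intro mult_mono geo sum_nonneg) auto
  finally show ?thesis by (simp add: power2_eq_square)
qed

text \<open>
  If \<open>a\<close> is square summable then \<open>\<Sum> \<bar>a\<^sub>k\<bar> r\<^bsup>\<bar>k\<bar>\<^esup>\<close> is not only
  \<open>O(1 / (1 - r))\<close>, as Cauchy--Schwarz gives, but \<open>o(1 / (1 - r))\<close>.
\<close>

lemma square_summable_abel_bound:
  fixes a :: "nat \<times> nat \<Rightarrow> real"
  assumes sq: "(\<lambda>k. (a k)\<^sup>2) summable_on UNIV" and eps: "\<epsilon> > 0"
  obtains C where "\<And>r F. 0 \<le> r \<Longrightarrow> r < 1 \<Longrightarrow> finite F \<Longrightarrow>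
    (\<Sum>k\<in>F. \<bar>a k\<bar> * r ^ (fst k + snd k)) \<le> C + \<epsilon> / (1 - r)"
proof -
  \<comment> \<open>K carries all but \<epsilon>^2 of the square mass. On K the powers of r are at
    most 1, which gives the constant; off K, Cauchy-Schwarz gives at most \<epsilon> / (1 -
    r^2).\<close>
  obtain K where K: "finite K" and tail: "dist (sum (\<lambda>k. (a k)\<^sup>2) K) (\<Sum>\<^sub>\<infinity>k. (a k)\<^sup>2) \<le> \<epsilon>\<^sup>2"
    using infsum_finite_approximation[OF sq, of "\<epsilon>\<^sup>2"] eps by auto
  have tail_le: "(\<Sum>k\<in>G. (a k)\<^sup>2) \<le> \<epsilon>\<^sup>2" if G: "finite G" "G \<inter> K = {}" for G
  proof -
    have "(\<Sum>k\<in>G. (a k)\<^sup>2) + (\<Sum>k\<in>K. (a k)\<^sup>2) = (\<Sum>k\<in>G \<union> K. (a k)\<^sup>2)"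
      using G K by (simp add: sum.union_disjoint)
    also have "\<dots> \<le> (\<Sum>\<^sub>\<infinity>k. (a k)\<^sup>2)"
      using G K by (intro finite_sum_le_infsum sq) auto
    finally show ?thesis using tail by (simp add: dist_real_def)
  qed
  show thesis
  proof (rule that[of "\<Sum>k\<in>K. \<bar>a k\<bar>"])
    fix r :: real and F :: "(nat \<times> nat) set" assume r: "0 \<le> r" "r < 1" and F: "finite F"
    have "(\<Sum>k\<in>F. \<bar>a k\<bar> * r ^ (fst k + snd k)) =
        (\<Sum>k\<in>F \<inter> K. \<bar>a k\<bar> * r ^ (fst k + snd k)) + (\<Sum>k\<in>F - K. \<bar>a k\<bar> * r ^ (fst k + snd k))"
      using F by (subst sum.union_disjoint[symmetric]) (auto simp: Int_Diff_Un)
    also have "(\<Sum>k\<in>F \<inter> K. \<bar>a k\<bar> * r ^ (fst k + snd k)) \<le> (\<Sum>k\<in>K. \<bar>a k\<bar>)"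
    proof (rule order.trans)
      show "(\<Sum>k\<in>F \<inter> K. \<bar>a k\<bar> * r ^ (fst k + snd k)) \<le> (\<Sum>k\<in>F \<inter> K. \<bar>a k\<bar>)"
        using r by (intro sum_mono) (simp add: mult_left_le power_le_one)
      show "(\<Sum>k\<in>F \<inter> K. \<bar>a k\<bar>) \<le> (\<Sum>k\<in>K. \<bar>a k\<bar>)"
        using K by (intro sum_mono2) auto
    qed
    also have "(\<Sum>k\<in>F - K. \<bar>a k\<bar> * r ^ (fst k + snd k)) \<le> \<epsilon> / (1 - r)"
    proof -
      define q where "q = r\<^sup>2"
      have q: "0 \<le> q" "q < 1" using r by (auto simp: q_def power_less_one_iff abs_square_less_1)
      have "(\<Sum>k\<in>F - K. \<bar>a k\<bar> * r ^ (fst k + snd k)) \<le>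
          (\<Sum>k\<in>F - K. \<bar>\<bar>a k\<bar> * r ^ (fst k + snd k)\<bar>)"
        by (intro sum_mono) simp
      also have "\<dots> \<le> L2_set (\<lambda>k. \<bar>a k\<bar>) (F - K) * L2_set (\<lambda>k. r ^ (fst k + snd k)) (F - K)"
        using L2_set_mult_ineq[of "\<lambda>k. \<bar>a k\<bar>" "\<lambda>k. r ^ (fst k + snd k)" "F - K"] r
        by (simp add: abs_mult)
      finally have "(\<Sum>k\<in>F - K. \<bar>a k\<bar> * r ^ (fst k + snd k)) \<le>
          L2_set (\<lambda>k. \<bar>a k\<bar>) (F - K) * L2_set (\<lambda>k. r ^ (fst k + snd k)) (F - K)" .
      moreover have "L2_set (\<lambda>k. \<bar>a k\<bar>) (F - K) \<le> \<epsilon>"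
        unfolding L2_set_def using tail_le[of "F - K"] F eps by (intro real_le_lsqrt) (auto intro: sum_nonneg)
      moreover have "L2_set (\<lambda>k. r ^ (fst k + snd k)) (F - K) \<le> 1 / (1 - q)"
        unfolding L2_set_def
      proof (intro real_le_lsqrt)
        have "(\<Sum>k\<in>F - K. (r ^ (fst k + snd k))\<^sup>2) = (\<Sum>k\<in>F - K. q ^ (fst k + snd k))"
          by (simp add: q_def power_mult[symmetric] mult.commute)
        also have "\<dots> \<le> (1 / (1 - q))\<^sup>2"
          using sum_product_geometric_le[OF q, of "F - K"] F by (simp add: power_divide)
        finally show "(\<Sum>k\<in>F - K. (r ^ (fst k + snd k))\<^sup>2) \<le> (1 / (1 - q))\<^sup>2" .
      qed (use q in auto)
      moreover have "1 / (1 - q) \<le> 1 / (1 - r)"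
        using r q by (intro divide_left_mono) (auto simp: q_def power2_eq_square mult_left_le)
      ultimately have "(\<Sum>k\<in>F - K. \<bar>a k\<bar> * r ^ (fst k + snd k)) \<le> \<epsilon> * (1 / (1 - r))"
        using eps by (meson L2_set_nonneg mult_mono order.trans less_imp_le)
      then show ?thesis by simp
    qed
    finally show "(\<Sum>k\<in>F. \<bar>a k\<bar> * r ^ (fst k + snd k)) \<le> (\<Sum>k\<in>K. \<bar>a k\<bar>) + \<epsilon> / (1 - r)"
      by simp
  qed
qed

text \<open>Along the ray each monomial changes by a multiple of 1 - r; for z1 z2 the factor is 1 -
  r^2 = (1 - r) (1 + r), whence the 2.\<close>

lemma ar_poly_radial_bound:
  assumes "ar_poly c1 c2 c3 z1 z2 = 0" "cmod z1 \<le> 1" "cmod z2 \<le> 1" "0 \<le> r" "r \<le> 1"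
  shows "cmod (ar_poly c1 c2 c3 (of_real r * z1) (of_real r * z2))
    \<le> (\<bar>c1\<bar> + \<bar>c2\<bar> + 2 * \<bar>c3\<bar>) * (1 - r)"
proof -
  have "ar_poly c1 c2 c3 (of_real r * z1) (of_real r * z2) =
      ar_poly c1 c2 c3 (of_real r * z1) (of_real r * z2) - ar_poly c1 c2 c3 z1 z2"
    using assms by simp
  also have "\<dots> = of_real (1 - r) *
      (of_real c1 * z1 + of_real c2 * z2 + of_real c3 * of_real (1 + r) * (z1 * z2))"
    by (simp add: ar_poly_def algebra_simps)
  also have "cmod \<dots> = (1 - r) *
      cmod (of_real c1 * z1 + of_real c2 * z2 + of_real c3 * of_real (1 + r) * (z1 * z2))"
    using assms by (simp only: norm_mult norm_of_real)
  also have "\<dots> \<le> (1 - r) * (\<bar>c1\<bar> * 1 + \<bar>c2\<bar> * 1 + \<bar>c3\<bar> * \<bar>1 + r\<bar> * (1 * 1))"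
  proof (intro mult_left_mono)
    have "cmod (of_real c1 * z1 + of_real c2 * z2 + of_real c3 * of_real (1 + r) * (z1 * z2)) \<le>
      \<bar>c1\<bar> * cmod z1 + \<bar>c2\<bar> * cmod z2 + \<bar>c3\<bar> * \<bar>1 + r\<bar> * (cmod z1 * cmod z2)"
      by (intro norm_triangle_le add_mono) (simp_all only: norm_mult norm_of_real)
    also have "\<dots> \<le> \<bar>c1\<bar> * 1 + \<bar>c2\<bar> * 1 + \<bar>c3\<bar> * \<bar>1 + r\<bar> * (1 * 1)"
      using assms by (intro add_mono mult_left_mono mult_mono) auto
    finally show "cmod (of_real c1 * z1 + of_real c2 * z2 + of_real c3 * of_real (1 + r) * (z1 * z2))
      \<le> \<bar>c1\<bar> * 1 + \<bar>c2\<bar> * 1 + \<bar>c3\<bar> * \<bar>1 + r\<bar> * (1 * 1)" .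
  qed (use assms in auto)
  also have "\<dots> \<le> (1 - r) * (\<bar>c1\<bar> + \<bar>c2\<bar> + \<bar>c3\<bar> * 2)"
    using assms by (intro mult_left_mono add_mono) (auto intro!: mult_left_mono)
  finally show ?thesis by (simp add: mult_ac)
qed

lemma psi_square_summable_imp_no_zero:
  assumes sq: "(\<lambda>k. (psi c1 c2 c3 k)\<^sup>2) summable_on UNIV"
  shows "no_zero_on_closed_bidisc c1 c2 c3"
  unfolding no_zero_on_closed_bidisc_def
proof (intro allI impI notI)
  fix z1 z2 assume z: "cmod z1 \<le> 1 \<and> cmod z2 \<le> 1" and zero: "ar_poly c1 c2 c3 z1 z2 = 0"
  define D where "D = \<bar>c1\<bar> + \<bar>c2\<bar> + 2 * \<bar>c3\<bar> + 1"
  have D: "D > 0" by (simp add: D_def add_nonneg_pos)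
  obtain C where C: "\<And>r F. 0 \<le> r \<Longrightarrow> r < 1 \<Longrightarrow> finite F \<Longrightarrow>
    (\<Sum>k\<in>F. \<bar>psi c1 c2 c3 k\<bar> * r ^ (fst k + snd k)) \<le> C + 1 / (4 * D) / (1 - r)"
    using square_summable_abel_bound[OF sq, of "1 / (4 * D)"] D by auto
  \<comment> \<open>This r makes B D (1 - r) = 1 / 4, and the singular part of the Abel bound
    contributes another 1 / 4, so |S \<Phi>| \<le> 1 / 2 although the product is 1. Taking B at
    least 1 keeps r in [0, 1).\<close>
  define B r where "B = max C 1" and "r = 1 - 1 / (4 * D * B)"
  have B: "B \<ge> 1" "C \<le> B" by (auto simp: B_def)
  have "D \<ge> 1" by (simp add: D_def)
  then have "D * B \<ge> 1 * 1" using B by (intro mult_mono) auto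
  then have r: "0 \<le> r" "r < 1" by (auto simp: r_def field_simps)
  let ?f = "\<lambda>k. \<bar>psi c1 c2 c3 k\<bar> * r ^ (fst k + snd k)"
  have summ: "?f summable_on UNIV"
    using C[OF r] r
    by (intro nonneg_bdd_above_summable_on bdd_aboveI[of _ "C + 1 / (4 * D) / (1 - r)"]) auto
  have le: "(\<Sum>\<^sub>\<infinity>k. ?f k) \<le> C + 1 / (4 * D) / (1 - r)"
    using C[OF r] by (intro infsum_le_finite_sums summ) auto
  obtain S where S: "S * ar_poly c1 c2 c3 (of_real r * z1) (of_real r * z2) = 1" "cmod S \<le> (\<Sum>\<^sub>\<infinity>k. ?f k)"
    by (rule psi_summable_ar_poly[OF summ, of "of_real r * z1" "of_real r * z2"])
       (use r z in \<open>auto simp: norm_mult mult_left_le\<close>)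
  have "1 = cmod S * cmod (ar_poly c1 c2 c3 (of_real r * z1) (of_real r * z2))"
    using S(1) by (metis norm_mult norm_one)
  also have "\<dots> \<le> (B + 1 / (4 * D) / (1 - r)) * (D * (1 - r))"
  proof (intro mult_mono)
    show "cmod S \<le> B + 1 / (4 * D) / (1 - r)" using S le B by simp
    have "(\<bar>c1\<bar> + \<bar>c2\<bar> + 2 * \<bar>c3\<bar>) * (1 - r) \<le> D * (1 - r)"
      using r by (intro mult_right_mono) (auto simp: D_def)
    then show "cmod (ar_poly c1 c2 c3 (of_real r * z1) (of_real r * z2)) \<le> D * (1 - r)"
      using ar_poly_radial_bound[OF zero _ _ r(1)] z r by (meson order.trans less_imp_le)
    show "0 \<le> B + 1 / (4 * D) / (1 - r)" using B D r by (intro add_nonneg_nonneg) auto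
  qed simp
  also have "\<dots> = B * D * (1 - r) + 1 / 4"
    using D r by (simp add: field_simps)
  also have "\<dots> = 1 / 2" using B D by (simp add: r_def)
  finally show False by simp
qed

section \<open>Symmetrization and logarithmic moments\<close>

lemma sin_le_quintic: "x \<ge> 0 \<Longrightarrow> sin x \<le> x - x ^ 3 / 6 + x ^ 5 / (120 :: real)"
proof -
  assume "x \<ge> 0"
  have "sin_coeff 1 = 1" "sin_coeff 2 = 0" "sin_coeff 3 = - 1 / 6" "sin_coeff 4 = 0"
    by (simp_all add: sin_coeff_def fact_numeral)
  then have "(\<Sum>m<5. sin_coeff m * x ^ m) = x - x ^ 3 / 6"
    by (simp add: eval_nat_numeral lessThan_Suc)
  then have "\<bar>sin x - (x - x ^ 3 / 6)\<bar> \<le> x ^ 5 / 120"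
    using Maclaurin_sin_bound[of x 5] \<open>x \<ge> 0\<close> by (simp add: fact_numeral)
  then show ?thesis using abs_ge_self[of "sin x - (x - x ^ 3 / 6)"] by linarith
qed

text \<open>For x \<le> 2, inserting x^4 \<le> 4 x^2 into the quintic bound leaves x^2 with the
  coefficient 1/6 - 4/120 = 2/15 \<ge> 1/8; beyond 2, sin x / x \<le> 1 / 2 is more than
  enough.\<close>

lemma one_minus_sinc_ge:
  fixes x :: real
  assumes "x > 0"
  shows "min 1 (x\<^sup>2) / 8 \<le> 1 - sin x / x"
proof (cases "x \<le> 2")
  case True
  have "x\<^sup>2 \<le> 2\<^sup>2" using True assms by (intro power_mono) auto
  then have "x\<^sup>2 * x\<^sup>2 \<le> 4 * x\<^sup>2" by (intro mult_right_mono) auto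
  then have *: "x ^ 4 \<le> 4 * x\<^sup>2" by (simp add: power4_eq_xxxx power2_eq_square)
  have "sin x / x \<le> (x - x ^ 3 / 6 + x ^ 5 / 120) / x"
    using sin_le_quintic[of x] assms by (intro divide_right_mono) auto
  also have "\<dots> = 1 - x\<^sup>2 / 6 + x ^ 4 / 120"
    using assms by (simp add: field_simps power2_eq_square power3_eq_cube power4_eq_xxxx numeral_eq_Suc)
  finally have "sin x / x \<le> 1 - x\<^sup>2 / 8" using * zero_le_power2[of x] by linarith
  then show ?thesis by linarith
next
  case False
  then have "sin x / x \<le> 1 / 2"
    using order.trans[OF sin_le_one, of "x / 2" x] by (simp add: divide_le_eq)
  then show ?thesis by linarith
qed

text \<open>At a single frequency 1 - cos (s y) may vanish for large y. Its integral T - sin (T y) /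
  y cannot, and so dominates a truncated square.\<close>

lemma averaged_one_minus_cos_ge:
  fixes y T :: real
  assumes "T > 0"
  shows "ennreal (T / 8 * min 1 ((T * y)\<^sup>2)) \<le>
    (\<integral>\<^sup>+s. ennreal (1 - cos (s * y)) * indicator {0..T} s \<partial>lborel)"
proof (cases "y = 0")
  case False
  have "(\<integral>\<^sup>+s. ennreal (1 - cos (s * y)) * indicator {0..T} s \<partial>lborel) =
      ennreal ((T - sin (T * y) / y) - (0 - sin (0 * y) / y))"
    using False assms
    by (intro nn_integral_FTC_Icc) (auto intro!: derivative_eq_intros)
  moreover have "T / 8 * min 1 ((T * y)\<^sup>2) \<le> T - sin (T * y) / y"
  proof -
    have "min 1 ((T * \<bar>y\<bar>)\<^sup>2) / 8 \<le> 1 - sin (T * \<bar>y\<bar>) / (T * \<bar>y\<bar>)"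
      using False assms by (intro one_minus_sinc_ge) auto
    also have "sin (T * \<bar>y\<bar>) / (T * \<bar>y\<bar>) = sin (T * y) / (T * y)"
      by (cases "y > 0") (auto simp: abs_if)
    finally have "T * (min 1 ((T * y)\<^sup>2) / 8) \<le> T * (1 - sin (T * y) / (T * y))"
      using assms by (intro mult_left_mono) (auto simp: power_mult_distrib)
    also have "\<dots> = T - sin (T * y) / y"
      using False assms by (simp add: field_simps)
    finally show ?thesis by simp
  qed
  ultimately show ?thesis by (simp add: ennreal_leI)
qed auto

section \<open>Symmetrization by characteristic functions\<close>

lemma (in real_distribution) char_eq_cos_sin:
  "char M t = of_real (\<integral>x. cos (t * x) \<partial>M) + \<i> * of_real (\<integral>x. sin (t * x) \<partial>M)"
proof -
  have int: "integrable M (\<lambda>x. cos (t * x))" "integrable M (\<lambda>x. sin (t * x))"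
    by (auto intro!: integrable_const_bound[where B = 1])
  have "iexp y = of_real (cos y) + \<i> * of_real (sin y)" for y
    by (simp add: cis_conv_exp[symmetric] complex_eq_iff)
  then have "char M t = (\<integral>x. of_real (cos (t * x)) + \<i> * of_real (sin (t * x)) \<partial>M)"
    by (simp only: char_def)
  also have "\<dots> = of_real (\<integral>x. cos (t * x) \<partial>M) + \<i> * of_real (\<integral>x. sin (t * x) \<partial>M)"
    using int by simp
  finally show ?thesis .
qed

text \<open>|char|^2 is the characteristic function of X - X' for independent copies; the copies are
  realized by the iterated integral.\<close>

lemma (in real_distribution) symmetrized_char:
  "(\<integral>\<^sup>+y. \<integral>\<^sup>+x. ennreal (1 - cos (t * (x - y))) \<partial>M \<partial>M) = ennreal (1 - (cmod (char M t))\<^sup>2)"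
proof -
  define c s where "c = (\<integral>x. cos (t * x) \<partial>M)" and "s = (\<integral>x. sin (t * x) \<partial>M)"
  have int: "integrable M (\<lambda>x. cos (t * x))" "integrable M (\<lambda>x. sin (t * x))"
    by (auto intro!: integrable_const_bound[where B = 1])
  have cos_diff': "cos (t * (x - y)) = cos (t * x) * cos (t * y) + sin (t * x) * sin (t * y)" for x y
    by (simp add: right_diff_distrib cos_diff)
  have int_diff: "integrable M (\<lambda>x. 1 - cos (t * (x - y)))" for y
    unfolding cos_diff' using int by auto
  have "(\<integral>\<^sup>+x. ennreal (1 - cos (t * (x - y))) \<partial>M) = ennreal (\<integral>x. 1 - cos (t * (x - y)) \<partial>M)" for y
    using int_diff by (intro nn_integral_eq_integral) auto
  moreover have "(\<integral>x. 1 - cos (t * (x - y)) \<partial>M) = 1 - (c * cos (t * y) + s * sin (t * y))" for y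
    unfolding cos_diff' c_def s_def using int by (simp del: space_eq_univ add: prob_space)
  ultimately have inner: "(\<integral>\<^sup>+x. ennreal (1 - cos (t * (x - y))) \<partial>M) =
      ennreal (1 - (c * cos (t * y) + s * sin (t * y)))"
    and inner_nonneg: "0 \<le> 1 - (c * cos (t * y) + s * sin (t * y))" for y
    using Bochner_Integration.integral_nonneg[of M "\<lambda>x. 1 - cos (t * (x - y))"] by auto
  have "(\<integral>\<^sup>+y. \<integral>\<^sup>+x. ennreal (1 - cos (t * (x - y))) \<partial>M \<partial>M) =
      ennreal (\<integral>y. 1 - (c * cos (t * y) + s * sin (t * y)) \<partial>M)"
    unfolding inner using int inner_nonneg by (intro nn_integral_eq_integral) auto
  also have "(\<integral>y. 1 - (c * cos (t * y) + s * sin (t * y)) \<partial>M) = 1 - (c * c + s * s)"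
    using int by (simp del: space_eq_univ add: prob_space c_def s_def)
  also have "c * c + s * s = (cmod (char M t))\<^sup>2"
    unfolding char_eq_cos_sin c_def[symmetric] s_def[symmetric]
    by (simp add: cmod_def power2_eq_square)
  finally show ?thesis .
qed

text \<open>Integrating over frequencies in [0, T] bounds T / 8 times the left-hand side by T,
  whence the 8. The integrals are exchanged so that the hypothesis applies at each frequency
  s.\<close>

lemma (in real_distribution) symmetrized_sum_bound:
  fixes a :: "'k \<Rightarrow> real"
  assumes T: "T > 0" and K: "finite K"
    and le: "\<And>s. 0 \<le> s \<Longrightarrow> s \<le> T \<Longrightarrow> (\<Sum>k\<in>K. 1 - (cmod (char M (a k * s)))\<^sup>2) \<le> 1"
  shows "(\<integral>\<^sup>+y. \<integral>\<^sup>+x. (\<Sum>k\<in>K. ennreal (min 1 ((T * (a k * (x - y)))\<^sup>2))) \<partial>M \<partial>M) \<le> 8"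
proof -
  interpret L: pair_sigma_finite lborel M ..
  define g where "g s y x = (\<Sum>k\<in>K. ennreal (1 - cos (s * (a k * (x - y)))) * indicator {0..T} s)"
    for s y x
  have "ennreal (T / 8) * (\<integral>\<^sup>+y. \<integral>\<^sup>+x. (\<Sum>k\<in>K. ennreal (min 1 ((T * (a k * (x - y)))\<^sup>2))) \<partial>M \<partial>M) =
      (\<integral>\<^sup>+y. \<integral>\<^sup>+x. (\<Sum>k\<in>K. ennreal (T / 8 * min 1 ((T * (a k * (x - y)))\<^sup>2))) \<partial>M \<partial>M)"
    using T by (simp add: nn_integral_cmult[symmetric] sum_distrib_left ennreal_mult'[symmetric])
  also have "\<dots> \<le> (\<integral>\<^sup>+y. \<integral>\<^sup>+x. \<integral>\<^sup>+s. g s y x \<partial>lborel \<partial>M \<partial>M)"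
  proof (intro nn_integral_mono)
    fix x y
    have "(\<Sum>k\<in>K. ennreal (T / 8 * min 1 ((T * (a k * (x - y)))\<^sup>2))) \<le>
        (\<Sum>k\<in>K. \<integral>\<^sup>+s. ennreal (1 - cos (s * (a k * (x - y)))) * indicator {0..T} s \<partial>lborel)"
      by (intro sum_mono averaged_one_minus_cos_ge T)
    also have "\<dots> = (\<integral>\<^sup>+s. g s y x \<partial>lborel)"
      unfolding g_def by (rule nn_integral_sum[symmetric]) measurable
    finally show "(\<Sum>k\<in>K. ennreal (T / 8 * min 1 ((T * (a k * (x - y)))\<^sup>2))) \<le>
      (\<integral>\<^sup>+s. g s y x \<partial>lborel)" .
  qed
  also have "\<dots> = (\<integral>\<^sup>+y. \<integral>\<^sup>+s. \<integral>\<^sup>+x. g s y x \<partial>M \<partial>lborel \<partial>M)"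
    by (intro nn_integral_cong L.Fubini') (simp add: g_def split_def)
  also have "\<dots> = (\<integral>\<^sup>+s. \<integral>\<^sup>+y. \<integral>\<^sup>+x. g s y x \<partial>M \<partial>M \<partial>lborel)"
    by (intro L.Fubini') (simp add: g_def split_def)
  also have "\<dots> \<le> (\<integral>\<^sup>+s. indicator {0..T} s \<partial>lborel)"
  proof (intro nn_integral_mono)
    fix s :: real
    have "(\<integral>\<^sup>+y. \<integral>\<^sup>+x. g s y x \<partial>M \<partial>M) =
        (\<Sum>k\<in>K. \<integral>\<^sup>+y. \<integral>\<^sup>+x. ennreal (1 - cos (a k * s * (x - y))) \<partial>M \<partial>M) * indicator {0..T} s"
      unfolding g_def
      by (cases "s \<in> {0..T}") (simp_all add: nn_integral_sum mult_ac del: sum_ennreal)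
    also have "\<dots> = ennreal (\<Sum>k\<in>K. 1 - (cmod (char M (a k * s)))\<^sup>2) * indicator {0..T} s"
      unfolding symmetrized_char
      by (subst sum_ennreal) (auto simp: abs_square_le_1 cmod_char_le_1)
    also have "\<dots> \<le> indicator {0..T} s"
      using le[of s] by (auto simp: indicator_def)
    finally show "(\<integral>\<^sup>+y. \<integral>\<^sup>+x. g s y x \<partial>M \<partial>M) \<le> indicator {0..T} s" .
  qed
  also have "\<dots> = ennreal (T / 8) * 8"
    using T by (simp add: ennreal_mult'[symmetric] flip: ennreal_numeral)
  finally show ?thesis
    using T by (simp add: ennreal_mult_le_mult_iff)
qed

text \<open>Monotone convergence, applied twice. The logarithmic moment cuts the sum off at an index
  that depends on x - y, so a fixed finite index set would not do.\<close>

lemma (in real_distribution) symmetrized_SUP_bound: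
  fixes a :: "'k \<Rightarrow> real"
  assumes T: "T > 0"
    and le: "\<And>K s. finite K \<Longrightarrow> 0 \<le> s \<Longrightarrow> s \<le> T \<Longrightarrow>
      (\<Sum>k\<in>K. 1 - (cmod (char M (a k * s)))\<^sup>2) \<le> 1"
    and K: "incseq K" "\<And>n. finite (K n)"
  shows "(\<integral>\<^sup>+y. \<integral>\<^sup>+x. (SUP n. \<Sum>k\<in>K n. ennreal (min 1 ((T * (a k * (x - y)))\<^sup>2))) \<partial>M \<partial>M) \<le> 8"
proof -
  define f where "f n y x = (\<Sum>k\<in>K n. ennreal (min 1 ((T * (a k * (x - y)))\<^sup>2)))" for n y x
  have mono: "f m y x \<le> f n y x" if "m \<le> n" for m n y x
    unfolding f_def using K that by (intro sum_mono2) (auto simp: incseq_def)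
  have "(\<integral>\<^sup>+y. \<integral>\<^sup>+x. (SUP n. f n y x) \<partial>M \<partial>M) = (\<integral>\<^sup>+y. (SUP n. \<integral>\<^sup>+x. f n y x \<partial>M) \<partial>M)"
    using mono by (intro nn_integral_cong nn_integral_monotone_convergence_SUP)
      (auto simp: incseq_def le_fun_def f_def)
  also have "\<dots> = (SUP n. \<integral>\<^sup>+y. \<integral>\<^sup>+x. f n y x \<partial>M \<partial>M)"
    using mono by (intro nn_integral_monotone_convergence_SUP)
      (auto simp: incseq_def le_fun_def intro!: nn_integral_mono, simp add: f_def)
  also have "\<dots> \<le> 8"
    unfolding f_def by (intro SUP_least symmetrized_sum_bound T K le)
  finally show ?thesis by (simp add: f_def)
qed

lemma (in real_distribution) separation_measurable:
  "(\<lambda>y. emeasure M {x. \<eta> \<le> \<bar>x - y\<bar>}) \<in> borel_measurable M"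
proof -
  have "(\<lambda>y. \<integral>\<^sup>+x. indicator {z. \<eta> \<le> \<bar>z\<bar>} (x - y) \<partial>M) \<in> borel_measurable M"
    by measurable
  also have "(\<lambda>y. \<integral>\<^sup>+x. indicator {z. \<eta> \<le> \<bar>z\<bar>} (x - y) \<partial>M) =
      (\<lambda>y. \<integral>\<^sup>+x. indicator {x. \<eta> \<le> \<bar>x - y\<bar>} x \<partial>M)"
    by (simp add: indicator_def)
  also have "\<dots> = (\<lambda>y. emeasure M {x. \<eta> \<le> \<bar>x - y\<bar>})"
    by (intro ext nn_integral_indicator) measurable
  finally show ?thesis .
qed

text \<open>If X and an independent copy were almost surely never separated by any 1 / (n + 1), then
  for almost every fixed y the variable X would equal y almost surely.\<close>

lemma (in real_distribution) nondegenerate_separation: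
  assumes "\<not> (\<exists>c. AE x in M. x = c)"
  obtains \<eta> where "\<eta> > 0" "(\<integral>\<^sup>+y. emeasure M {x. \<eta> \<le> \<bar>x - y\<bar>} \<partial>M) > 0"
proof (rule ccontr)
  assume not: "\<not> thesis"
  have "AE y in M. \<forall>n. emeasure M {x. 1 / real (Suc n) \<le> \<bar>x - y\<bar>} = 0"
  proof (subst AE_all_countable, intro allI)
    fix n
    have "(\<integral>\<^sup>+y. emeasure M {x. 1 / real (Suc n) \<le> \<bar>x - y\<bar>} \<partial>M) = 0"
      using that[of "1 / real (Suc n)"] not by (auto simp: zero_less_iff_neq_zero)
    then show "AE y in M. emeasure M {x. 1 / real (Suc n) \<le> \<bar>x - y\<bar>} = 0"
      by (subst (asm) nn_integral_0_iff_AE[OF separation_measurable])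
  qed
  then obtain y where y: "\<And>n. emeasure M {x. 1 / real (Suc n) \<le> \<bar>x - y\<bar>} = 0"
    using eventually_happens[of _ "ae_filter M"]
    by (auto simp del: space_eq_univ simp: ae_filter_eq_bot_iff emeasure_space_1)
  have "AE x in M. \<forall>n. \<not> 1 / real (Suc n) \<le> \<bar>x - y\<bar>"
  proof (subst AE_all_countable, intro allI)
    fix n
    have "{x. 1 / real (Suc n) \<le> \<bar>x - y\<bar>} \<in> null_sets M"
      using y[of n] by (auto simp: null_sets_def)
    then show "AE x in M. \<not> 1 / real (Suc n) \<le> \<bar>x - y\<bar>"
      by (auto dest: AE_not_in)
  qed
  then have "AE x in M. x = y"
  proof eventually_elim
    case (elim x)
    show ?case
    proof (rule ccontr)
      assume "x \<noteq> y"
      then obtain n where "1 / real (Suc n) < \<bar>x - y\<bar>"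
        using reals_Archimedean[of "\<bar>x - y\<bar>"] by (auto simp: inverse_eq_divide)
      with elim show False by (meson less_imp_le)
    qed
  qed
  with assms show False by blast
qed

text \<open>On the event |X - X'| \<ge> \<eta>, of probability p > 0, each summand is at least
  \<open>b k\<close>, so the sum of the \<open>b k\<close> is at most 8 / p. Hence only finitely
  many reach the truncation level 1, and the others are (T \<eta> a k)^2.\<close>

lemma (in real_distribution) char_sum_bound_imp_square_summable:
  fixes a :: "'k \<Rightarrow> real"
  assumes T: "T > 0"
    and le: "\<And>K s. finite K \<Longrightarrow> 0 \<le> s \<Longrightarrow> s \<le> T \<Longrightarrow>
      (\<Sum>k\<in>K. 1 - (cmod (char M (a k * s)))\<^sup>2) \<le> 1"
    and nondeg: "\<not> (\<exists>c. AE x in M. x = c)"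
  shows "(\<lambda>k. (a k)\<^sup>2) summable_on UNIV"
proof -
  obtain \<eta> where \<eta>: "\<eta> > 0" and pos: "(\<integral>\<^sup>+y. emeasure M {x. \<eta> \<le> \<bar>x - y\<bar>} \<partial>M) > 0"
    using nondegenerate_separation[OF nondeg] by blast
  define p where "p = (\<integral>\<^sup>+y. emeasure M {x. \<eta> \<le> \<bar>x - y\<bar>} \<partial>M)"
  define b where "b k = min 1 ((T * \<eta> * a k)\<^sup>2)" for k
  have bound: "ennreal (sum b K) * p \<le> 8" if K: "finite K" for K
  proof -
    have "ennreal (sum b K) * p = (\<integral>\<^sup>+y. \<integral>\<^sup>+x. ennreal (sum b K) * indicator {x. \<eta> \<le> \<bar>x - y\<bar>} x \<partial>M \<partial>M)"
      unfolding p_def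
      by (subst nn_integral_cmult[symmetric]) (auto simp: separation_measurable nn_integral_cmult)
    also have "\<dots> \<le> (\<integral>\<^sup>+y. \<integral>\<^sup>+x. (\<Sum>k\<in>K. ennreal (min 1 ((T * (a k * (x - y)))\<^sup>2))) \<partial>M \<partial>M)"
    proof (intro nn_integral_mono)
      fix x y
      have "b k \<le> min 1 ((T * (a k * (x - y)))\<^sup>2)" if "\<eta> \<le> \<bar>x - y\<bar>" for k
      proof -
        have "\<bar>T * \<eta> * a k\<bar> \<le> \<bar>T * (a k * (x - y))\<bar>"
          using mult_left_mono[OF that, of "T * \<bar>a k\<bar>"] T \<eta> by (simp add: abs_mult mult_ac)
        then show ?thesis unfolding b_def abs_le_square_iff by (rule min.mono[OF order.refl])
      qed
      then show "ennreal (sum b K) * indicator {x. \<eta> \<le> \<bar>x - y\<bar>} x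
          \<le> (\<Sum>k\<in>K. ennreal (min 1 ((T * (a k * (x - y)))\<^sup>2)))"
        by (auto simp: indicator_def intro!: ennreal_leI sum_mono)
    qed
    also have "\<dots> \<le> 8" by (intro symmetrized_sum_bound T K le)
    finally show ?thesis .
  qed
  have "p \<le> (\<integral>\<^sup>+y. 1 \<partial>M)" unfolding p_def by (intro nn_integral_mono emeasure_le_1)
  then have "p \<le> 1" by (simp del: space_eq_univ add: emeasure_space_1)
  then obtain q where q: "p = ennreal q" "q > 0"
    using pos unfolding p_def[symmetric] by (cases p) (auto simp: top_unique)
  have le_8q: "sum b K \<le> 8 / q" if "finite K" for K
  proof -
    have "ennreal (sum b K * q) \<le> ennreal 8"
      using bound[OF that] q by (simp add: ennreal_mult'')
    then have "sum b K * q \<le> 8" by (subst (asm) ennreal_le_iff) auto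
    then show ?thesis using q by (simp add: le_divide_eq)
  qed
  then have b_summable: "b summable_on UNIV"
    by (intro nonneg_bdd_above_summable_on bdd_aboveI[of _ "8 / q"]) (auto simp: b_def)
  have fin: "finite {k. 1 \<le> b k}"
  proof (rule ccontr)
    assume "infinite {k. 1 \<le> b k}"
    then obtain K where K: "finite K" "K \<subseteq> {k. 1 \<le> b k}" "card K = Suc (nat \<lceil>8 / q\<rceil>)"
      using infinite_arbitrarily_large by blast
    have "real (card K) \<le> sum b K"
      using K sum_mono[of K "\<lambda>_. 1" b] by auto
    also have "\<dots> \<le> 8 / q" using K by (intro le_8q)
    finally show False using K by linarith
  qed
  have "(\<lambda>k. (T * \<eta> * a k)\<^sup>2) summable_on UNIV"
  proof -
    have "(\<lambda>k. (T * \<eta> * a k)\<^sup>2) summable_on (- {k. 1 \<le> b k})"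
      using summable_on_subset_banach[OF b_summable, of "- {k. 1 \<le> b k}"]
      by (rule summable_on_cong[THEN iffD1, rotated]) (auto simp: b_def min_def split: if_splits)
    moreover have "(\<lambda>k. (T * \<eta> * a k)\<^sup>2) summable_on {k. 1 \<le> b k}"
      using fin by (rule summable_on_finite)
    ultimately have "(\<lambda>k. (T * \<eta> * a k)\<^sup>2) summable_on (- {k. 1 \<le> b k} \<union> {k. 1 \<le> b k})"
      by (intro summable_on_Un_disjoint) auto
    then show ?thesis by (simp add: Un_commute)
  qed
  then have "(\<lambda>k. (T * \<eta>)\<^sup>2 * (a k)\<^sup>2) summable_on UNIV"
    by (simp add: power_mult_distrib)
  then show ?thesis
    using T \<eta> by (subst (asm) summable_on_cmult_right') auto
qed


lemma char_distr_scale: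
  "f \<in> borel_measurable M \<Longrightarrow>
    char (distr M borel (\<lambda>\<omega>. c * f \<omega>)) t = char (distr M borel f) (c * t)"
  unfolding char_def by (subst (1 2) integral_distr) (auto simp: mult_ac)

text \<open>
  The modulus of the characteristic function of \<open>U\<close> is a lower bound for that of every partial sum.
\<close>

lemma (in prob_space) char_sum_bound_of_decomposition:
  fixes a :: "'k \<Rightarrow> real" and V :: "'k \<Rightarrow> 'a \<Rightarrow> real"
  assumes U: "random_variable borel U"
    and distr_V: "\<And>k. random_variable borel (V k)" "\<And>k. distr M borel (V k) = \<nu>"
    and split: "\<And>K. finite K \<Longrightarrow> \<exists>K' R. finite K' \<and> K \<subseteq> K' \<and> indep_vars (\<lambda>_. borel) V K' \<and>
      indep_var borel (\<lambda>\<omega>. \<Sum>k\<in>K'. a k * V k \<omega>) borel R \<and>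
      (AE \<omega> in M. U \<omega> = (\<Sum>k\<in>K'. a k * V k \<omega>) + R \<omega>)"
  obtains T where "T > 0" "\<And>K s. finite K \<Longrightarrow> 0 \<le> s \<Longrightarrow> s \<le> T \<Longrightarrow>
      (\<Sum>k\<in>K. 1 - (cmod (char \<nu> (a k * s)))\<^sup>2) \<le> 1"
proof -
  interpret U: real_distribution "distr M borel U" using U by simp
  interpret \<nu>: real_distribution \<nu> using distr_V by (metis real_distribution_distr)
  have "((\<lambda>t. (cmod (char (distr M borel U) t))\<^sup>2) \<longlongrightarrow> (cmod (char (distr M borel U) 0))\<^sup>2) (at 0)"
    using U.isCont_char[of 0] unfolding isCont_def by (intro tendsto_intros)
  then have "\<forall>\<^sub>F t in at 0. (cmod (char (distr M borel U) t))\<^sup>2 > 1 / 2"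
    by (rule order_tendstoD) (simp add: U.char_zero)
  then obtain d where d: "d > 0" "\<And>t. t \<noteq> 0 \<Longrightarrow> \<bar>t\<bar> < d \<Longrightarrow> (cmod (char (distr M borel U) t))\<^sup>2 > 1 / 2"
    by (auto simp: eventually_at dist_real_def)
  show thesis
  proof (rule that[of "d / 2"])
    fix K :: "'k set" and s :: real
    assume K: "finite K" and s: "0 \<le> s" "s \<le> d / 2"
    have ge: "(cmod (char (distr M borel U) s))\<^sup>2 \<ge> 1 / 2"
      using d(2)[of s] s d(1) by (cases "s = 0") (auto simp: U.char_zero)
    obtain K' R where K': "finite K'" "K \<subseteq> K'" and V_indep: "indep_vars (\<lambda>_. borel) V K'"
      and indep: "indep_var borel (\<lambda>\<omega>. \<Sum>k\<in>K'. a k * V k \<omega>) borel R"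
      and eq: "AE \<omega> in M. U \<omega> = (\<Sum>k\<in>K'. a k * V k \<omega>) + R \<omega>"
      using split[OF K] by blast
    have [measurable]: "random_variable borel R" using indep by (rule indep_var_rv2)
    note [measurable] = U distr_V(1)
    define x where "x k = 1 - (cmod (char \<nu> (a k * s)))\<^sup>2" for k
    have x: "0 \<le> x k" "x k \<le> 1" for k
      by (auto simp: x_def abs_square_le_1 \<nu>.cmod_char_le_1)
    have "char (distr M borel U) s = char (distr M borel (\<lambda>\<omega>. (\<Sum>k\<in>K'. a k * V k \<omega>) + R \<omega>)) s"
      using eq by (intro arg_cong[where f = "\<lambda>m. char m s"] distr_cong_AE) auto
    also have "\<dots> = char (distr M borel (\<lambda>\<omega>. \<Sum>k\<in>K'. a k * V k \<omega>)) s * char (distr M borel R) s"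
      by (rule char_distr_add[OF indep])
    also have "char (distr M borel (\<lambda>\<omega>. \<Sum>k\<in>K'. a k * V k \<omega>)) s = (\<Prod>k\<in>K'. char \<nu> (a k * s))"
      using indep_vars_compose2[OF V_indep, of "\<lambda>k v. a k * v" "\<lambda>_. borel"]
      by (subst char_distr_sum) (auto simp: char_distr_scale distr_V)
    finally have "cmod (char (distr M borel U) s)
        = (\<Prod>k\<in>K'. cmod (char \<nu> (a k * s))) * cmod (char (distr M borel R) s)"
      by (simp add: norm_mult prod_norm)
    also have "\<dots> \<le> (\<Prod>k\<in>K'. cmod (char \<nu> (a k * s))) * 1"
      by (intro mult_left_mono real_distribution.cmod_char_le_1 real_distribution_distr prod_nonneg) auto
    finally have "(cmod (char (distr M borel U) s))\<^sup>2 \<le> (\<Prod>k\<in>K'. cmod (char \<nu> (a k * s)))\<^sup>2"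
      by (intro power_mono) auto
    also have "\<dots> = (\<Prod>k\<in>K'. 1 - x k)" by (simp add: x_def prod_power_distrib)
    \<comment> \<open>1 - x \<le> exp (- x) turns the product into a sum S with 1 / 2 \<le> exp (-
      S); as 1 / e \<le> 1 / 2, this gives S \<le> 1. This fixes the threshold 1 / 2 imposed near
      frequency 0.\<close>
    also have "\<dots> \<le> (\<Prod>k\<in>K'. exp (- x k))"
      using x exp_ge_add_one_self[of "- x _"] by (intro prod_mono) auto
    also have "\<dots> = exp (- (\<Sum>k\<in>K'. x k))" using K' by (simp add: exp_sum sum_negf[symmetric])
    finally have "1 / 2 \<le> exp (- (\<Sum>k\<in>K'. x k))" using ge by linarith
    moreover have "exp (- 1) \<le> (1 / 2 :: real)"
      using exp_ge_add_one_self[of "1 :: real"] by (simp add: exp_minus field_simps)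
    ultimately have "exp (- 1) \<le> exp (- (\<Sum>k\<in>K'. x k))" by linarith
    then have "(\<Sum>k\<in>K'. x k) \<le> 1" by simp
    then show "(\<Sum>k\<in>K. 1 - (cmod (char \<nu> (a k * s)))\<^sup>2) \<le> 1"
      using sum_mono2[OF K', of x] x(1) by (simp add: x_def)
  qed (use d in auto)
qed

text \<open>Taking m about log |y| / |log r|, every counted k has |a k| |y| \<ge> 1, so a sum over k
  truncated at 1 is at least of order (log |y|)^q. Hence the threshold r^m, uniform over all |k|
  \<le> m.\<close>

definition log_growth :: "nat \<Rightarrow> (nat \<times> nat \<Rightarrow> real) \<Rightarrow> bool" where
  "log_growth q a \<longleftrightarrow> (\<exists>r c. 0 < r \<and> r < 1 \<and> 0 < c \<and>
     (\<forall>m. c * real (Suc m) ^ q \<le> real (card {k. fst k + snd k \<le> m \<and> r ^ m \<le> \<bar>a k\<bar>})))"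

lemma log_plus_nonneg [simp]: "0 \<le> log_plus x"
  by (simp add: log_plus_def)

lemma log_plus_le: "0 \<le> x \<Longrightarrow> x \<le> exp l \<Longrightarrow> 0 \<le> l \<Longrightarrow> log_plus x \<le> l"
  by (cases "x = 0") (auto simp: log_plus_def ln_ge_iff[symmetric] dest: ln_mono[of x "exp l"])

lemma log_plus_measurable [measurable]: "log_plus \<in> borel_measurable borel"
  unfolding log_plus_def by measurable

lemma log_plus_mono: "0 \<le> x \<Longrightarrow> x \<le> y \<Longrightarrow> log_plus x \<le> log_plus y"
  by (auto simp: log_plus_def max_def dest: ln_mono)

lemma le_exp_log_plus: "0 \<le> x \<Longrightarrow> x \<le> exp (log_plus x)"
  by (cases "x = 0") (auto simp: log_plus_def max_def)

lemma log_plus_add: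
  assumes "0 \<le> x" "0 \<le> y"
  shows "log_plus (x + y) \<le> log_plus x + log_plus y + 1"
proof (rule log_plus_le)
  have "x + y \<le> exp (log_plus x) + exp (log_plus y)"
    using assms by (intro add_mono le_exp_log_plus)
  also have "\<dots> \<le> 2 * (exp (log_plus x) * exp (log_plus y))"
  proof -
    have "1 \<le> exp (log_plus x)" "1 \<le> exp (log_plus y)" by simp_all
    then have "exp (log_plus x) * 1 \<le> exp (log_plus x) * exp (log_plus y)"
      "1 * exp (log_plus y) \<le> exp (log_plus x) * exp (log_plus y)"
      by (intro mult_left_mono mult_right_mono; simp)+
    then show ?thesis by linarith
  qed
  also have "\<dots> \<le> exp 1 * (exp (log_plus x) * exp (log_plus y))"
    using exp_ge_add_one_self[of 1] by (intro mult_right_mono) auto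
  also have "\<dots> = exp (log_plus x + log_plus y + 1)" by (simp add: exp_add mult_ac)
  finally show "x + y \<le> exp (log_plus x + log_plus y + 1)" .
qed (use assms in auto)

lemma log_plus_mult:
  assumes "0 \<le> x" "0 \<le> y"
  shows "log_plus (x * y) \<le> log_plus x + log_plus y"
proof (rule log_plus_le)
  show "x * y \<le> exp (log_plus x + log_plus y)"
    unfolding exp_add using assms by (intro mult_mono le_exp_log_plus) auto
qed (use assms in auto)

text \<open>Only \<open>q = 1\<close> and \<open>q = 2\<close> are needed, whence the constant.\<close>

lemma power_add_le_two:
  assumes "q \<le> 2" "0 \<le> u" "0 \<le> v"
  shows "(u + v) ^ q \<le> 2 * (u ^ q + v ^ q :: real)"
proof -
  consider "q = 0" | "q = 1" | "q = 2" using assms by linarith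
  then show ?thesis
  proof cases
    case 3
    have "0 \<le> (u - v)\<^sup>2" by simp
    then show ?thesis unfolding 3 by (simp add: power2_eq_square algebra_simps)
  qed (use assms in auto)
qed

text \<open>For |T y| > 1 and m = floor (L / l) one has r^m exp L \<ge> 1, so every index counted by
  \<open>log_growth\<close> contributes a full 1. The added 1 and C \<ge> 1 cover |T y| \<le> 1,
  where L = 0 and the left-hand side is 0^q.\<close>

lemma log_growth_SUP_ge:
  assumes growth: "log_growth q a" and T: "T > 0"
  obtains C where "C > 0" "\<And>y. ennreal (log_plus \<bar>T * y\<bar> ^ q) \<le>
    ennreal C * (1 + (SUP n. \<Sum>k | fst k + snd k \<le> n. ennreal (min 1 ((T * (a k * y))\<^sup>2))))"
proof -
  obtain r c where r: "0 < r" "r < 1" and c: "0 < c" and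
    card_ge: "\<And>m. c * real (Suc m) ^ q \<le> real (card {k. fst k + snd k \<le> m \<and> r ^ m \<le> \<bar>a k\<bar>})"
    using growth unfolding log_growth_def by auto
  define l where "l = - ln r"
  have l: "l > 0" using r by (simp add: l_def)
  define C where "C = max 1 (l ^ q / c)"
  have C: "C \<ge> 1" "C \<ge> l ^ q / c" by (auto simp: C_def)
  show thesis
  proof (rule that[of C])
    show "C > 0" using C by simp
    fix y
    define f where "f n = (\<Sum>k | fst k + snd k \<le> n. ennreal (min 1 ((T * (a k * y))\<^sup>2)))" for n :: nat
    define L where "L = log_plus \<bar>T * y\<bar>"
    show "ennreal (log_plus \<bar>T * y\<bar> ^ q) \<le>
      ennreal C * (1 + (SUP n. \<Sum>k | fst k + snd k \<le> n. ennreal (min 1 ((T * (a k * y))\<^sup>2))))"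
    proof (cases "\<bar>T * y\<bar> \<le> 1")
      case True
      then have "L = 0" by (auto simp: L_def log_plus_def max_def)
      have "ennreal (L ^ q) \<le> ennreal C * 1"
        using C \<open>L = 0\<close> by (simp add: ennreal_leI power_0_left)
      also have "\<dots> \<le> ennreal C * (1 + (SUP n. f n))" by (intro mult_left_mono) auto
      finally show ?thesis by (simp add: L_def f_def)
    next
      case False
      then have L: "exp L = \<bar>T * y\<bar>" "0 \<le> L" by (auto simp: L_def log_plus_def max_def)
      define m where "m = nat \<lfloor>L / l\<rfloor>"
      have m: "real m \<le> L / l" "L / l \<le> real (Suc m)"
        using L l by (auto simp: m_def) linarith
      let ?G = "{k. fst k + snd k \<le> m \<and> r ^ m \<le> \<bar>a k\<bar>}"
      have fin: "finite {k :: nat \<times> nat. fst k + snd k \<le> m}"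
        by (rule finite_subset[of _ "{..m} \<times> {..m}"]) auto
      have ge_1: "min 1 ((T * (a k * y))\<^sup>2) = 1" if k: "k \<in> ?G" for k
      proof -
        have "1 \<le> exp (- (l * real m)) * exp L"
          using m l by (simp add: exp_add[symmetric] field_simps)
        also have "exp (- (l * real m)) = r ^ m"
          using r by (simp add: l_def exp_of_nat2_mult)
        also have "r ^ m * exp L \<le> \<bar>a k\<bar> * \<bar>T * y\<bar>"
          using k by (simp add: L mult_right_mono)
        also have "\<dots> = \<bar>T * (a k * y)\<bar>" by (simp add: abs_mult)
        finally have "1\<^sup>2 \<le> (T * (a k * y))\<^sup>2" by (subst abs_le_square_iff[symmetric]) simp
        then show ?thesis by simp
      qed
      have "L ^ q \<le> (l * real (Suc m)) ^ q"
        using m l L by (intro power_mono) (auto simp: field_simps)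
      also have "\<dots> = l ^ q / c * (c * real (Suc m) ^ q)"
        using c by (simp add: power_mult_distrib)
      also have "\<dots> \<le> C * real (card ?G)"
        using card_ge[of m] C c l by (intro mult_mono) auto
      finally have "ennreal (L ^ q) \<le> ennreal (C * real (card ?G))" by (rule ennreal_leI)
      also have "\<dots> = ennreal C * (\<Sum>k\<in>?G. ennreal (min 1 ((T * (a k * y))\<^sup>2)))"
        using C ge_1 by (simp add: ennreal_mult ennreal_of_nat_eq_real_of_nat)
      also have "\<dots> \<le> ennreal C * f m"
        unfolding f_def using fin by (intro mult_left_mono sum_mono2) auto
      also have "\<dots> \<le> ennreal C * (1 + (SUP n. f n))"
        by (intro mult_left_mono order.trans[OF SUP_upper[of m UNIV f]]) auto
      finally show ?thesis by (simp add: L_def f_def)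
    qed
  qed
qed

text \<open>The bound at hand concerns X - X'. It allows X' to be frozen at one value y with finite
  inner integral, and the near subadditivity of \<open>log_plus\<close> then undoes the shift by y
  and the scaling by T at the cost of the constant D.\<close>

lemma (in real_distribution) char_sum_bound_imp_log_moment:
  assumes q: "q \<le> 2" and growth: "log_growth q a" and T: "T > 0"
    and le: "\<And>K s. finite K \<Longrightarrow> 0 \<le> s \<Longrightarrow> s \<le> T \<Longrightarrow>
      (\<Sum>k\<in>K. 1 - (cmod (char M (a k * s)))\<^sup>2) \<le> 1"
  shows "(\<integral>\<^sup>+x. ennreal (log_plus \<bar>x\<bar> ^ q) \<partial>M) < \<infinity>"
proof -
  define F where "F y x = (SUP n. \<Sum>k | fst k + snd k \<le> n. ennreal (min 1 ((T * (a k * (x - y)))\<^sup>2)))"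
    for y x
  have [measurable]: "case_prod F \<in> borel_measurable (borel \<Otimes>\<^sub>M borel)" "F y \<in> borel_measurable borel" for y
    unfolding F_def by measurable
  have "(\<integral>\<^sup>+y. \<integral>\<^sup>+x. F y x \<partial>M \<partial>M) \<le> 8"
    unfolding F_def
  proof (rule symmetrized_SUP_bound[OF T le])
    show "finite {k :: nat \<times> nat. fst k + snd k \<le> n}" for n
      by (rule finite_subset[of _ "{..n} \<times> {..n}"]) auto
  qed (auto simp: incseq_def)
  then have "(\<integral>\<^sup>+y. \<integral>\<^sup>+x. F y x \<partial>M \<partial>M) \<noteq> \<infinity>" by (auto simp: top_unique)
  then have "AE y in M. (\<integral>\<^sup>+x. F y x \<partial>M) \<noteq> \<infinity>"
    by (intro nn_integral_PInf_AE) auto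
  then obtain y where y: "(\<integral>\<^sup>+x. F y x \<partial>M) \<noteq> \<infinity>"
    using eventually_happens[of _ "ae_filter M"]
    by (auto simp del: space_eq_univ simp: ae_filter_eq_bot_iff emeasure_space_1)
  obtain C where C: "C > 0" "\<And>y. ennreal (log_plus \<bar>T * y\<bar> ^ q) \<le>
    ennreal C * (1 + (SUP n. \<Sum>k | fst k + snd k \<le> n. ennreal (min 1 ((T * (a k * y))\<^sup>2))))"
    using log_growth_SUP_ge[OF growth T] by blast
  define D where "D = log_plus (1 / T) + log_plus \<bar>y\<bar> + 1"
  have D: "D \<ge> 0" by (simp add: D_def)
  have "ennreal (log_plus \<bar>x\<bar> ^ q) \<le> 2 * (ennreal C * (1 + F y x) + ennreal (D ^ q))" for x
  proof -
    have "log_plus \<bar>x\<bar> \<le> log_plus (1 / T * \<bar>T * (x - y)\<bar> + \<bar>y\<bar>)"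
      using T by (intro log_plus_mono) (auto simp: abs_mult)
    also have "\<dots> \<le> log_plus \<bar>T * (x - y)\<bar> + D"
      using T log_plus_add[of "1 / T * \<bar>T * (x - y)\<bar>" "\<bar>y\<bar>"] log_plus_mult[of "1 / T" "\<bar>T * (x - y)\<bar>"]
      by (simp add: D_def)
    finally have "log_plus \<bar>x\<bar> ^ q \<le> (log_plus \<bar>T * (x - y)\<bar> + D) ^ q"
      by (intro power_mono) auto
    also have "\<dots> \<le> 2 * (log_plus \<bar>T * (x - y)\<bar> ^ q + D ^ q)"
      using D by (intro power_add_le_two q) auto
    finally have "ennreal (log_plus \<bar>x\<bar> ^ q) \<le> 2 * (ennreal (log_plus \<bar>T * (x - y)\<bar> ^ q) + ennreal (D ^ q))"
      using D by (simp add: ennreal_mult'[symmetric] ennreal_leI flip: ennreal_plus ennreal_numeral)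
    also have "\<dots> \<le> 2 * (ennreal C * (1 + F y x) + ennreal (D ^ q))"
      using C(2)[of "x - y"] unfolding F_def by (intro mult_left_mono add_mono) auto
    finally show ?thesis .
  qed
  then have "(\<integral>\<^sup>+x. ennreal (log_plus \<bar>x\<bar> ^ q) \<partial>M) \<le>
      (\<integral>\<^sup>+x. 2 * (ennreal C * (1 + F y x) + ennreal (D ^ q)) \<partial>M)"
    by (intro nn_integral_mono)
  also have "\<dots> = 2 * (ennreal C * (1 + (\<integral>\<^sup>+x. F y x \<partial>M)) + ennreal (D ^ q))"
    by (simp del: space_eq_univ add: nn_integral_cmult nn_integral_add emeasure_space_1)
  also have "\<dots> < \<infinity>"
    using y by (simp add: ennreal_mult_less_top less_top)
  finally show ?thesis .
qed

section \<open>Lower bounds for the coefficients\<close>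

text \<open>Compare coefficients of degree m in Lagrange's interpolation formula, which reproduces p
  on more nodes than its degree: the left-hand side is the divided difference of order m.\<close>

lemma sum_lagrange_eq_coeff:
  fixes p :: "'a :: field poly"
  assumes A: "finite A" "card A = Suc m" and deg: "degree p \<le> m"
  shows "(\<Sum>x\<in>A. poly p x / (\<Prod>y\<in>A - {x}. x - y)) = poly.coeff p m"
proof -
  define B where "B x = (\<Prod>y\<in>A - {x}. [:- y, 1:])" for x
  define w where "w x = (\<Prod>y\<in>A - {x}. x - y)" for x
  have w: "w x \<noteq> 0" for x using A by (simp add: w_def)
  have poly_B: "poly (B x) z = (\<Prod>y\<in>A - {x}. z - y)" for x z
    by (simp add: B_def poly_prod)
  have deg_B: "degree (B x) = m" if "x \<in> A" for x
    unfolding B_def using A that by (subst degree_prod_eq_sum_degree) auto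
  have lead_B: "poly.coeff (B x) m = 1" if "x \<in> A" for x
    using deg_B[OF that] lead_coeff_prod[of "\<lambda>y. [:- y, 1:]" "A - {x}"] by (simp add: B_def)
  define q where "q = (\<Sum>x\<in>A. Polynomial.smult (poly p x / w x) (B x))"
  have "degree q \<le> m"
    unfolding q_def using A deg_B
    by (intro degree_sum_le) (auto intro: order.trans[OF degree_smult_le])
  moreover have "poly q z = poly p z" if z: "z \<in> A" for z
  proof -
    have "poly q z = (\<Sum>x\<in>A. poly p x / w x * poly (B x) z)" by (simp add: q_def poly_sum)
    also have "\<dots> = (\<Sum>x\<in>A. if x = z then poly p z else 0)"
    proof (intro sum.cong refl)
      fix x assume "x \<in> A"
      show "poly p x / w x * poly (B x) z = (if x = z then poly p z else 0)"
      proof (cases "x = z")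
        case True
        then show ?thesis using w[of z] by (simp add: poly_B w_def)
      next
        case False
        then have "poly (B x) z = 0" using z A by (auto simp: poly_B)
        with False show ?thesis by simp
      qed
    qed
    also have "\<dots> = poly p z" using z A by simp
    finally show ?thesis .
  qed
  ultimately have "q = p"
    using A deg by (intro poly_eqI_degree[of A]) auto
  then have "poly.coeff p m = (\<Sum>x\<in>A. poly p x / w x * poly.coeff (B x) m)"
    by (simp add: q_def[symmetric] flip: coeff_smult coeff_sum)
  also have "\<dots> = (\<Sum>x\<in>A. poly p x / w x)" using lead_B by simp
  finally show ?thesis by (simp add: w_def)
qed

text \<open>The largest of n distinct positive integers is at least n.\<close>

lemma fact_card_le_prod:
  assumes "finite S" "0 \<notin> S"
  shows "fact (card S) \<le> \<Prod>(S :: nat set)"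
  using assms
proof (induction S rule: finite_linorder_max_induct)
  case (insert b S)
  have "S \<subseteq> {0<..<b}" using insert by (auto intro: Suc_leI gr0I)
  then have "card S \<le> card {0<..<b}" by (intro card_mono) auto
  with insert have "Suc (card S) \<le> b" by (cases b) auto
  moreover have "fact (card S) \<le> \<Prod>S" using insert by auto
  ultimately have "Suc (card S) * fact (card S) \<le> b * \<Prod>S" by (intro mult_mono) auto
  then show ?case using insert by (auto simp: card_insert_if)
qed simp

text \<open>With l nodes left and g nodes right of x, the distances on either side are distinct
  positive integers. The product is thus at least l! g! = m! / (m choose l), and the binomial
  coefficient is at most 2^m.\<close>

lemma prod_distances_ge:
  fixes x :: nat
  assumes N: "finite N" "card N = Suc m" "x \<in> N"
  shows "fact m / 2 ^ m \<le> (\<Prod>y\<in>N - {x}. \<bar>real x - real y\<bar>)"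
proof -
  define L G where "L = {y\<in>N. y < x}" and "G = {y\<in>N. x < y}"
  have LG: "N - {x} = L \<union> G" "L \<inter> G = {}" "finite L" "finite G"
    using N by (auto simp: L_def G_def)
  have card: "card L + card G = m"
    using LG N by (metis card_Un_disjoint card_Diff_singleton diff_Suc_1)
  have L: "fact (card L) \<le> (\<Prod>y\<in>L. x - y)"
  proof -
    have inj: "inj_on (\<lambda>y. x - y) L" by (auto simp: inj_on_def L_def)
    have "fact (card ((\<lambda>y. x - y) ` L)) \<le> \<Prod>((\<lambda>y. x - y) ` L)"
      using N(1) by (intro fact_card_le_prod) (auto simp: L_def)
    then show ?thesis by (simp add: card_image[OF inj] prod.reindex[OF inj])
  qed
  have G: "fact (card G) \<le> (\<Prod>y\<in>G. y - x)"
  proof -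
    have inj: "inj_on (\<lambda>y. y - x) G" by (auto simp: inj_on_def G_def)
    have "fact (card ((\<lambda>y. y - x) ` G)) \<le> \<Prod>((\<lambda>y. y - x) ` G)"
      using N(1) by (intro fact_card_le_prod) (auto simp: G_def)
    then show ?thesis by (simp add: card_image[OF inj] prod.reindex[OF inj])
  qed
  have "fact m = fact (card L) * fact (m - card L) * (m choose card L)"
    using card by (intro binomial_fact_lemma[symmetric]) auto
  also have "\<dots> \<le> fact (card L) * fact (card G) * 2 ^ m"
    using card by (intro mult_mono binomial_le_pow2) auto
  also have "\<dots> \<le> (\<Prod>y\<in>L. x - y) * (\<Prod>y\<in>G. y - x) * 2 ^ m"
    by (intro mult_mono L G) auto
  finally have "real (fact m) \<le> real ((\<Prod>y\<in>L. x - y) * (\<Prod>y\<in>G. y - x) * 2 ^ m)"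
    by (rule of_nat_mono)
  also have "\<dots> = (\<Prod>y\<in>L. real (x - y)) * (\<Prod>y\<in>G. real (y - x)) * 2 ^ m" by simp
  also have "(\<Prod>y\<in>L. real (x - y)) = (\<Prod>y\<in>L. \<bar>real x - real y\<bar>)"
    by (intro prod.cong) (auto simp: L_def)
  also have "(\<Prod>y\<in>G. real (y - x)) = (\<Prod>y\<in>G. \<bar>real x - real y\<bar>)"
    by (intro prod.cong) (auto simp: G_def)
  also have "(\<Prod>y\<in>L. \<bar>real x - real y\<bar>) * (\<Prod>y\<in>G. \<bar>real x - real y\<bar>) = (\<Prod>y\<in>N - {x}. \<bar>real x - real y\<bar>)"
    using LG by (simp add: prod.union_disjoint)
  finally show ?thesis by (simp add: divide_le_eq)
qed

text \<open>Lagrange interpolation at \<open>m + 1\<close> such points would make the leading coefficient too small.\<close>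

lemma card_small_poly_values:
  fixes p :: "real poly"
  assumes deg: "degree p \<le> m" and lead: "\<bar>poly.coeff p m\<bar> = b ^ m / fact m" and b: "b > 0"
  shows "finite {i. \<bar>poly p (real i)\<bar> < (b / 4) ^ m} \<and> card {i. \<bar>poly p (real i)\<bar> < (b / 4) ^ m} \<le> m"
proof (rule ccontr)
  let ?S = "{i. \<bar>poly p (real i)\<bar> < (b / 4) ^ m}"
  assume "\<not> ?thesis"
  then have "infinite ?S \<or> Suc m \<le> card ?S" by auto
  then obtain N where N: "finite N" "card N = Suc m" "N \<subseteq> ?S"
    using infinite_arbitrarily_large[of ?S "Suc m"] obtain_subset_with_card_n[of "Suc m" ?S] by metis
  define D where "D x = (\<Prod>y\<in>N - {x}. \<bar>real x - real y\<bar>)" for x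
  have D: "fact m / 2 ^ m \<le> D x" if "x \<in> N" for x
    unfolding D_def using N that by (intro prod_distances_ge)
  have Dpos: "D x > 0" if "x \<in> N" for x
    by (rule less_le_trans[OF _ D[OF that]]) simp
  have inj: "inj_on real A" for A by (simp add: inj_on_def)
  have "poly.coeff p m = (\<Sum>x\<in>real ` N. poly p x / (\<Prod>y\<in>real ` N - {x}. x - y))"
    using N deg by (intro sum_lagrange_eq_coeff[symmetric]) (auto simp: card_image inj)
  also have "\<dots> = (\<Sum>x\<in>N. poly p (real x) / (\<Prod>y\<in>real ` N - {real x}. real x - y))"
    by (subst sum.reindex[OF inj]) simp
  also have "\<dots> = (\<Sum>x\<in>N. poly p (real x) / (\<Prod>y\<in>N - {x}. real x - real y))"
  proof (intro sum.cong refl)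
    fix x
    have "real ` N - {real x} = real ` (N - {x})" by auto
    then have "(\<Prod>y\<in>real ` N - {real x}. real x - y) = (\<Prod>y\<in>N - {x}. real x - real y)"
      by (simp only:) (subst prod.reindex[OF inj], simp)
    then show "poly p (real x) / (\<Prod>y\<in>real ` N - {real x}. real x - y) =
        poly p (real x) / (\<Prod>y\<in>N - {x}. real x - real y)" by simp
  qed
  finally have "\<bar>poly.coeff p m\<bar> \<le> (\<Sum>x\<in>N. \<bar>poly p (real x)\<bar> / D x)"
    by (simp add: D_def abs_prod order.trans[OF sum_abs])
  also have "\<dots> < (\<Sum>x\<in>N. (b / 4) ^ m / (fact m / 2 ^ m))"
  proof (rule sum_strict_mono)
    fix x assume x: "x \<in> N"
    have "\<bar>poly p (real x)\<bar> / D x < (b / 4) ^ m / D x"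
      using x N Dpos[OF x] by (intro divide_strict_right_mono) auto
    also have "\<dots> \<le> (b / 4) ^ m / (fact m / 2 ^ m)"
      using D[OF x] b Dpos[OF x] by (intro divide_left_mono) auto
    finally show "\<bar>poly p (real x)\<bar> / D x < (b / 4) ^ m / (fact m / 2 ^ m)" .
  qed (use N in auto)
  also have "\<dots> = real (Suc m) * ((b / 4) ^ m * 2 ^ m / fact m)" using N by simp
  \<comment> \<open>The m + 1 terms cost a factor of at most 2^m and the distances another 2^m;
    together 4^m, matched by the threshold (b / 4)^m.\<close>
  also have "\<dots> \<le> 2 ^ m * ((b / 4) ^ m * 2 ^ m / fact m)"
  proof (intro mult_right_mono)
    have "Suc m \<le> 2 ^ m" by (simp add: Suc_leI)
    then have "real (Suc m) \<le> real (2 ^ m)" by (rule of_nat_mono)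
    then show "real (Suc m) \<le> 2 ^ m" by simp
  qed (use b in auto)
  also have "\<dots> = (2 * (b / 4) * 2) ^ m / fact m" by (simp only: power_mult_distrib) simp
  also have "\<dots> = b ^ m / fact m" by simp
  finally show False using lead by simp
qed

section \<open>Counting indices with large coefficients\<close>

lemma finite_total_degree_le: "finite {k :: nat \<times> nat. fst k + snd k \<le> n}"
  by (rule finite_subset[of _ "{..n} \<times> {..n}"]) auto

lemma sum_odd_reversed: "(\<Sum>j\<le>n. Suc (2 * (n - j))) = (Suc n)\<^sup>2"
proof -
  have "(\<Sum>j\<le>n. Suc (2 * j)) = (Suc n)\<^sup>2"
    by (induction n) (auto simp: power2_eq_square)
  moreover have "(\<Sum>j\<le>n. Suc (2 * (n - j))) = (\<Sum>j\<le>n. Suc (2 * j))"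
    by (rule sum.reindex_bij_witness[of _ "\<lambda>j. n - j" "\<lambda>j. n - j"]) auto
  ultimately show ?thesis by simp
qed

text \<open>Only columns j \<le> n = m div 2 are counted. Column j has m - j + 1 indices of total
  degree at most m, of which at most j are bad, so at least 2 (n - j) + 1 are good. These odd
  numbers add up to (n + 1)^2, at least a quarter of (m + 1)^2.\<close>

lemma log_growth_columns:
  assumes r: "0 < r" "r < 1"
    and bad: "\<And>j. finite {i. \<bar>a (i, j)\<bar> < r ^ (i + j)} \<and> card {i. \<bar>a (i, j)\<bar> < r ^ (i + j)} \<le> j"
  shows "log_growth 2 a"
  unfolding log_growth_def
proof (intro exI conjI allI)
  fix m :: nat
  define n where "n = m div 2"
  define G where "G = {k. fst k + snd k \<le> m \<and> r ^ m \<le> \<bar>a k\<bar>}"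
  define H where "H j = {..m - j} - {i. \<bar>a (i, j)\<bar> < r ^ (i + j)}" for j
  have fin: "finite G" unfolding G_def by (rule finite_subset[OF _ finite_total_degree_le[of m]]) auto
  have "(Suc n)\<^sup>2 = (\<Sum>j\<le>n. Suc (2 * (n - j)))" by (rule sum_odd_reversed[symmetric])
  also have "\<dots> \<le> (\<Sum>j\<le>n. card (H j))"
  proof (intro sum_mono)
    fix j assume "j \<in> {..n}"
    then have "Suc (2 * (n - j)) \<le> card {..m - j} - j" by (auto simp: n_def)
    also have "\<dots> \<le> card {..m - j} - card {i. \<bar>a (i, j)\<bar> < r ^ (i + j)}"
      using bad[of j] by (intro diff_le_mono2) auto
    also have "\<dots> \<le> card (H j)" unfolding H_def using bad[of j] by (intro diff_card_le_card_Diff) auto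
    finally show "Suc (2 * (n - j)) \<le> card (H j)" .
  qed
  also have "\<dots> = card (SIGMA j:{..n}. H j)" by (subst card_SigmaI) (auto simp: H_def)
  also have "\<dots> = card (prod.swap ` (SIGMA j:{..n}. H j))" by (simp add: card_image)
  also have "\<dots> \<le> card G"
  proof (rule card_mono[OF fin], rule subsetI)
    fix k assume "k \<in> prod.swap ` (SIGMA j:{..n}. H j)"
    then obtain i j where k: "k = (i, j)" and "j \<le> n" "i \<in> H j" by auto
    then have ij: "j \<le> n" "i \<le> m - j" "r ^ (i + j) \<le> \<bar>a (i, j)\<bar>" by (auto simp: H_def not_less)
    then have "i + j \<le> m" by (auto simp: n_def)
    moreover from this have "r ^ m \<le> r ^ (i + j)" using r by (intro power_decreasing) auto
    ultimately show "k \<in> G" using ij by (simp add: G_def k)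
  qed
  finally have "real ((Suc n)\<^sup>2) \<le> real (card G)" by (rule of_nat_mono)
  moreover have "real (Suc m) \<le> 2 * real (Suc n)" by (simp add: n_def)
  then have "(real (Suc m))\<^sup>2 \<le> (2 * real (Suc n))\<^sup>2" by (intro power_mono) auto
  ultimately have "(real (Suc m))\<^sup>2 \<le> 4 * real (card G)"
    by (simp only: power_mult_distrib of_nat_power) simp
  then show "1 / 4 * real (Suc m) ^ 2 \<le> real (card {k. fst k + snd k \<le> m \<and> r ^ m \<le> \<bar>a k\<bar>})"
    by (simp add: G_def)
qed (use r in auto)

lemma log_growth_swap: "log_growth q (\<lambda>k. a (prod.swap k)) \<Longrightarrow> log_growth q a"
proof -
  have "card {k. fst k + snd k \<le> m \<and> x \<le> \<bar>a (prod.swap k)\<bar>} = card {k. fst k + snd k \<le> m \<and> x \<le> \<bar>a k\<bar>}"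
    for m x
    by (rule bij_betw_same_card[of prod.swap])
       (rule bij_betwI[where g = prod.swap], auto)
  then show "log_growth q (\<lambda>k. a (prod.swap k)) \<Longrightarrow> log_growth q a"
    by (simp add: log_growth_def)
qed

text \<open>Meant for coefficients supported on a ray. The factor 2 accommodates the diagonal, whose
  point (n, n) has total degree 2 n.\<close>

lemma log_growth_sequence:
  assumes r: "0 < r" "r < 1" and inj: "inj \<kappa>"
    and \<kappa>: "\<And>n. fst (\<kappa> n) + snd (\<kappa> n) \<le> 2 * n" "\<And>n. r ^ (2 * n) \<le> \<bar>a (\<kappa> n)\<bar>"
  shows "log_growth 1 a"
  unfolding log_growth_def
proof (intro exI conjI allI)
  fix m :: nat
  let ?G = "{k. fst k + snd k \<le> m \<and> r ^ m \<le> \<bar>a k\<bar>}"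
  have "finite ?G" by (rule finite_subset[OF _ finite_total_degree_le[of m]]) auto
  moreover have "\<kappa> ` {..m div 2} \<subseteq> ?G"
  proof (rule image_subsetI)
    fix n assume "n \<in> {..m div 2}"
    then have n: "n \<le> m div 2" by simp
    then have "r ^ m \<le> r ^ (2 * n)" using r by (intro power_decreasing) auto
    moreover have "fst (\<kappa> n) + snd (\<kappa> n) \<le> m" using \<kappa>(1)[of n] n by linarith
    ultimately show "\<kappa> n \<in> ?G" using \<kappa>(2)[of n] by simp
  qed
  ultimately have "card (\<kappa> ` {..m div 2}) \<le> card ?G" by (intro card_mono)
  also have "card (\<kappa> ` {..m div 2}) = Suc (m div 2)"
    using inj by (simp add: card_image inj_on_subset)
  finally show "1 / 2 * real (Suc m) ^ 1 \<le> real (card ?G)" by simp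
qed (use r in auto)

section \<open>Closed forms of the coefficients and their growth\<close>

lemma psi_first_axis: "psi c1 c2 c3 (n, 0) = c1 ^ n"
  by (induction n) (simp_all add: psi_Suc_0)

lemma psi_second_axis: "psi c1 c2 c3 (0, n) = c2 ^ n"
  by (simp add: psi_def)

lemma psi_c1_zero: "i \<le> m \<Longrightarrow> psi 0 c2 c3 (i, m) = real (m choose i) * c2 ^ (m - i) * c3 ^ i"
proof -
  assume "i \<le> m"
  have "psi 0 c2 c3 (i, m) = (\<Sum>j=0..i. if j = i then real (m choose i) * c2 ^ (m - i) * c3 ^ i else 0)"
    unfolding psi_def prod.case by (intro sum.cong) (auto simp: power_0_left)
  then show ?thesis by simp
qed

text \<open>In this case \<Phi> = (1 - c1 z1) (1 - c2 z2), and its reciprocal is a product of two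
  geometric series.\<close>

lemma psi_factorized: "psi c1 c2 (- (c1 * c2)) (i, m) = c1 ^ i * c2 ^ m"
proof (induction "i + m" arbitrary: i m rule: less_induct)
  case less
  show ?case
  proof (cases i; cases m)
    fix i' m' assume "i = Suc i'" "m = Suc m'"
    then show ?thesis using less[of i' m] less[of i m'] less[of i' m'] by (simp add: psi_Suc_Suc)
  qed (simp_all add: psi_first_axis psi_second_axis)
qed

text \<open>For j \<le> m the binomial coefficient (i + m - j choose m) is a polynomial in i with
  leading coefficient 1 / m!, and it vanishes by itself for i < j. So the cut-off j \<le> i of the
  defining sum disappears, and the leading coefficients add up by the binomial theorem.\<close>

lemma psi_column_polynomial:
  assumes c1: "c1 \<noteq> 0"
  obtains p where "degree p \<le> m" "poly.coeff p m = (c2 + c3 / c1) ^ m / fact m"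
    "\<And>i. psi c1 c2 c3 (i, m) = c1 ^ i * poly p (real i)"
proof -
  define P where "P j = Polynomial.smult (1 / fact m) (\<Prod>l<m. [:real m - real j - real l, 1:])" for j
  define p where "p = (\<Sum>j\<le>m. Polynomial.smult (real (m choose j) * c2 ^ (m - j) * (c3 / c1) ^ j) (P j))"
  have deg_prod: "degree (\<Prod>l<m. [:real m - real j - real l, 1:]) = m" for j
    by (subst degree_prod_eq_sum_degree) auto
  have deg_P: "degree (P j) = m" for j by (simp add: P_def deg_prod)
  have lead_P: "poly.coeff (P j) m = 1 / fact m" for j
    using deg_prod[of j] lead_coeff_prod[of "\<lambda>l. [:real m - real j - real l, 1:]" "{..<m}"]
    by (simp add: P_def)
  have poly_P: "poly (P j) (real i) = (if j \<le> i then real ((i + m - j) choose m) else 0)" if j: "j \<le> m" for i j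
  proof -
    have "poly (P j) (real i) = (\<Prod>l<m. real (i + m - j) - real l) / fact m"
      using j by (simp add: P_def poly_prod of_nat_diff algebra_simps)
    also have "\<dots> = real ((i + m - j) choose m)"
      by (simp add: binomial_gbinomial gbinomial_prod_rev atLeast0LessThan)
    also have "\<dots> = (if j \<le> i then real ((i + m - j) choose m) else 0)"
      using j by (auto simp: not_le intro!: binomial_eq_0)
    finally show ?thesis .
  qed
  show thesis
  proof (rule that[of p])
    show "degree p \<le> m"
      unfolding p_def using deg_P by (intro degree_sum_le) (auto intro: order.trans[OF degree_smult_le])
    have "poly.coeff p m = (\<Sum>j\<le>m. real (m choose j) * (c3 / c1) ^ j * c2 ^ (m - j)) / fact m"
      by (simp add: p_def coeff_sum lead_P sum_divide_distrib mult_ac)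
    also have "\<dots> = (c3 / c1 + c2) ^ m / fact m" by (subst binomial_ring) simp
    finally show "poly.coeff p m = (c2 + c3 / c1) ^ m / fact m" by (simp add: add.commute)
    fix i
    have "c1 ^ i * poly p (real i) = (\<Sum>j\<le>m. c1 ^ i *
        (real (m choose j) * c2 ^ (m - j) * (c3 / c1) ^ j * poly (P j) (real i)))"
      by (simp add: p_def poly_sum sum_distrib_left)
    also have "\<dots> = (\<Sum>j\<in>{0..i} \<inter> {..m}. real (m choose j) * real ((i + m - j) choose m)
       * c1 ^ (i - j) * c2 ^ (m - j) * c3 ^ j)"
    proof (rule sum.mono_neutral_cong_right)
      fix j assume "j \<in> {0..i} \<inter> {..m}"
      then have j: "j \<le> i" "j \<le> m" by auto
      have "c1 ^ i = c1 ^ (i - j) * c1 ^ j" using j by (simp add: power_add[symmetric])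
      then have "c1 ^ i * (c3 / c1) ^ j = c1 ^ (i - j) * c3 ^ j"
        using c1 by (simp add: power_divide)
      then show "c1 ^ i * (real (m choose j) * c2 ^ (m - j) * (c3 / c1) ^ j * poly (P j) (real i)) =
         real (m choose j) * real ((i + m - j) choose m) * c1 ^ (i - j) * c2 ^ (m - j) * c3 ^ j"
        using j poly_P[of j i] by (simp add: algebra_simps)
    qed (auto simp: poly_P)
    also have "\<dots> = psi c1 c2 c3 (i, m)"
      unfolding psi_def prod.case by (rule sum.mono_neutral_left) (auto simp: binomial_eq_0)
    finally show "psi c1 c2 c3 (i, m) = c1 ^ i * poly p (real i)" by simp
  qed
qed

text \<open>The second assumption keeps the leading coefficient of the column polynomial away from
  0. Since r is below both |c1| and b / 4, a bad index of column m must be one of the at most m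
  places where the polynomial is below (b / 4)^m.\<close>

lemma log_growth_psi_c1_nonzero:
  assumes c1: "c1 \<noteq> 0" and c: "c1 * c2 + c3 \<noteq> 0"
  shows "log_growth 2 (psi c1 c2 c3)"
proof -
  define b where "b = \<bar>c2 + c3 / c1\<bar>"
  have b: "b > 0" using c c1 by (auto simp: b_def field_simps)
  define r where "r = min (1 / 2) (min \<bar>c1\<bar> (b / 4))"
  have r: "0 < r" "r < 1" "r \<le> \<bar>c1\<bar>" "r \<le> b / 4" using c1 b by (auto simp: r_def)
  show ?thesis
  proof (rule log_growth_columns[OF r(1,2)])
    fix m
    obtain p where p: "degree p \<le> m" "poly.coeff p m = (c2 + c3 / c1) ^ m / fact m"
      "\<And>i. psi c1 c2 c3 (i, m) = c1 ^ i * poly p (real i)"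
      using psi_column_polynomial[OF c1] by blast
    have *: "finite {i. \<bar>poly p (real i)\<bar> < (b / 4) ^ m}" "card {i. \<bar>poly p (real i)\<bar> < (b / 4) ^ m} \<le> m"
      using card_small_poly_values[OF p(1), of b] b by (auto simp: p(2) b_def power_abs)
    have "{i. \<bar>psi c1 c2 c3 (i, m)\<bar> < r ^ (i + m)} \<subseteq> {i. \<bar>poly p (real i)\<bar> < (b / 4) ^ m}"
    proof (clarify, rule ccontr)
      fix i assume "\<bar>psi c1 c2 c3 (i, m)\<bar> < r ^ (i + m)" "\<not> \<bar>poly p (real i)\<bar> < (b / 4) ^ m"
      moreover have "r ^ i * r ^ m \<le> \<bar>c1\<bar> ^ i * (b / 4) ^ m"
        using r by (intro mult_mono power_mono) auto
      moreover have "\<bar>c1\<bar> ^ i * (b / 4) ^ m \<le> \<bar>c1\<bar> ^ i * \<bar>poly p (real i)\<bar>"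
        using calculation(2) by (intro mult_left_mono) auto
      ultimately show False by (simp add: p(3) abs_mult power_abs power_add)
    qed
    with * show "finite {i. \<bar>psi c1 c2 c3 (i, m)\<bar> < r ^ (i + m)} \<and>
        card {i. \<bar>psi c1 c2 c3 (i, m)\<bar> < r ^ (i + m)} \<le> m"
      by (meson card_mono finite_subset order.trans)
  qed
qed

text \<open>The column polynomials divide by c1, so rows replace columns: in row i every entry with
  m \<ge> i is a positive integer times c2^(m - i) c3^i, which leaves at most i bad ones.\<close>

lemma log_growth_psi_c1_zero:
  assumes c: "c2 \<noteq> 0" "c3 \<noteq> 0"
  shows "log_growth 2 (psi 0 c2 c3)"
proof -
  define r where "r = min (1 / 2) (min \<bar>c2\<bar> \<bar>c3\<bar>)"
  have r: "0 < r" "r < 1" "r \<le> \<bar>c2\<bar>" "r \<le> \<bar>c3\<bar>" using c by (auto simp: r_def)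
  have "log_growth 2 (\<lambda>k. psi 0 c2 c3 (prod.swap k))"
  proof (rule log_growth_columns[OF r(1,2)])
    fix i
    have *: "{m. \<bar>psi 0 c2 c3 (prod.swap (m, i))\<bar> < r ^ (m + i)} \<subseteq> {..<i}"
    proof (clarsimp, rule ccontr)
      fix m assume less: "\<bar>psi 0 c2 c3 (i, m)\<bar> < r ^ (m + i)" and "\<not> m < i"
      then have im: "i \<le> m" by simp
      have "r ^ (m + i) \<le> r ^ (m - i + i)" using r im by (intro power_decreasing) auto
      also have "\<dots> \<le> 1 * (\<bar>c2\<bar> ^ (m - i) * \<bar>c3\<bar> ^ i)"
        using r by (simp only: power_add mult_1) (intro mult_mono power_mono, auto)
      also have "\<dots> \<le> real (m choose i) * (\<bar>c2\<bar> ^ (m - i) * \<bar>c3\<bar> ^ i)"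
        using im by (intro mult_right_mono) (auto simp: Suc_leI)
      also have "\<dots> = \<bar>psi 0 c2 c3 (i, m)\<bar>"
        using im by (simp add: psi_c1_zero abs_mult power_abs)
      finally show False using less by simp
    qed
    then show "finite {m. \<bar>psi 0 c2 c3 (prod.swap (m, i))\<bar> < r ^ (m + i)} \<and>
        card {m. \<bar>psi 0 c2 c3 (prod.swap (m, i))\<bar> < r ^ (m + i)} \<le> i"
      using finite_subset[OF *] card_mono[OF _ *] by simp
  qed
  then show ?thesis by (rule log_growth_swap)
qed

text \<open>Complements \<open>log_growth_psi_c1_nonzero\<close>: the coefficient on which that
  argument rests is zero for m > 0, but the entries are pure powers and none is bad.\<close>

lemma log_growth_psi_factorized:
  assumes c: "c1 \<noteq> 0" "c2 \<noteq> 0" and "c1 * c2 + c3 = 0"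
  shows "log_growth 2 (psi c1 c2 c3)"
proof -
  define r where "r = min (1 / 2) (min \<bar>c1\<bar> \<bar>c2\<bar>)"
  have r: "0 < r" "r < 1" "r \<le> \<bar>c1\<bar>" "r \<le> \<bar>c2\<bar>" using c by (auto simp: r_def)
  have "c3 = - (c1 * c2)" using assms by linarith
  then have "r ^ (i + m) \<le> \<bar>psi c1 c2 c3 (i, m)\<bar>" for i m
    using r by (auto simp: psi_factorized abs_mult power_abs power_add intro!: mult_mono power_mono)
  then have "{i. \<bar>psi c1 c2 c3 (i, m)\<bar> < r ^ (i + m)} = {}" for m by (auto simp: not_less)
  then show ?thesis by (intro log_growth_columns[OF r(1,2)]) simp
qed

lemma psi_diagonal: "psi 0 0 c3 (n, n) = c3 ^ n"
  by (simp add: psi_c1_zero)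

lemma log_growth_psi:
  assumes "(c1, c2, c3) \<noteq> (0, 0, 0)"
  shows "log_growth (if at_least_two_nonzero c1 c2 c3 then 2 else 1) (psi c1 c2 c3)"
proof (cases "at_least_two_nonzero c1 c2 c3")
  case True
  have "log_growth 2 (psi c1 c2 c3)"
  proof (cases "c1 = 0")
    case True
    with \<open>at_least_two_nonzero c1 c2 c3\<close> show ?thesis
      by (auto simp: at_least_two_nonzero_def intro: log_growth_psi_c1_zero)
  next
    case False
    with \<open>at_least_two_nonzero c1 c2 c3\<close> show ?thesis
      by (cases "c1 * c2 + c3 = 0")
         (auto simp: at_least_two_nonzero_def intro: log_growth_psi_c1_nonzero log_growth_psi_factorized)
  qed
  with True show ?thesis by simp
next
  case False
  \<comment> \<open>A single coefficient is nonzero here, so d is its absolute value.\<close>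
  define d where "d = \<bar>c1\<bar> + \<bar>c2\<bar> + \<bar>c3\<bar>"
  define r where "r = min (1 / 2) d"
  have "d > 0" using assms by (auto simp: d_def)
  then have r: "0 < r" "r < 1" "r \<le> d" by (auto simp: r_def)
  have r_pow: "r ^ (2 * n) \<le> d ^ n" for n
  proof -
    have "r ^ (2 * n) \<le> r ^ n" using r by (intro power_decreasing) auto
    also have "\<dots> \<le> d ^ n" using r by (intro power_mono) auto
    finally show ?thesis .
  qed
  from False assms consider "c1 \<noteq> 0" "c2 = 0" "c3 = 0" | "c1 = 0" "c2 \<noteq> 0" "c3 = 0"
    | "c1 = 0" "c2 = 0" "c3 \<noteq> 0"
    by (auto simp: at_least_two_nonzero_def)
  then have "log_growth 1 (psi c1 c2 c3)"
  proof cases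
    case 1
    show ?thesis
      by (rule log_growth_sequence[OF r(1,2), of "\<lambda>n. (n, 0)"])
         (use r_pow 1 in \<open>auto simp: inj_def psi_first_axis d_def power_abs\<close>)
  next
    case 2
    show ?thesis
      by (rule log_growth_sequence[OF r(1,2), of "\<lambda>n. (0, n)"])
         (use r_pow 2 in \<open>auto simp: inj_def psi_second_axis d_def power_abs\<close>)
  next
    case 3
    show ?thesis
      by (rule log_growth_sequence[OF r(1,2), of "\<lambda>n. (n, n)"])
         (use r_pow 3 in \<open>auto simp: inj_def psi_diagonal d_def power_abs\<close>)
  qed
  with False show ?thesis by simp
qed

text \<open>With a single nonzero coefficient the support lies on an axis or the diagonal, so it has
  at most one point of each total degree; \<kappa> recovers the point from the degree.\<close>

lemma card_psi_support_le:
  fixes c1 c2 c3 :: real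
  assumes "(c1, c2, c3) \<noteq> (0, 0, 0)"
  shows "card {k. fst k + snd k \<le> m \<and> psi c1 c2 c3 k \<noteq> 0}
    \<le> Suc m ^ (if at_least_two_nonzero c1 c2 c3 then 2 else 1)"
proof (cases "at_least_two_nonzero c1 c2 c3")
  case True
  have "card {k. fst k + snd k \<le> m \<and> psi c1 c2 c3 k \<noteq> 0} \<le> card ({..m} \<times> {..m})"
    by (intro card_mono) auto
  with True show ?thesis by (simp add: power2_eq_square)
next
  case False
  have "\<exists>\<kappa>. \<forall>k. psi c1 c2 c3 k \<noteq> 0 \<longrightarrow> k = \<kappa> (fst k + snd k)"
  proof -
    from False assms consider "c2 = 0" "c3 = 0" | "c1 = 0" "c3 = 0" | "c1 = 0" "c2 = 0"
      by (auto simp: at_least_two_nonzero_def)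
    then show ?thesis
    proof cases
      case 1
      show ?thesis
      proof (intro exI allI impI)
        fix k assume "psi c1 c2 c3 k \<noteq> 0"
        moreover have "psi c1 c2 c3 (i, j) = 0" if "j \<noteq> 0" for i j
          unfolding psi_def prod.case using 1 that
          by (intro sum.neutral) (auto simp: power_0_left)
        ultimately have "snd k = 0" by (cases k) auto
        then show "k = (\<lambda>n. (n, 0)) (fst k + snd k)" by (simp add: prod_eq_iff)
      qed
    next
      case 2
      show ?thesis
      proof (intro exI allI impI)
        fix k assume "psi c1 c2 c3 k \<noteq> 0"
        moreover have "psi c1 c2 c3 (i, j) = 0" if "i \<noteq> 0" for i j
          unfolding psi_def prod.case using 2 that
          by (intro sum.neutral) (auto simp: power_0_left)
        ultimately have "fst k = 0" by (cases k) auto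
        then show "k = (\<lambda>n. (0, n)) (fst k + snd k)" by (simp add: prod_eq_iff)
      qed
    next
      case 3
      show ?thesis
      proof (intro exI allI impI)
        fix k assume "psi c1 c2 c3 k \<noteq> 0"
        moreover have "psi c1 c2 c3 (i, j) = 0" if "i \<noteq> j" for i j
          unfolding psi_def prod.case using 3 that
          by (intro sum.neutral) (auto simp: power_0_left intro!: binomial_eq_0)
        ultimately have "fst k = snd k" by (cases k) auto
        then show "k = (\<lambda>n. (n div 2, n div 2)) (fst k + snd k)" by (simp add: prod_eq_iff)
      qed
    qed
  qed
  then obtain \<kappa> where \<kappa>: "\<And>k. psi c1 c2 c3 k \<noteq> 0 \<Longrightarrow> k = \<kappa> (fst k + snd k)" by blast
  have "{k. fst k + snd k \<le> m \<and> psi c1 c2 c3 k \<noteq> 0} \<subseteq> \<kappa> ` {..m}"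
  proof clarify
    fix i j assume "fst (i, j) + snd (i, j) \<le> m" "psi c1 c2 c3 (i, j) \<noteq> 0"
    then show "(i, j) \<in> \<kappa> ` {..m}" using \<kappa>[of "(i, j)"] by (intro image_eqI[of _ _ "i + j"]) auto
  qed
  then have "card {k. fst k + snd k \<le> m \<and> psi c1 c2 c3 k \<noteq> 0} \<le> card (\<kappa> ` {..m})"
    by (intro card_mono) auto
  also have "\<dots> \<le> Suc m" using card_image_le[of "{..m}" \<kappa>] by simp
  finally show ?thesis using False by simp
qed

section \<open>The moving average solution\<close>

text \<open>\<open>infsum\<close> is identified with the Bochner integral over counting measure,
  which depends measurably on a parameter. They agree at every point: for complex terms both take
  the default value 0 exactly when absolute summability fails.\<close>

lemma borel_measurable_infsum:
  fixes f :: "'k :: countable \<Rightarrow> 'a \<Rightarrow> complex"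
  assumes f: "\<And>k. f k \<in> borel_measurable N"
  shows "(\<lambda>\<omega>. \<Sum>\<^sub>\<infinity>k. f k \<omega>) \<in> borel_measurable N"
proof -
  have eq: "(\<Sum>\<^sub>\<infinity>k. f k \<omega>) = (\<integral>k. f k \<omega> \<partial>count_space UNIV)" for \<omega>
  proof (cases "integrable (count_space UNIV) (\<lambda>k. f k \<omega>)")
    case True
    then show ?thesis
      using infsetsum_infsum[of "\<lambda>k. f k \<omega>" UNIV]
      by (simp add: Infinite_Set_Sum.abs_summable_on_def infsetsum_def)
  next
    case False
    then have "\<not> (\<lambda>k. f k \<omega>) summable_on UNIV"
      using abs_summable_equivalent[of "\<lambda>k. f k \<omega>" UNIV]
      by (simp add: Infinite_Set_Sum.abs_summable_on_def summable_on_iff_abs_summable_on_complex)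
    with False show ?thesis by (simp add: infsum_not_exists not_integrable_integral_eq)
  qed
  interpret sigma_finite_measure "count_space (UNIV :: 'k set)"
    by (rule sigma_finite_measure_count_space)
  have "(\<lambda>p. case p of (\<omega>, k) \<Rightarrow> f k \<omega>) \<in> borel_measurable (N \<Otimes>\<^sub>M count_space UNIV)"
    by (subst measurable_pair_swap_iff) (rule measurable_pair_measure_countable1, auto simp: f)
  then have "(\<lambda>\<omega>. \<integral>k. f k \<omega> \<partial>count_space UNIV) \<in> borel_measurable N"
    by (rule borel_measurable_lebesgue_integral)
  then show ?thesis by (simp add: eq)
qed

text \<open>
  Almost surely only finitely many \<open>k\<close> in the support of \<open>a\<close> satisfy
  \<open>\<bar>X\<^sub>k\<bar> > \<rho>\<^bsup>-\<bar>k\<bar>/2\<^esup>\<close>, because their expected number is controlled by the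
  logarithmic moment.
\<close>

lemma (in prob_space) summable_of_log_moment:
  fixes a :: "nat \<times> nat \<Rightarrow> real" and X :: "nat \<times> nat \<Rightarrow> 'a \<Rightarrow> complex"
  assumes X: "\<And>k. random_variable borel (X k)" "\<And>k. distr M borel (X k) = \<mu>"
    and decay: "\<And>k. \<bar>a k\<bar> \<le> C * \<rho> ^ (fst k + snd k)" "0 < \<rho>" "\<rho> < 1"
    and supp: "\<And>m. card {k. fst k + snd k \<le> m \<and> a k \<noteq> 0} \<le> Suc m ^ q" and q: "q \<le> 2"
    and moment: "(\<integral>\<^sup>+x. ennreal (log_plus (cmod x) ^ q) \<partial>\<mu>) < \<infinity>"
  shows "AE \<omega> in M. (\<lambda>k. of_real (a k) * X k \<omega>) summable_on UNIV"
proof -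
  note [measurable] = X(1)
  \<comment> \<open>Half of the decay rate: the noise is compared with exp (l |k|) = \<rho>^(- |k| /
    2), which leaves \<rho>^(|k| / 2) in the product with a k.\<close>
  define l where "l = - ln \<rho> / 2"
  have l: "l > 0" using decay by (simp add: l_def)
  define B where "B k = {x. a k \<noteq> 0 \<and> l * real (fst k + snd k) < log_plus (cmod x)}" for k
  have [measurable]: "B k \<in> sets borel" for k
    unfolding B_def by measurable
  have sets_\<mu>: "sets \<mu> = sets borel" using X(2)[of undefined] by auto
  \<comment> \<open>Tonelli twice: the expected number of exceptional k becomes the integral, over
    one noise value x, of the number of k with x in \<open>B k\<close>. The support bound makes that
    number at most (L / l + 1)^q.\<close>
  have "(\<integral>\<^sup>+\<omega>. \<integral>\<^sup>+k. indicator (B k) (X k \<omega>) \<partial>count_space UNIV \<partial>M) =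
      (\<integral>\<^sup>+k. \<integral>\<^sup>+\<omega>. indicator (B k) (X k \<omega>) \<partial>M \<partial>count_space UNIV)"
    by (rule nn_integral_count_space_nn_integral) auto
  also have "\<dots> = (\<integral>\<^sup>+k. \<integral>\<^sup>+x. indicator (B k) x \<partial>\<mu> \<partial>count_space UNIV)"
  proof (intro nn_integral_cong)
    fix k
    have "(\<integral>\<^sup>+x. indicator (B k) x \<partial>distr M borel (X k)) = (\<integral>\<^sup>+\<omega>. indicator (B k) (X k \<omega>) \<partial>M)"
      by (subst nn_integral_distr) auto
    then show "(\<integral>\<^sup>+\<omega>. indicator (B k) (X k \<omega>) \<partial>M) = (\<integral>\<^sup>+x. indicator (B k) x \<partial>\<mu>)"
      by (simp add: X(2))
  qed
  also have "\<dots> = (\<integral>\<^sup>+x. \<integral>\<^sup>+k. indicator (B k) x \<partial>count_space UNIV \<partial>\<mu>)"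
    by (rule nn_integral_count_space_nn_integral[symmetric]) (auto simp: sets_\<mu> cong: measurable_cong_sets)
  also have "\<dots> \<le> (\<integral>\<^sup>+x. 2 * (ennreal (1 / l ^ q) * ennreal (log_plus (cmod x) ^ q) + 1) \<partial>\<mu>)"
  proof (intro nn_integral_mono)
    fix x :: complex
    define L where "L = log_plus (cmod x)"
    define m where "m = nat \<lfloor>L / l\<rfloor>"
    have "L / l \<ge> 0" using l by (simp add: L_def)
    then have m: "real m \<le> L / l" by (simp add: m_def)
    let ?S = "{k. x \<in> B k}" and ?T = "{k. fst k + snd k \<le> m \<and> a k \<noteq> 0}"
    have fin: "finite ?T" by (rule finite_subset[OF _ finite_total_degree_le[of m]]) auto
    have sub: "?S \<subseteq> ?T"
    proof clarify
      fix i j assume "x \<in> B (i, j)"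
      then have "a (i, j) \<noteq> 0" "real (i + j) < L / l"
        using l by (auto simp: B_def L_def field_simps)
      then show "fst (i, j) + snd (i, j) \<le> m \<and> a (i, j) \<noteq> 0"
        unfolding m_def by (simp add: le_nat_floor)
    qed
    have "(\<integral>\<^sup>+k. indicator (B k) x \<partial>count_space UNIV) = (\<integral>\<^sup>+k. indicator ?S k \<partial>count_space UNIV)"
      by (intro nn_integral_cong) (auto simp: indicator_def)
    also have "\<dots> = of_nat (card ?S)"
      using finite_subset[OF sub fin] by (simp add: emeasure_count_space_finite)
    also have "\<dots> \<le> of_nat (Suc m ^ q)"
      using order.trans[OF card_mono[OF fin sub] supp] by (rule of_nat_mono)
    also have "\<dots> = ennreal (real (Suc m) ^ q)"
      by (simp only: ennreal_of_nat_eq_real_of_nat of_nat_power)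
    also have "\<dots> \<le> ennreal (2 * ((L / l) ^ q + 1 ^ q))"
    proof (rule ennreal_leI)
      have "real (Suc m) ^ q \<le> (L / l + 1) ^ q" using m by (intro power_mono) auto
      also have "\<dots> \<le> 2 * ((L / l) ^ q + 1 ^ q)"
        using l q by (intro power_add_le_two) (auto simp: L_def)
      finally show "real (Suc m) ^ q \<le> 2 * ((L / l) ^ q + 1 ^ q)" .
    qed
    also have "2 * ((L / l) ^ q + 1 ^ q) = 2 * (1 / l ^ q * L ^ q + 1)" by (simp add: power_divide)
    also have "ennreal \<dots> = 2 * (ennreal (1 / l ^ q) * ennreal (L ^ q) + 1)"
    proof -
      have "ennreal (1 / l ^ q * L ^ q) = ennreal (1 / l ^ q) * ennreal (L ^ q)"
        using l by (intro ennreal_mult) (auto simp: L_def)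
      moreover have "ennreal (1 / l ^ q * L ^ q + 1) = ennreal (1 / l ^ q * L ^ q) + ennreal 1"
        using l by (intro ennreal_plus) (auto simp: L_def)
      moreover have "ennreal (2 * (1 / l ^ q * L ^ q + 1)) = ennreal 2 * ennreal (1 / l ^ q * L ^ q + 1)"
        using l by (intro ennreal_mult) (auto simp: L_def)
      ultimately show ?thesis by simp
    qed
    finally show "(\<integral>\<^sup>+k. indicator (B k) x \<partial>count_space UNIV) \<le>
        2 * (ennreal (1 / l ^ q) * ennreal (log_plus (cmod x) ^ q) + 1)" by (simp add: L_def)
  qed
  also have "\<dots> = 2 * (ennreal (1 / l ^ q) * (\<integral>\<^sup>+x. ennreal (log_plus (cmod x) ^ q) \<partial>\<mu>) + emeasure \<mu> (space \<mu>))"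
    using sets_\<mu> by (simp add: nn_integral_cmult nn_integral_add cong: measurable_cong_sets)
  also have "\<dots> < \<infinity>"
  proof -
    have "emeasure \<mu> (space \<mu>) = 1"
      unfolding X(2)[symmetric, of undefined] by (intro prob_space.emeasure_space_1 prob_space_distr X)
    with moment show ?thesis by (simp add: ennreal_mult_less_top)
  qed
  finally have "AE \<omega> in M. (\<integral>\<^sup>+k. indicator (B k) (X k \<omega>) \<partial>count_space UNIV) \<noteq> \<infinity>"
  proof (intro nn_integral_PInf_AE)
    have "(\<lambda>(\<omega>, k). indicator (B k) (X k \<omega>) :: ennreal) \<in> borel_measurable (M \<Otimes>\<^sub>M count_space UNIV)"
      by (subst measurable_pair_swap_iff) (rule measurable_pair_measure_countable1, auto)
    then show "(\<lambda>\<omega>. \<integral>\<^sup>+k. indicator (B k) (X k \<omega>) \<partial>count_space UNIV) \<in> borel_measurable M"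
      by (rule sigma_finite_measure.borel_measurable_nn_integral[OF sigma_finite_measure_count_space])
  qed auto
  then show ?thesis
  proof eventually_elim
    case (elim \<omega>)
    let ?S = "{k. X k \<omega> \<in> B k}"
    have "(\<integral>\<^sup>+k. indicator (B k) (X k \<omega>) \<partial>count_space UNIV) = (\<integral>\<^sup>+k. indicator ?S k \<partial>count_space UNIV)"
      by (intro nn_integral_cong) (auto simp: indicator_def)
    also have "\<dots> = emeasure (count_space UNIV) ?S" by simp
    finally have fin: "finite ?S"
      using elim by (simp add: emeasure_count_space split: if_splits)
    define \<sigma> where "\<sigma> = exp (- l)"
    have \<sigma>: "0 \<le> \<sigma>" "\<sigma> < 1" using l by (auto simp: \<sigma>_def)
    have \<rho>\<sigma>: "\<rho> = \<sigma> * \<sigma>" using decay by (simp add: \<sigma>_def l_def exp_add[symmetric])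
    have C: "C \<ge> 0" using decay(1)[of "(0, 0)"] by simp
    have "(\<lambda>k :: nat \<times> nat. \<sigma> ^ (fst k + snd k)) summable_on UNIV"
      using sum_product_geometric_le[OF \<sigma>] \<sigma>
      by (intro nonneg_bdd_above_summable_on bdd_aboveI[of _ "1 / (1 - \<sigma>)\<^sup>2"]) auto
    then have "(\<lambda>k :: nat \<times> nat. C * \<sigma> ^ (fst k + snd k)) summable_on - ?S"
      by (intro summable_on_cmult_right) (auto intro: summable_on_subset_banach)
    then have "(\<lambda>k. norm (of_real (a k) * X k \<omega>)) summable_on - ?S"
    proof (rule summable_on_comparison_test)
      fix k assume k: "k \<in> - ?S"
      show "norm (of_real (a k) * X k \<omega>) \<le> C * \<sigma> ^ (fst k + snd k)"
      proof (cases "a k = 0")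
        case False
        define n where "n = fst k + snd k"
        have "cmod (X k \<omega>) \<le> exp (log_plus (cmod (X k \<omega>)))" by (rule le_exp_log_plus) simp
        also have "\<dots> \<le> exp (l * real n)" using k False by (auto simp: B_def n_def not_less)
        finally have X_le: "cmod (X k \<omega>) \<le> exp (l * real n)" .
        have "norm (of_real (a k) * X k \<omega>) = \<bar>a k\<bar> * cmod (X k \<omega>)" by (simp add: norm_mult)
        also have "\<dots> \<le> (C * \<rho> ^ n) * exp (l * real n)"
          using decay X_le C by (intro mult_mono) (auto simp: n_def)
        also have "\<dots> = C * \<sigma> ^ n * (\<sigma> ^ n * exp (l * real n))"
          by (simp add: \<rho>\<sigma> power_mult_distrib)
        also have "\<sigma> ^ n * exp (l * real n) = 1"
          by (simp add: \<sigma>_def exp_of_nat_mult[symmetric] exp_add[symmetric] mult.commute)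
        finally show ?thesis by (simp add: n_def)
      qed (use C \<sigma> in auto)
    qed auto
    then have "(\<lambda>k. of_real (a k) * X k \<omega>) summable_on - ?S" by (rule abs_summable_summable)
    moreover have "(\<lambda>k. of_real (a k) * X k \<omega>) summable_on ?S" using fin by (rule summable_on_finite)
    ultimately have "(\<lambda>k. of_real (a k) * X k \<omega>) summable_on (- ?S \<union> ?S)"
      by (intro summable_on_Un_disjoint) auto
    then show ?case by (simp add: Un_commute)
  qed
qed

lemma (in prob_space) iid_law:
  fixes Z :: "'i \<Rightarrow> 'a \<Rightarrow> 'b :: topological_space"
  assumes "indep_vars (\<lambda>_. borel) Z UNIV" "\<And>t. distr M borel (Z t) = \<mu>"
  shows "distr M (Pi\<^sub>M UNIV (\<lambda>_. borel)) (\<lambda>\<omega> t. Z t \<omega>) = Pi\<^sub>M UNIV (\<lambda>_. \<mu>)"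
proof -
  have "\<And>t. random_variable borel (Z t)" using assms(1) by (auto simp: indep_vars_def)
  then have "distr M (Pi\<^sub>M UNIV (\<lambda>_. borel)) (\<lambda>\<omega>. \<lambda>t\<in>UNIV. Z t \<omega>) = Pi\<^sub>M UNIV (\<lambda>t. distr M borel (Z t))"
    using assms(1) by (subst (asm) indep_vars_iff_distr_eq_PiM) auto
  then show ?thesis by (simp add: assms(2) restrict_UNIV)
qed

section \<open>The noise field and its moving average\<close>

locale noise_field = prob_space M for M :: "'w measure" +
  fixes Z :: "int \<times> int \<Rightarrow> 'w \<Rightarrow> complex" and c1 c2 c3 :: real
  assumes iid: "iid_field M Z"
begin

lemma Z_indep: "indep_vars (\<lambda>_. borel) Z UNIV"
  using iid by (simp add: iid_field_def)

lemma Z_measurable [measurable]: "Z t \<in> borel_measurable M"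
  using Z_indep by (cases t) (auto simp: indep_vars_def)

lemma Z_distr: "distr M borel (Z t) = distr M borel (Z (0, 0))"
  using iid unfolding iid_field_def by blast

abbreviation field_space :: "(int \<times> int \<Rightarrow> complex) measure" where
  "field_space \<equiv> Pi\<^sub>M UNIV (\<lambda>_. borel)"

text \<open>As one fixed functional of the shifted noise path, the moving average inherits
  stationarity and symmetry from the law of the whole noise field.\<close>

definition ma_functional :: "(int \<times> int \<Rightarrow> complex) \<Rightarrow> complex" where
  "ma_functional z = (\<Sum>\<^sub>\<infinity>k. of_real (psi c1 c2 c3 k) * z (- int (fst k), - int (snd k)))"

lemma ma_functional_measurable [measurable]: "ma_functional \<in> borel_measurable field_space"
  unfolding ma_functional_def by (rule borel_measurable_infsum) measurable

lemma ma_field_eq_functional: "ma_field c1 c2 c3 Z t \<omega> = ma_functional (\<lambda>s. Z (s + t) \<omega>)"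
  by (simp add: ma_field_def ma_term_def ma_functional_def plus_prod_def)

lemma Z_field_measurable: "(\<lambda>\<omega> s. Z (s + h) \<omega>) \<in> measurable M field_space"
  by (rule measurable_PiM_single') (auto simp: space_PiM)

lemma shifted_law: "distr M field_space (\<lambda>\<omega> s. Z (s + h) \<omega>) = distr M field_space (\<lambda>\<omega> s. Z s \<omega>)"
proof -
  let ?\<mu> = "distr M borel (Z (0, 0))"
  have law: "distr M field_space (\<lambda>\<omega> s. Z s \<omega>) = Pi\<^sub>M UNIV (\<lambda>_. ?\<mu>)"
    by (rule iid_law[OF Z_indep Z_distr])
  have "sets (Pi\<^sub>M UNIV (\<lambda>_::int \<times> int. ?\<mu>)) = sets field_space"
    by (intro sets_PiM_cong) auto
  then have "distr M field_space (\<lambda>\<omega> s. Z (s + h) \<omega>) =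
      distr (distr M field_space (\<lambda>\<omega> s. Z s \<omega>)) (Pi\<^sub>M UNIV (\<lambda>_. ?\<mu>)) (\<lambda>z. \<lambda>s\<in>UNIV. z (s + h))"
    using Z_field_measurable[of 0]
    by (subst distr_distr) (auto simp: comp_def restrict_UNIV cong: distr_cong intro!: measurable_PiM_single')
  also have "\<dots> = Pi\<^sub>M UNIV (\<lambda>_. ?\<mu>)"
    unfolding law
    by (intro distr_PiM_reindex) (auto intro: prob_space_distr simp: inj_on_def)
  finally show ?thesis by (simp add: law)
qed

lemma ma_field_measurable [measurable]: "ma_field c1 c2 c3 Z t \<in> borel_measurable M"
  unfolding ma_field_eq_functional
  by (rule measurable_compose[OF Z_field_measurable ma_functional_measurable])

lemma ma_field_stationary: "strictly_stationary M (ma_field c1 c2 c3 Z)"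
  unfolding strictly_stationary_def
proof (intro conjI allI impI)
  fix h and J :: "(int \<times> int) set" assume "finite J"
  define F where "F z = (\<lambda>t\<in>J. ma_functional (\<lambda>s. z (s + t)))" for z
  have F: "F \<in> measurable field_space (Pi\<^sub>M J (\<lambda>_. borel))"
    unfolding F_def
    by (intro measurable_restrict measurable_compose[OF _ ma_functional_measurable] measurable_PiM_single')
       (auto simp: space_PiM)
  have "distr M (Pi\<^sub>M J (\<lambda>_. borel)) (\<lambda>\<omega>. \<lambda>t\<in>J. ma_field c1 c2 c3 Z (t + h) \<omega>) =
      distr (distr M field_space (\<lambda>\<omega> s. Z (s + h) \<omega>)) (Pi\<^sub>M J (\<lambda>_. borel)) F"
    by (subst distr_distr[OF F Z_field_measurable])
       (simp add: comp_def F_def ma_field_eq_functional add.assoc)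
  also have "\<dots> = distr (distr M field_space (\<lambda>\<omega> s. Z s \<omega>)) (Pi\<^sub>M J (\<lambda>_. borel)) F"
    by (simp only: shifted_law)
  also have "\<dots> = distr M (Pi\<^sub>M J (\<lambda>_. borel)) (\<lambda>\<omega>. \<lambda>t\<in>J. ma_field c1 c2 c3 Z t \<omega>)"
    using distr_distr[OF F Z_field_measurable[of 0]]
    by (simp add: comp_def F_def ma_field_eq_functional)
  finally show "distr M (Pi\<^sub>M J (\<lambda>_. borel)) (\<lambda>\<omega>. \<lambda>t\<in>J. ma_field c1 c2 c3 Z (t + h) \<omega>) =
    distr M (Pi\<^sub>M J (\<lambda>_. borel)) (\<lambda>\<omega>. \<lambda>t\<in>J. ma_field c1 c2 c3 Z t \<omega>)" .
qed measurable

text \<open>The field - Z has the same law as Z, and the functional is odd without exception: where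
  the terms are not summable both values are 0.\<close>

lemma ma_field_symmetric:
  assumes "symmetric_rv M (Z (0, 0))"
  shows "symmetric_rv M (ma_field c1 c2 c3 Z t)"
proof -
  let ?\<mu> = "distr M borel (Z (0, 0))"
  have neg_distr: "distr M borel (\<lambda>\<omega>. - Z s \<omega>) = ?\<mu>" for s
  proof -
    have "distr M borel (\<lambda>\<omega>. - Z s \<omega>) = distr (distr M borel (Z s)) borel uminus"
      by (subst distr_distr) (auto simp: comp_def)
    also have "\<dots> = distr (distr M borel (Z (0, 0))) borel uminus" unfolding Z_distr[of s] ..
    also have "\<dots> = distr M borel (\<lambda>\<omega>. - Z (0, 0) \<omega>)"
      by (subst distr_distr) (auto simp: comp_def)
    finally show ?thesis using assms by (simp add: symmetric_rv_def)
  qed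
  have neg_law: "distr M field_space (\<lambda>\<omega> s. - Z s \<omega>) = distr M field_space (\<lambda>\<omega> s. Z s \<omega>)"
    using iid_law[OF indep_vars_compose2[OF Z_indep, of "\<lambda>_. uminus" "\<lambda>_. borel"] neg_distr]
      iid_law[OF Z_indep Z_distr] by simp
  define F where "F z = ma_functional (\<lambda>s. z (s + t))" for z
  have F: "F \<in> borel_measurable field_space"
    unfolding F_def
    by (intro measurable_compose[OF _ ma_functional_measurable] measurable_PiM_single')
       (auto simp: space_PiM)
  have neg: "(\<lambda>\<omega> s. - Z s \<omega>) \<in> measurable M field_space"
    by (rule measurable_PiM_single') (auto simp: space_PiM)
  have F_neg: "F (\<lambda>s. - z s) = - F z" for z
    by (simp add: F_def ma_functional_def infsum_uminus)
  have "distr M borel (ma_field c1 c2 c3 Z t) = distr (distr M field_space (\<lambda>\<omega> s. Z s \<omega>)) borel F"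
    using distr_distr[OF F Z_field_measurable[of 0]]
    by (simp add: comp_def F_def ma_field_eq_functional[abs_def])
  also have "\<dots> = distr (distr M field_space (\<lambda>\<omega> s. - Z s \<omega>)) borel F" by (simp only: neg_law)
  also have "\<dots> = distr M borel (\<lambda>\<omega>. - ma_field c1 c2 c3 Z t \<omega>)"
    by (subst distr_distr[OF F neg]) (simp add: comp_def F_neg, simp add: F_def ma_field_eq_functional)
  finally show ?thesis by (simp add: symmetric_rv_def)
qed

lemma Z_measurable_past: "s \<le> t \<Longrightarrow> Z s \<in> borel_measurable (past_algebra M Z t)"
  unfolding past_algebra_def
  by (rule measurableI) (auto simp: space_measure_of_conv intro!: in_measure_of)

text \<open>\<open>past_algebra\<close> is not completed by null sets, so an almost sure limit would
  not be enough; \<open>infsum\<close> is measurable as a function defined everywhere.\<close>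

lemma ma_field_causal: "ma_field c1 c2 c3 Z t \<in> borel_measurable (past_algebra M Z t)"
  unfolding ma_field_def[abs_def] ma_term_def
  by (intro borel_measurable_infsum borel_measurable_times borel_measurable_const Z_measurable_past)
     (auto simp: less_eq_prod_def)

lemma ma_term_summable:
  assumes nz: "(c1, c2, c3) \<noteq> (0, 0, 0)" and "no_zero_on_closed_bidisc c1 c2 c3"
    and moment: "log_moment_condition M c1 c2 c3 (Z (0, 0))"
  shows "AE \<omega> in M. ma_term c1 c2 c3 Z t \<omega> summable_on UNIV"
proof -
  define q :: nat where "q = (if at_least_two_nonzero c1 c2 c3 then 2 else 1)"
  obtain C \<rho> where "C > 0" and \<rho>: "0 < \<rho>" "\<rho> < 1"
    and decay: "\<And>i m. \<bar>psi c1 c2 c3 (i, m)\<bar> \<le> C * \<rho> ^ (i + m)"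
    by (rule psi_exponential_decay[OF assms(2)]) (rule that)
  have "(\<integral>\<^sup>+x. ennreal (log_plus (cmod x) ^ q) \<partial>distr M borel (Z (0, 0))) =
      (\<integral>\<^sup>+\<omega>. ennreal (log_plus (cmod (Z (0, 0) \<omega>)) ^ q) \<partial>M)"
    by (rule nn_integral_distr) measurable
  also have "\<dots> < \<infinity>"
    using moment by (cases "at_least_two_nonzero c1 c2 c3") (simp_all add: log_moment_condition_def q_def)
  finally have moment': "(\<integral>\<^sup>+x. ennreal (log_plus (cmod x) ^ q) \<partial>distr M borel (Z (0, 0))) < \<infinity>" .
  have "AE \<omega> in M. (\<lambda>k. of_real (psi c1 c2 c3 k) * Z (fst t - int (fst k), snd t - int (snd k)) \<omega>)
      summable_on UNIV"
  proof (rule summable_of_log_moment[OF Z_measurable Z_distr _ \<rho> _ _ moment'])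
    show "\<bar>psi c1 c2 c3 k\<bar> \<le> C * \<rho> ^ (fst k + snd k)" for k
      using decay[of "fst k" "snd k"] by simp
    show "card {k. fst k + snd k \<le> m \<and> psi c1 c2 c3 k \<noteq> 0} \<le> Suc m ^ q" for m
      unfolding q_def by (rule card_psi_support_le[OF nz])
  qed (simp add: q_def)
  then show ?thesis by (simp add: ma_term_def[abs_def])
qed

lemma ma_field_causal_solution:
  assumes summable: "\<And>t. AE \<omega> in M. ma_term c1 c2 c3 Z t \<omega> summable_on UNIV"
  shows "causal_solution M c1 c2 c3 Z (ma_field c1 c2 c3 Z)"
  unfolding causal_solution_def spatial_ar_equation_def
proof (intro conjI allI)
  fix x y
  show "AE \<omega> in M. ma_field c1 c2 c3 Z (x, y) \<omega> - of_real c1 * ma_field c1 c2 c3 Z (x - 1, y) \<omega>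
      - of_real c2 * ma_field c1 c2 c3 Z (x, y - 1) \<omega>
      - of_real c3 * ma_field c1 c2 c3 Z (x - 1, y - 1) \<omega> = Z (x, y) \<omega>"
    using summable[of "(x, y)"] summable[of "(x - 1, y)"] summable[of "(x, y - 1)"]
      summable[of "(x - 1, y - 1)"]
  proof eventually_elim
    case (elim \<omega>)
    then show ?case
      using convolution_solves_ar[of c1 c2 c3 "\<lambda>s. Z s \<omega>" x y]
      unfolding ma_field_def ma_term_def[abs_def] fst_conv snd_conv by (simp add: has_sum_infsum)
  qed
qed (intro ma_field_stationary ma_field_causal)+

end

section \<open>Arbitrary causal solutions\<close>

text \<open>The recursion for \<open>psi\<close> summed along an antidiagonal: c1 and c2 link
  diagonal n + 1 to n, and c3 links it to n - 1. The end points lie on the axes and use the axis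
  recursions.\<close>

lemma psi_diagonal_recursion:
  fixes Y :: "nat \<Rightarrow> nat \<Rightarrow> complex"
  shows "(\<Sum>i\<le>Suc n. of_real (psi c1 c2 c3 (i, Suc n - i)) * Y i (Suc n - i)) =
    of_real c1 * (\<Sum>i\<le>n. of_real (psi c1 c2 c3 (i, n - i)) * Y (Suc i) (n - i)) +
    of_real c2 * (\<Sum>i\<le>n. of_real (psi c1 c2 c3 (i, n - i)) * Y i (Suc n - i)) +
    of_real c3 * (\<Sum>i<n. of_real (psi c1 c2 c3 (i, n - Suc i)) * Y (Suc i) (n - i))"
proof -
  let ?p = "\<lambda>k. complex_of_real (psi c1 c2 c3 k)"
  have split_last: "(\<Sum>i\<le>n. f i) = (\<Sum>i<n. f i) + f n" for f :: "nat \<Rightarrow> complex"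
    by (simp add: lessThan_Suc_atMost[symmetric])
  have split_first: "(\<Sum>i\<le>n. f i) = f 0 + (\<Sum>i<n. f (Suc i))" for f :: "nat \<Rightarrow> complex"
    by (simp add: lessThan_Suc_atMost[symmetric] sum.lessThan_Suc_shift del: sum.lessThan_Suc)
  have mid: "(\<Sum>i<n. ?p (Suc i, n - i) * Y (Suc i) (n - i)) =
      of_real c1 * (\<Sum>i<n. ?p (i, n - i) * Y (Suc i) (n - i)) +
      of_real c2 * (\<Sum>i<n. ?p (Suc i, n - Suc i) * Y (Suc i) (n - i)) +
      of_real c3 * (\<Sum>i<n. ?p (i, n - Suc i) * Y (Suc i) (n - i))"
    unfolding sum_distrib_left sum.distrib[symmetric]
  proof (intro sum.cong refl)
    fix i assume "i \<in> {..<n}"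
    then have "n - i = Suc (n - Suc i)" by auto
    then have "psi c1 c2 c3 (Suc i, n - i) = c1 * psi c1 c2 c3 (i, n - i)
        + c2 * psi c1 c2 c3 (Suc i, n - Suc i) + c3 * psi c1 c2 c3 (i, n - Suc i)"
      using psi_Suc_Suc[of c1 c2 c3 i "n - Suc i"] by simp
    then show "?p (Suc i, n - i) * Y (Suc i) (n - i) =
       of_real c1 * (?p (i, n - i) * Y (Suc i) (n - i)) +
       of_real c2 * (?p (Suc i, n - Suc i) * Y (Suc i) (n - i)) +
       of_real c3 * (?p (i, n - Suc i) * Y (Suc i) (n - i))"
      by (simp add: algebra_simps)
  qed
  have "(\<Sum>i\<le>Suc n. ?p (i, Suc n - i) * Y i (Suc n - i)) =
      ?p (0, Suc n) * Y 0 (Suc n) + (\<Sum>i\<le>n. ?p (Suc i, n - i) * Y (Suc i) (n - i))"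
    by (simp only: sum.atMost_Suc_shift diff_Suc_Suc diff_zero)
  also have "(\<Sum>i\<le>n. ?p (Suc i, n - i) * Y (Suc i) (n - i)) =
      (\<Sum>i<n. ?p (Suc i, n - i) * Y (Suc i) (n - i)) + ?p (Suc n, 0) * Y (Suc n) 0"
    by (simp only: split_last diff_self_eq_0)
  finally show ?thesis
    unfolding mid split_last[of "\<lambda>i. ?p (i, n - i) * Y (Suc i) (n - i)"]
      split_first[of "\<lambda>i. ?p (i, n - i) * Y i (Suc n - i)"]
    by (simp add: psi_Suc_0 psi_0_Suc algebra_simps)
qed

text \<open>What is left after n rounds of substitution. Two diagonals occur because c1 and c2
  advance by one diagonal and c3 by two: the c3 terms of the last round already sit on diagonal n +
  1.\<close>

definition ar_remainder ::
  "real \<Rightarrow> real \<Rightarrow> real \<Rightarrow> (int \<times> int \<Rightarrow> complex) \<Rightarrow> int \<times> int \<Rightarrow> nat \<Rightarrow> complex" where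
  "ar_remainder c1 c2 c3 y t n =
     (\<Sum>i\<le>n. of_real (psi c1 c2 c3 (i, n - i)) * y (fst t - int i, snd t - int (n - i))) +
     of_real c3 * (\<Sum>i<n. of_real (psi c1 c2 c3 (i, n - Suc i)) * y (fst t - int (Suc i), snd t - int (n - i)))"

lemma sum_total_degree_less_Suc:
  fixes f :: "nat \<times> nat \<Rightarrow> complex"
  shows "(\<Sum>k | fst k + snd k < Suc n. f k) = (\<Sum>k | fst k + snd k < n. f k) + (\<Sum>i\<le>n. f (i, n - i))"
proof -
  have "{k :: nat \<times> nat. fst k + snd k < Suc n} = {k. fst k + snd k < n} \<union> (\<lambda>i. (i, n - i)) ` {..n}"
    by (auto simp: image_iff)
  moreover have "finite {k :: nat \<times> nat. fst k + snd k < n}"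
    by (rule finite_subset[OF _ finite_total_degree_le[of n]]) auto
  ultimately have "(\<Sum>k | fst k + snd k < Suc n. f k) =
      (\<Sum>k | fst k + snd k < n. f k) + (\<Sum>k\<in>(\<lambda>i. (i, n - i)) ` {..n}. f k)"
    by (simp only:) (intro sum.union_disjoint, auto)
  then show ?thesis by (simp add: sum.reindex inj_on_def)
qed

lemma ar_expansion:
  fixes y z :: "int \<times> int \<Rightarrow> complex"
  assumes eq: "\<And>t1 t2. y (t1, t2) - of_real c1 * y (t1 - 1, t2) - of_real c2 * y (t1, t2 - 1)
    - of_real c3 * y (t1 - 1, t2 - 1) = z (t1, t2)"
  shows "y t = (\<Sum>k | fst k + snd k < n. of_real (psi c1 c2 c3 k) * z (fst t - int (fst k), snd t - int (snd k)))
    + ar_remainder c1 c2 c3 y t n"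
proof (induction n)
  case 0
  show ?case by (simp add: ar_remainder_def)
next
  case (Suc n)
  let ?p = "\<lambda>i. complex_of_real (psi c1 c2 c3 (i, n - i))"
  define Y where "Y i j = y (fst t - int i, snd t - int j)" for i j
  have z: "z (fst t - int i, snd t - int (n - i)) = Y i (n - i) - of_real c1 * Y (Suc i) (n - i)
      - of_real c2 * Y i (Suc n - i) - of_real c3 * Y (Suc i) (Suc n - i)" if "i \<le> n" for i
  proof -
    have "int (Suc n - i) = int (n - i) + 1" using that by simp
    then show ?thesis by (simp add: Y_def eq[symmetric] algebra_simps)
  qed
  have "(\<Sum>i\<le>n. ?p i * z (fst t - int i, snd t - int (n - i))) =
      (\<Sum>i\<le>n. ?p i * Y i (n - i) - of_real c1 * (?p i * Y (Suc i) (n - i))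
        - of_real c2 * (?p i * Y i (Suc n - i)) - of_real c3 * (?p i * Y (Suc i) (Suc n - i)))"
  proof (intro sum.cong refl)
    fix i assume "i \<in> {..n}"
    then show "?p i * z (fst t - int i, snd t - int (n - i)) =
        ?p i * Y i (n - i) - of_real c1 * (?p i * Y (Suc i) (n - i))
        - of_real c2 * (?p i * Y i (Suc n - i)) - of_real c3 * (?p i * Y (Suc i) (Suc n - i))"
      by (subst z) (simp_all only: atMost_iff right_diff_distrib mult.left_commute)
  qed
  also have "\<dots> = (\<Sum>i\<le>n. ?p i * Y i (n - i)) - of_real c1 * (\<Sum>i\<le>n. ?p i * Y (Suc i) (n - i))
        - of_real c2 * (\<Sum>i\<le>n. ?p i * Y i (Suc n - i)) - of_real c3 * (\<Sum>i\<le>n. ?p i * Y (Suc i) (Suc n - i))"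
    by (simp only: sum_subtractf sum_distrib_left)
  \<comment> \<open>\<open>psi_diagonal_recursion\<close> collects the c1 and c2 sums on diagonal n
    + 1. The weighted noise on diagonal n is then a difference of consecutive remainders, and the
    expansion telescopes.\<close>
  also have "\<dots> = (\<Sum>i\<le>n. ?p i * Y i (n - i)) -
       ((\<Sum>i\<le>Suc n. of_real (psi c1 c2 c3 (i, Suc n - i)) * Y i (Suc n - i)) -
         of_real c3 * (\<Sum>i<n. of_real (psi c1 c2 c3 (i, n - Suc i)) * Y (Suc i) (n - i)))
       - of_real c3 * (\<Sum>i\<le>n. ?p i * Y (Suc i) (Suc n - i))"
    unfolding psi_diagonal_recursion by simp
  also have "\<dots> = ar_remainder c1 c2 c3 y t n - ar_remainder c1 c2 c3 y t (Suc n)"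
    unfolding ar_remainder_def Y_def by (simp add: lessThan_Suc_atMost)
  finally show ?case
    using Suc.IH by (simp add: sum_total_degree_less_Suc)
qed

section \<open>Independence, zero-one variables and symmetric laws\<close>

lemma (in prob_space) indep_vars_reindex:
  assumes "indep_vars (\<lambda>_. N) X UNIV" "inj f"
  shows "indep_vars (\<lambda>_. N) (\<lambda>k. X (f k)) K"
proof -
  have "indep_vars (\<lambda>k. PiM {f k} (\<lambda>_. N)) (\<lambda>k \<omega>. restrict (\<lambda>i. X i \<omega>) {f k}) K"
    using assms by (intro indep_vars_restrict) (auto simp: disjoint_family_on_def inj_def)
  then have "indep_vars (\<lambda>_. N) (\<lambda>k \<omega>. (\<lambda>x. x (f k)) (restrict (\<lambda>i. X i \<omega>) {f k})) K"
    by (rule indep_vars_compose2) auto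
  then show ?thesis by simp
qed

text \<open>Choose \<omega>0 so that X \<omega>0 avoids all basic open sets of probability 0. Then
  every basic open set around X \<omega>0 has probability 1, and by T1 these countably many sets
  intersect in that point only.\<close>

lemma (in prob_space) zero_one_imp_AE_const:
  fixes X :: "'a \<Rightarrow> 'b :: {second_countable_topology, t1_space}"
  assumes X: "random_variable borel X"
    and zero_one: "\<And>B. B \<in> sets borel \<Longrightarrow> prob (X -` B \<inter> space M) = 0 \<or> prob (X -` B \<inter> space M) = 1"
  shows "\<exists>c. AE \<omega> in M. X \<omega> = c"
proof -
  obtain \<B> :: "'b set set" where \<B>: "countable \<B>" "topological_basis \<B>"
    using ex_countable_basis by blast
  have borel: "U \<in> sets borel" if "U \<in> \<B>" for U
    using topological_basis_open[OF \<B>(2) that] by simp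
  have "AE \<omega> in M. \<forall>U\<in>{U\<in>\<B>. prob (X -` U \<inter> space M) = 0}. X \<omega> \<notin> U"
  proof (subst AE_ball_countable)
    show "\<forall>U\<in>{U\<in>\<B>. prob (X -` U \<inter> space M) = 0}. AE \<omega> in M. X \<omega> \<notin> U"
    proof
      fix U assume "U \<in> {U\<in>\<B>. prob (X -` U \<inter> space M) = 0}"
      then have "X -` U \<inter> space M \<in> null_sets M"
        using X borel by (auto simp: null_sets_def emeasure_eq_measure measurable_sets)
      from AE_not_in[OF this] show "AE \<omega> in M. X \<omega> \<notin> U" by (rule AE_mp) (auto intro!: AE_I2)
    qed
  qed (use \<B> in auto)
  from eventually_happens[OF this]
  obtain \<omega>0 where \<omega>0: "\<And>U. U \<in> \<B> \<Longrightarrow> prob (X -` U \<inter> space M) = 0 \<Longrightarrow> X \<omega>0 \<notin> U"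
    by (auto simp: ae_filter_eq_bot_iff emeasure_space_1)
  have "AE \<omega> in M. \<forall>U\<in>{U\<in>\<B>. X \<omega>0 \<in> U}. X \<omega> \<in> U"
  proof (subst AE_ball_countable)
    show "\<forall>U\<in>{U\<in>\<B>. X \<omega>0 \<in> U}. AE \<omega> in M. X \<omega> \<in> U"
    proof
      fix U assume U: "U \<in> {U\<in>\<B>. X \<omega>0 \<in> U}"
      then have "prob (X -` U \<inter> space M) = 1"
        using zero_one[OF borel, of U] \<omega>0[of U] by auto
      then have "AE \<omega> in M. \<omega> \<in> X -` U \<inter> space M"
        using X borel U by (intro AE_prob_1) auto
      then show "AE \<omega> in M. X \<omega> \<in> U" by eventually_elim auto
    qed
  qed (use \<B> in auto)
  then have "AE \<omega> in M. X \<omega> = X \<omega>0"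
  proof eventually_elim
    case (elim \<omega>)
    show ?case
    proof (rule ccontr)
      assume "X \<omega> \<noteq> X \<omega>0"
      then obtain V where V: "open V" "X \<omega>0 \<in> V" "X \<omega> \<notin> V" by (metis t1_space)
      then obtain U where "U \<in> \<B>" "X \<omega>0 \<in> U" "U \<subseteq> V"
        using topological_basisE[OF \<B>(2)] by metis
      with elim V show False by auto
    qed
  qed
  then show ?thesis by blast
qed

lemma symmetric_rv_cong_AE:
  assumes "AE \<omega> in M. X \<omega> = X' \<omega>" "X \<in> borel_measurable M" "X' \<in> borel_measurable M"
  shows "symmetric_rv M X \<longleftrightarrow> symmetric_rv M X'"
proof -
  have "distr M borel X = distr M borel X'"
    using assms by (intro distr_cong_AE) auto
  moreover have "distr M borel (\<lambda>\<omega>. - X \<omega>) = distr M borel (\<lambda>\<omega>. - X' \<omega>)"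
    using assms by (intro distr_cong_AE) auto
  ultimately show ?thesis by (simp add: symmetric_rv_def)
qed

lemma symmetric_rv_cong_distr:
  assumes "distr M borel X = distr M borel X'" "X \<in> borel_measurable M" "X' \<in> borel_measurable M"
  shows "symmetric_rv M X \<longleftrightarrow> symmetric_rv M X'"
proof -
  have "distr M borel (\<lambda>\<omega>. - X \<omega>) = distr (distr M borel X) borel uminus"
    using assms by (subst distr_distr) (auto simp: comp_def)
  moreover have "distr M borel (\<lambda>\<omega>. - X' \<omega>) = distr (distr M borel X') borel uminus"
    using assms by (subst distr_distr) (auto simp: comp_def)
  ultimately show ?thesis using assms(1) by (simp add: symmetric_rv_def)
qed

text \<open>The two symmetries combine to invariance of the law of \<open>X\<close> under translation by \<open>2 d\<close>.\<close>

lemma (in prob_space) symmetric_shift_eq_0: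
  assumes X: "random_variable borel X" and "symmetric_rv M X"
    and "symmetric_rv M (\<lambda>\<omega>. X \<omega> + d)"
  shows "d = 0"
proof (rule ccontr)
  assume d: "d \<noteq> 0"
  let ?\<mu> = "distr M borel X"
  interpret \<mu>: prob_space ?\<mu> using X by (rule prob_space_distr)
  note [measurable] = X
  have inv: "distr ?\<mu> borel (\<lambda>x. x + 2 * d) = ?\<mu>"
  proof -
    have "distr ?\<mu> borel (\<lambda>x. x + 2 * d) = distr (distr M borel (\<lambda>\<omega>. X \<omega> + d)) borel (\<lambda>x. x + d)"
      by (simp add: distr_distr comp_def add.assoc flip: mult_2)
    also have "\<dots> = distr (distr M borel (\<lambda>\<omega>. - (X \<omega> + d))) borel (\<lambda>x. x + d)"
      using assms(3) unfolding symmetric_rv_def by (rule arg_cong)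
    also have "\<dots> = distr M borel (\<lambda>\<omega>. - X \<omega>)"
      by (simp add: distr_distr comp_def)
    also have "\<dots> = ?\<mu>" using assms(2) unfolding symmetric_rv_def ..
    finally show ?thesis .
  qed
  have step: "\<mu>.prob (cball (c - 2 * d) K) = \<mu>.prob (cball c K)" for c K
  proof -
    have "(\<lambda>x. x + 2 * d) -` cball c K = cball (c - 2 * d) K"
      by (auto simp: dist_norm algebra_simps)
    moreover have "measure (distr ?\<mu> borel (\<lambda>x. x + 2 * d)) (cball c K) =
        \<mu>.prob ((\<lambda>x. x + 2 * d) -` cball c K \<inter> space ?\<mu>)"
      by (rule measure_distr) auto
    ultimately show ?thesis by (simp add: inv)
  qed
  have ball: "\<mu>.prob (cball (- of_nat n * (2 * d)) K) = \<mu>.prob (cball 0 K)" for n K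
  proof (induction n)
    case (Suc n)
    have "- of_nat (Suc n) * (2 * d) = - of_nat n * (2 * d) - 2 * d" by (simp add: algebra_simps)
    with Suc step[of "- of_nat n * (2 * d)" K] show ?case by simp
  qed simp
  have "(\<lambda>n. \<mu>.prob (cball 0 (real n))) \<longlonglongrightarrow> \<mu>.prob (\<Union>n. cball 0 (real n))"
    by (intro \<mu>.finite_Lim_measure_incseq) (auto simp: incseq_def)
  also have "(\<Union>n. cball (0 :: complex) (real n)) = space ?\<mu>"
    using real_arch_simple by (auto simp: dist_norm)
  finally have "(\<lambda>n. \<mu>.prob (cball 0 (real n))) \<longlonglongrightarrow> 1" by (simp only: \<mu>.prob_space)
  then have "\<forall>\<^sub>F n in sequentially. \<mu>.prob (cball 0 (real n)) > 1 / 2"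
    by (rule order_tendstoD) simp
  then obtain K where K: "\<mu>.prob (cball 0 (real K)) > 1 / 2"
    by (auto simp: eventually_sequentially)
  obtain n where n: "2 * real K < real n * cmod (2 * d)"
  proof -
    have "0 < cmod (2 * d)" using d by simp
    from reals_Archimedean3[OF this] show thesis using that by blast
  qed
  define e where "e = - of_nat n * (2 * d)"
  have "cball 0 (real K) \<inter> cball e (real K) = {}"
  proof (rule ccontr)
    assume "cball 0 (real K) \<inter> cball e (real K) \<noteq> {}"
    then obtain x where "cmod x \<le> real K" "cmod (e - x) \<le> real K" by (auto simp: dist_norm)
    then have "cmod e \<le> 2 * real K" using norm_triangle_sub[of e x] by simp
    moreover have "cmod e = real n * cmod (2 * d)"
      unfolding e_def norm_mult norm_minus_cancel norm_of_nat ..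
    ultimately show False using n by simp
  qed
  then have "\<mu>.prob (cball 0 (real K) \<union> cball e (real K)) =
      \<mu>.prob (cball 0 (real K)) + \<mu>.prob (cball e (real K))"
    by (intro \<mu>.finite_measure_Union) auto
  also have "\<dots> > 1" using K ball[of n "real K"] by (simp add: e_def)
  finally show False using \<mu>.prob_le_1 by (simp add: not_le[symmetric])
qed

lemma distr_stationary:
  assumes "strictly_stationary M Y"
  shows "distr M borel (Y t) = distr M borel (Y (0, 0))"
proof -
  have Y[measurable]: "Y t \<in> borel_measurable M" for t
    using assms unfolding strictly_stationary_def by blast
  let ?J = "{(0, 0)} :: (int \<times> int) set"
  have "distr M (Pi\<^sub>M ?J (\<lambda>_. borel)) (\<lambda>\<omega>. \<lambda>s\<in>?J. Y (s + t) \<omega>) =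
      distr M (Pi\<^sub>M ?J (\<lambda>_. borel)) (\<lambda>\<omega>. \<lambda>s\<in>?J. Y s \<omega>)"
    using assms unfolding strictly_stationary_def by blast
  then have "distr (distr M (Pi\<^sub>M ?J (\<lambda>_. borel)) (\<lambda>\<omega>. \<lambda>s\<in>?J. Y (s + t) \<omega>)) borel (\<lambda>f. f (0, 0)) =
      distr (distr M (Pi\<^sub>M ?J (\<lambda>_. borel)) (\<lambda>\<omega>. \<lambda>s\<in>?J. Y s \<omega>)) borel (\<lambda>f. f (0, 0))"
    by (rule arg_cong)
  then show ?thesis by (simp add: distr_distr comp_def zero_prod_def[symmetric])
qed

section \<open>Sigma-algebras generated by parts of the noise\<close>

context noise_field
begin

definition noise_events :: "int \<times> int \<Rightarrow> 'w set set" where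
  "noise_events s = {Z s -` A \<inter> space M | A. A \<in> sets borel}"

definition noise_algebra :: "(int \<times> int) set \<Rightarrow> 'w measure" where
  "noise_algebra S = sigma (space M) (\<Union>s\<in>S. noise_events s)"

lemma past_algebra_eq: "past_algebra M Z t = noise_algebra {..t}"
  by (simp add: past_algebra_def noise_algebra_def noise_events_def)

lemma space_noise_algebra [simp]: "space (noise_algebra S) = space M"
  by (simp add: noise_algebra_def space_measure_of_conv)

lemma sets_noise_algebra: "sets (noise_algebra S) = sigma_sets (space M) (\<Union>s\<in>S. noise_events s)"
  unfolding noise_algebra_def by (rule sets_measure_of) (auto simp: noise_events_def)

lemma noise_algebra_mono:
  assumes "f \<in> borel_measurable (noise_algebra S)" "S \<subseteq> S'"
  shows "f \<in> borel_measurable (noise_algebra S')"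
proof -
  have "sets (noise_algebra S) \<subseteq> sets (noise_algebra S')"
    unfolding sets_noise_algebra using assms(2) by (intro sigma_sets_mono') auto
  then show ?thesis using assms(1) by (auto simp: measurable_def)
qed

lemma measurable_noise_algebra_imp:
  assumes "f \<in> borel_measurable (noise_algebra S)"
  shows "f \<in> borel_measurable M"
proof -
  have "sets (noise_algebra S) \<subseteq> sets M"
    unfolding sets_noise_algebra by (rule sets.sigma_sets_subset) (auto simp: noise_events_def)
  then show ?thesis using assms by (auto simp: measurable_def)
qed

lemma Z_measurable_noise_algebra: "s \<in> S \<Longrightarrow> Z s \<in> borel_measurable (noise_algebra S)"
  by (rule measurableI) (auto simp: sets_noise_algebra noise_events_def intro!: sigma_sets.Basic)

lemma indep_noise_events: "indep_sets noise_events UNIV"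
  using Z_indep by (simp add: indep_vars_def2 noise_events_def[abs_def])

lemma Int_stable_noise_events: "Int_stable (noise_events s)"
proof (rule Int_stableI)
  fix a b assume "a \<in> noise_events s" "b \<in> noise_events s"
  then obtain A B where "a = Z s -` A \<inter> space M" "b = Z s -` B \<inter> space M" "A \<in> sets borel" "B \<in> sets borel"
    by (auto simp: noise_events_def)
  then have "a \<inter> b = Z s -` (A \<inter> B) \<inter> space M" "A \<inter> B \<in> sets borel" by auto
  then show "a \<inter> b \<in> noise_events s" unfolding noise_events_def by blast
qed

lemma indep_noise_algebras:
  assumes "disjoint_family S"
  shows "indep_sets (\<lambda>j. sets (noise_algebra (S j))) UNIV"
  unfolding sets_noise_algebra
  using assms
  by (intro indep_sets_collect_sigma indep_sets_mono_index[OF _ indep_noise_events] Int_stable_noise_events) auto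

lemma indep_var_noise_algebra:
  fixes f g :: "'w \<Rightarrow> real"
  assumes f: "f \<in> borel_measurable (noise_algebra S)" and g: "g \<in> borel_measurable (noise_algebra S')"
    and disj: "S \<inter> S' = {}"
  shows "indep_var borel f borel g"
proof -
  have "indep_sets (\<lambda>j. sets (noise_algebra (case_bool S S' j))) UNIV"
    using disj by (intro indep_noise_algebras) (auto simp: disjoint_family_on_def split: bool.splits)
  then have "indep_sets (\<lambda>j. {case_bool f g j -` A \<inter> space M | A. A \<in> sets borel}) UNIV"
  proof (rule indep_sets_mono_sets)
    fix j :: bool
    have "case_bool f g j \<in> borel_measurable (noise_algebra (case_bool S S' j))"
      using f g by (cases j) auto
    from measurable_sets[OF this]
    show "{case_bool f g j -` A \<inter> space M | A. A \<in> sets borel} \<subseteq> sets (noise_algebra (case_bool S S' j))"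
      by auto
  qed
  then have "indep_vars (\<lambda>_. borel) (case_bool f g) UNIV"
    using measurable_noise_algebra_imp[OF f] measurable_noise_algebra_imp[OF g]
    by (auto simp: indep_vars_def2 split: bool.splits)
  moreover have "(\<lambda>_. borel) = case_bool borel (borel :: real measure)"
    by (auto split: bool.splits)
  ultimately show ?thesis by (simp add: indep_var_def)
qed

text \<open>The part of the quadrant outside the triangle summed by \<open>ma_partial t n\<close>;
  distance is total degree, to match the antidiagonals of the remainder.\<close>

definition far_past :: "int \<times> int \<Rightarrow> nat \<Rightarrow> (int \<times> int) set" where
  "far_past t n = {s. s \<le> t \<and> int n \<le> (fst t - fst s) + (snd t - snd s)}"

lemma ar_remainder_measurable:
  assumes Y: "causal_solution M c1 c2 c3 Z Y"
  shows "(\<lambda>\<omega>. ar_remainder c1 c2 c3 (\<lambda>s. Y s \<omega>) t n) \<in> borel_measurable (noise_algebra (far_past t n))"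
proof -
  have Y_far: "Y (fst t - int i, snd t - int j) \<in> borel_measurable (noise_algebra (far_past t n))"
    if "n \<le> i + j" for i j
  proof (rule noise_algebra_mono)
    show "Y (fst t - int i, snd t - int j) \<in> borel_measurable (noise_algebra {..(fst t - int i, snd t - int j)})"
      using Y by (simp add: causal_solution_def past_algebra_eq)
    show "{..(fst t - int i, snd t - int j)} \<subseteq> far_past t n"
      using that by (auto simp: far_past_def less_eq_prod_def)
  qed
  show ?thesis
    unfolding ar_remainder_def
    by (intro borel_measurable_add borel_measurable_times borel_measurable_sum borel_measurable_const Y_far) auto
qed

definition ma_partial :: "int \<times> int \<Rightarrow> nat \<Rightarrow> 'w \<Rightarrow> complex" where
  "ma_partial t n \<omega> = (\<Sum>k | fst k + snd k < n. ma_term c1 c2 c3 Z t \<omega> k)"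

text \<open>The countably many exceptional null sets are united first; afterwards the expansion is a
  deterministic identity on each path, for all n at once.\<close>

lemma causal_solution_expansion:
  assumes "causal_solution M c1 c2 c3 Z Y"
  shows "AE \<omega> in M. \<forall>n. Y t \<omega> = ma_partial t n \<omega> + ar_remainder c1 c2 c3 (\<lambda>s. Y s \<omega>) t n"
proof -
  have "AE \<omega> in M. \<forall>t1 t2. Y (t1, t2) \<omega> - of_real c1 * Y (t1 - 1, t2) \<omega> - of_real c2 * Y (t1, t2 - 1) \<omega>
      - of_real c3 * Y (t1 - 1, t2 - 1) \<omega> = Z (t1, t2) \<omega>"
    using assms by (simp add: causal_solution_def spatial_ar_equation_def AE_all_countable)
  then show ?thesis
  proof eventually_elim
    case (elim \<omega>)
    then show ?case
      using ar_expansion[of "\<lambda>s. Y s \<omega>" c1 c2 c3 "\<lambda>s. Z s \<omega>" t]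
      by (auto simp: ma_partial_def ma_term_def)
  qed
qed

text \<open>
  By causality the remainder of order \<open>n\<close> only involves noise at distance at least \<open>n\<close>, hence
  is independent of the partial sum.
\<close>

lemma causal_solution_char_bound:
  fixes g :: "complex \<Rightarrow> real"
  assumes Y: "causal_solution M c1 c2 c3 Z Y" and g: "bounded_linear g"
  obtains T where "T > 0" "\<And>K s. finite K \<Longrightarrow> 0 \<le> s \<Longrightarrow> s \<le> T \<Longrightarrow>
    (\<Sum>k\<in>K. 1 - (cmod (char (distr M borel (\<lambda>\<omega>. g (Z (0, 0) \<omega>))) (psi c1 c2 c3 k * s)))\<^sup>2) \<le> 1"
proof -
  interpret g: bounded_linear g by (rule g)
  have g_meas[measurable]: "g \<in> borel_measurable borel"
    by (intro borel_measurable_continuous_onI linear_continuous_on g)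
  define V where "V k \<omega> = g (Z (- int (fst k), - int (snd k)) \<omega>)" for k :: "nat \<times> nat" and \<omega>
  \<comment> \<open>A real-linear g commutes with the coefficients because \<open>psi\<close> is
    real. In this way characteristic functions of real variables reach complex noise.\<close>
  have g_mult: "g (of_real r * w) = r * g w" for r w
    by (simp only: scaleR_conv_of_real[symmetric] g.scaleR real_scaleR_def)
  have Y_meas[measurable]: "Y (0, 0) \<in> borel_measurable M"
    using Y by (auto simp: causal_solution_def strictly_stationary_def)
  show thesis
  proof (rule char_sum_bound_of_decomposition[where U = "\<lambda>\<omega>. g (Y (0, 0) \<omega>)" and V = V
        and \<nu> = "distr M borel (\<lambda>\<omega>. g (Z (0, 0) \<omega>))" and a = "psi c1 c2 c3"])
    show "random_variable borel (\<lambda>\<omega>. g (Y (0, 0) \<omega>))" by measurable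
    show "random_variable borel (V k)" for k unfolding V_def by measurable
    show "distr M borel (V k) = distr M borel (\<lambda>\<omega>. g (Z (0, 0) \<omega>))" for k
    proof -
      have "distr M borel (\<lambda>\<omega>. g (Z s \<omega>)) = distr (distr M borel (Z s)) borel g" for s
        by (subst distr_distr) (auto simp: comp_def)
      then show ?thesis
        unfolding V_def using Z_distr[of "(- int (fst k), - int (snd k))"] by simp
    qed
  next
    fix K :: "(nat \<times> nat) set" assume "finite K"
    then obtain n where n: "\<And>k. k \<in> K \<Longrightarrow> fst k + snd k < n"
      using finite_nat_set_iff_bounded[of "(\<lambda>k. fst k + snd k) ` K"] by auto
    define K' where "K' = {k :: nat \<times> nat. fst k + snd k < n}"
    define R where "R \<omega> = g (ar_remainder c1 c2 c3 (\<lambda>s. Y s \<omega>) (0, 0) n)" for \<omega>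
    \<comment> \<open>A half plane instead of the finite triangle: it contains the indices of the
      partial sum, and its disjointness from the far past is a single inequality.\<close>
    define S where "S = {s :: int \<times> int. - fst s - snd s < int n}"
    have "finite K'" unfolding K'_def by (rule finite_subset[OF _ finite_total_degree_le[of n]]) auto
    moreover have "K \<subseteq> K'" using n by (auto simp: K'_def)
    moreover have "indep_vars (\<lambda>_. borel) V K'"
    proof -
      have "indep_vars (\<lambda>_. borel) (\<lambda>k. Z (- int (fst k), - int (snd k))) K'"
        by (rule indep_vars_reindex[OF Z_indep]) (auto simp: inj_def prod_eq_iff)
      then show ?thesis unfolding V_def by (rule indep_vars_compose2) auto
    qed
    moreover have "indep_var borel (\<lambda>\<omega>. \<Sum>k\<in>K'. psi c1 c2 c3 k * V k \<omega>) borel R"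
    proof (rule indep_var_noise_algebra)
      show "(\<lambda>\<omega>. \<Sum>k\<in>K'. psi c1 c2 c3 k * V k \<omega>) \<in> borel_measurable (noise_algebra S)"
        unfolding V_def
        by (intro borel_measurable_sum borel_measurable_times borel_measurable_const
              measurable_compose[OF Z_measurable_noise_algebra g_meas])
           (auto simp: K'_def S_def)
      show "R \<in> borel_measurable (noise_algebra (far_past (0, 0) n))"
        unfolding R_def by (rule measurable_compose[OF ar_remainder_measurable[OF Y] g_meas])
      show "S \<inter> far_past (0, 0) n = {}" by (auto simp: S_def far_past_def)
    qed
    moreover have "AE \<omega> in M. g (Y (0, 0) \<omega>) = (\<Sum>k\<in>K'. psi c1 c2 c3 k * V k \<omega>) + R \<omega>"
      using causal_solution_expansion[OF Y, of "(0, 0)"]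
    proof eventually_elim
      case (elim \<omega>)
      have "g (Y (0, 0) \<omega>) = g (ma_partial (0, 0) n \<omega>) + R \<omega>"
        using elim by (metis R_def g.add)
      also have "g (ma_partial (0, 0) n \<omega>) = (\<Sum>k\<in>K'. psi c1 c2 c3 k * V k \<omega>)"
        by (simp add: ma_partial_def g.sum ma_term_def g_mult V_def K'_def)
      finally show ?case .
    qed
    ultimately show "\<exists>K' R. finite K' \<and> K \<subseteq> K' \<and> indep_vars (\<lambda>_. borel) V K' \<and>
        indep_var borel (\<lambda>\<omega>. \<Sum>k\<in>K'. psi c1 c2 c3 k * V k \<omega>) borel R \<and>
        (AE \<omega> in M. g (Y (0, 0) \<omega>) = (\<Sum>k\<in>K'. psi c1 c2 c3 k * V k \<omega>) + R \<omega>)"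
      by blast
  qed (rule that)
qed

lemma causal_solution_imp_no_zero:
  assumes Y: "causal_solution M c1 c2 c3 Z Y" and nondet: "nondeterministic M (Z (0, 0))"
  shows "no_zero_on_closed_bidisc c1 c2 c3"
proof -
  \<comment> \<open>Real and imaginary part cannot both be almost surely constant, so one of these
    two projections is nondegenerate.\<close>
  have "\<exists>g::complex \<Rightarrow> real. bounded_linear g \<and> \<not> (\<exists>c. AE \<omega> in M. g (Z (0, 0) \<omega>) = c)"
  proof (rule ccontr)
    assume "\<not> ?thesis"
    then obtain a b where a: "AE \<omega> in M. Re (Z (0, 0) \<omega>) = a" and b: "AE \<omega> in M. Im (Z (0, 0) \<omega>) = b"
      using bounded_linear_Re bounded_linear_Im by meson
    from a b have "AE \<omega> in M. Z (0, 0) \<omega> = Complex a b"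
      by eventually_elim (simp add: complex_eq_iff)
    with nondet show False by (auto simp: nondeterministic_def)
  qed
  then obtain g :: "complex \<Rightarrow> real" where g: "bounded_linear g" "\<not> (\<exists>c. AE \<omega> in M. g (Z (0, 0) \<omega>) = c)"
    by blast
  have [measurable]: "g \<in> borel_measurable borel"
    by (intro borel_measurable_continuous_onI linear_continuous_on g)
  interpret D: real_distribution "distr M borel (\<lambda>\<omega>. g (Z (0, 0) \<omega>))"
    by (rule real_distribution_distr) measurable
  obtain T where T: "T > 0" "\<And>K s. finite K \<Longrightarrow> 0 \<le> s \<Longrightarrow> s \<le> T \<Longrightarrow>
    (\<Sum>k\<in>K. 1 - (cmod (char (distr M borel (\<lambda>\<omega>. g (Z (0, 0) \<omega>))) (psi c1 c2 c3 k * s)))\<^sup>2) \<le> 1"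
    by (rule causal_solution_char_bound[OF Y g(1)]) (rule that)
  have nonconst: "\<not> (\<exists>c. AE x in distr M borel (\<lambda>\<omega>. g (Z (0, 0) \<omega>)). x = c)"
    using g(2) by (simp add: AE_distr_iff)
  have "(\<lambda>k. (psi c1 c2 c3 k)\<^sup>2) summable_on UNIV"
    by (rule D.char_sum_bound_imp_square_summable[OF T(1) _ nonconst]) (rule T(2))
  then show ?thesis by (rule psi_square_summable_imp_no_zero)
qed

text \<open>Real and imaginary part are treated separately and recombined by |z| \<le> |Re z| + |Im
  z|; the constants 4, 4, 2 come from applying \<open>power_add_le_two\<close> twice.\<close>

lemma causal_solution_imp_log_moment:
  assumes Y: "causal_solution M c1 c2 c3 Z Y" and nz: "(c1, c2, c3) \<noteq> (0, 0, 0)"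
  shows "log_moment_condition M c1 c2 c3 (Z (0, 0))"
proof -
  define q :: nat where "q = (if at_least_two_nonzero c1 c2 c3 then 2 else 1)"
  have q: "q \<le> 2" by (simp add: q_def)
  have growth: "log_growth q (psi c1 c2 c3)" unfolding q_def by (rule log_growth_psi[OF nz])
  have moment: "(\<integral>\<^sup>+\<omega>. ennreal (log_plus \<bar>g (Z (0, 0) \<omega>)\<bar> ^ q) \<partial>M) < \<infinity>"
    if g: "bounded_linear g" for g :: "complex \<Rightarrow> real"
  proof -
    have [measurable]: "g \<in> borel_measurable borel"
      by (intro borel_measurable_continuous_onI linear_continuous_on g)
    interpret D: real_distribution "distr M borel (\<lambda>\<omega>. g (Z (0, 0) \<omega>))"
      by (rule real_distribution_distr) measurable
    obtain T where T: "T > 0" "\<And>K s. finite K \<Longrightarrow> 0 \<le> s \<Longrightarrow> s \<le> T \<Longrightarrow>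
      (\<Sum>k\<in>K. 1 - (cmod (char (distr M borel (\<lambda>\<omega>. g (Z (0, 0) \<omega>))) (psi c1 c2 c3 k * s)))\<^sup>2) \<le> 1"
      by (rule causal_solution_char_bound[OF Y g]) (rule that)
    have "(\<integral>\<^sup>+x. ennreal (log_plus \<bar>x\<bar> ^ q) \<partial>distr M borel (\<lambda>\<omega>. g (Z (0, 0) \<omega>))) < \<infinity>"
      by (rule D.char_sum_bound_imp_log_moment[OF q growth T(1)]) (rule T(2))
    then show ?thesis by (simp add: nn_integral_distr)
  qed
  define u v where "u \<omega> = log_plus \<bar>Re (Z (0, 0) \<omega>)\<bar>" and "v \<omega> = log_plus \<bar>Im (Z (0, 0) \<omega>)\<bar>" for \<omega>
  have [measurable]: "u \<in> borel_measurable M" "v \<in> borel_measurable M"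
    unfolding u_def v_def by measurable
  have uv: "0 \<le> u \<omega>" "0 \<le> v \<omega>" for \<omega> by (auto simp: u_def v_def)
  have "(\<integral>\<^sup>+\<omega>. ennreal (log_plus (cmod (Z (0, 0) \<omega>)) ^ q) \<partial>M) \<le>
      (\<integral>\<^sup>+\<omega>. 4 * ennreal (u \<omega> ^ q) + 4 * ennreal (v \<omega> ^ q) + 2 \<partial>M)"
  proof (intro nn_integral_mono)
    fix \<omega>
    have "log_plus (cmod (Z (0, 0) \<omega>)) \<le> log_plus (\<bar>Re (Z (0, 0) \<omega>)\<bar> + \<bar>Im (Z (0, 0) \<omega>)\<bar>)"
      by (intro log_plus_mono cmod_le) simp
    also have "\<dots> \<le> u \<omega> + v \<omega> + 1" unfolding u_def v_def by (rule log_plus_add) auto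
    finally have "log_plus (cmod (Z (0, 0) \<omega>)) ^ q \<le> (u \<omega> + v \<omega> + 1) ^ q"
      by (intro power_mono) auto
    also have "\<dots> \<le> 2 * ((u \<omega> + v \<omega>) ^ q + 1 ^ q)"
      using uv by (intro power_add_le_two q) auto
    also have "(u \<omega> + v \<omega>) ^ q \<le> 2 * (u \<omega> ^ q + v \<omega> ^ q)"
      using uv by (intro power_add_le_two q) auto
    finally have "log_plus (cmod (Z (0, 0) \<omega>)) ^ q \<le> 4 * u \<omega> ^ q + 4 * v \<omega> ^ q + 2" by simp
    then have "ennreal (log_plus (cmod (Z (0, 0) \<omega>)) ^ q) \<le> ennreal (4 * u \<omega> ^ q + 4 * v \<omega> ^ q + 2)"
      by (rule ennreal_leI)
    also have "\<dots> = ennreal (4 * u \<omega> ^ q) + ennreal (4 * v \<omega> ^ q) + ennreal 2"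
      using uv by (simp del: ennreal_numeral)
    also have "\<dots> = 4 * ennreal (u \<omega> ^ q) + 4 * ennreal (v \<omega> ^ q) + 2"
      using uv by (simp add: ennreal_mult)
    finally show "ennreal (log_plus (cmod (Z (0, 0) \<omega>)) ^ q) \<le>
      4 * ennreal (u \<omega> ^ q) + 4 * ennreal (v \<omega> ^ q) + 2" .
  qed
  also have "\<dots> = 4 * (\<integral>\<^sup>+\<omega>. ennreal (u \<omega> ^ q) \<partial>M) + 4 * (\<integral>\<^sup>+\<omega>. ennreal (v \<omega> ^ q) \<partial>M) + 2"
    by (simp add: nn_integral_add nn_integral_cmult emeasure_space_1)
  also have "\<dots> < \<infinity>"
    using moment[OF bounded_linear_Re] moment[OF bounded_linear_Im]
    by (simp add: u_def v_def ennreal_mult_less_top)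
  finally show ?thesis
    by (cases "at_least_two_nonzero c1 c2 c3") (simp_all add: log_moment_condition_def q_def)
qed

section \<open>Uniqueness through the zero-one law\<close>

lemma ma_partial_tendsto:
  assumes "ma_term c1 c2 c3 Z t \<omega> summable_on UNIV"
  shows "(\<lambda>n. ma_partial t n \<omega>) \<longlonglongrightarrow> ma_field c1 c2 c3 Z t \<omega>"
proof -
  have "filterlim (\<lambda>n. {k :: nat \<times> nat. fst k + snd k < n}) (finite_subsets_at_top UNIV) sequentially"
    unfolding filterlim_finite_subsets_at_top
  proof (intro allI impI)
    fix K :: "(nat \<times> nat) set" assume "finite K \<and> K \<subseteq> UNIV"
    then obtain m where m: "\<And>k. k \<in> K \<Longrightarrow> fst k + snd k < m"
      using finite_nat_set_iff_bounded[of "(\<lambda>k. fst k + snd k) ` K"] by auto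
    have "finite {k :: nat \<times> nat. fst k + snd k < n}" for n
      by (rule finite_subset[OF _ finite_total_degree_le[of n]]) auto
    then show "\<forall>\<^sub>F n in sequentially. finite {k :: nat \<times> nat. fst k + snd k < n} \<and>
        K \<subseteq> {k. fst k + snd k < n} \<and> {k. fst k + snd k < n} \<subseteq> UNIV"
      using m by (auto simp: eventually_sequentially intro!: exI[of _ m] dest: less_le_trans)
  qed
  moreover have "(sum (ma_term c1 c2 c3 Z t \<omega>) \<longlongrightarrow> ma_field c1 c2 c3 Z t \<omega>) (finite_subsets_at_top UNIV)"
    using has_sum_infsum[OF assms] by (simp add: has_sum_def ma_field_def)
  ultimately show ?thesis
    unfolding ma_partial_def by (rule filterlim_compose[rotated])
qed

text \<open>Layers of constant distance turn the noise into a sequence of independent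
  sigma-algebras, as Kolmogorov's law requires; far pasts become its tails.\<close>

lemma far_past_decomposition: "far_past t n = (\<Union>i\<in>{n..}. far_past t i - far_past t (Suc i))"
proof (intro equalityI subsetI)
  fix s assume s: "s \<in> far_past t n"
  define i where "i = nat (fst t - fst s + (snd t - snd s))"
  have "int i = fst t - fst s + (snd t - snd s)" "n \<le> i"
    using s by (auto simp: i_def far_past_def)
  with s show "s \<in> (\<Union>i\<in>{n..}. far_past t i - far_past t (Suc i))"
    by (intro UN_I[of i]) (auto simp: far_past_def)
qed (auto simp: far_past_def)

lemma tail_measurable_AE_const:
  fixes D :: "'w \<Rightarrow> complex"
  assumes D: "\<And>n. D \<in> borel_measurable (noise_algebra (far_past t n))"
  shows "\<exists>d. AE \<omega> in M. D \<omega> = d"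
proof (rule zero_one_imp_AE_const)
  show "random_variable borel D" by (rule measurable_noise_algebra_imp[OF D[of 0]])
  define L where "L i = far_past t i - far_past t (Suc i)" for i
  have "disjoint_family L"
    unfolding disjoint_family_on_def L_def by (auto simp: far_past_def)
  then have indep: "indep_sets (\<lambda>i. sets (noise_algebra (L i))) UNIV" by (rule indep_noise_algebras)
  fix B :: "complex set" assume B: "B \<in> sets borel"
  have "D -` B \<inter> space M \<in> tail_events (\<lambda>i. sets (noise_algebra (L i)))"
    unfolding tail_events_def
  proof
    fix n
    have "D -` B \<inter> space M \<in> sigma_sets (space M) (\<Union>s\<in>far_past t n. noise_events s)"
      using measurable_sets[OF D B, of n] by (simp add: sets_noise_algebra)
    also have "\<dots> \<subseteq> sigma_sets (space M) (\<Union> ((\<lambda>i. sets (noise_algebra (L i))) ` {n..}))"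
    proof (rule sigma_sets_mono')
      show "(\<Union>s\<in>far_past t n. noise_events s) \<subseteq> \<Union> ((\<lambda>i. sets (noise_algebra (L i))) ` {n..})"
        unfolding far_past_decomposition[of t n] L_def[symmetric]
        by (auto simp: sets_noise_algebra intro!: bexI sigma_sets.Basic)
    qed
    finally show "D -` B \<inter> space M \<in> sigma_sets (space M) (\<Union> ((\<lambda>i. sets (noise_algebra (L i))) ` {n..}))" .
  qed
  then show "prob (D -` B \<inter> space M) = 0 \<or> prob (D -` B \<inter> space M) = 1"
    using sets.sigma_algebra_axioms[of "noise_algebra _"]
    by (intro kolmogorov_0_1_law[OF _ indep]) auto
qed

text \<open>Holds for divergent sequences too, since both limits are the same definite description.
  So the limit of the remainders is measurable for every far past as it stands, not only up to null
  sets.\<close>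

lemma lim_shift: "lim (\<lambda>n. f (n + N)) = lim (f :: nat \<Rightarrow> complex)"
proof -
  have "(\<lambda>n. f (n + N)) \<longlonglongrightarrow> l \<longleftrightarrow> f \<longlonglongrightarrow> l" for l
    using LIMSEQ_ignore_initial_segment LIMSEQ_offset by blast
  then show ?thesis by (simp add: lim_def)
qed

lemma causal_solution_eq_ma_plus_const:
  assumes Y: "causal_solution M c1 c2 c3 Z Y"
    and summable: "AE \<omega> in M. ma_term c1 c2 c3 Z t \<omega> summable_on UNIV"
  shows "\<exists>d. AE \<omega> in M. Y t \<omega> = ma_field c1 c2 c3 Z t \<omega> + d"
proof -
  define R where "R n \<omega> = ar_remainder c1 c2 c3 (\<lambda>s. Y s \<omega>) t n" for n \<omega>
  define D where "D \<omega> = lim (\<lambda>n. R n \<omega>)" for \<omega>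
  have "D \<in> borel_measurable (noise_algebra (far_past t n))" for n
  proof -
    have "D = (\<lambda>\<omega>. lim (\<lambda>m. R (m + n) \<omega>))" by (simp add: fun_eq_iff D_def lim_shift[of "\<lambda>m. R m \<omega>" n for \<omega>])
    moreover have "R (m + n) \<in> borel_measurable (noise_algebra (far_past t n))" for m
      unfolding R_def
      by (rule noise_algebra_mono[OF ar_remainder_measurable[OF Y]]) (auto simp: far_past_def)
    ultimately show ?thesis by (simp add: borel_measurable_lim_metric)
  qed
  then obtain d where d: "AE \<omega> in M. D \<omega> = d" using tail_measurable_AE_const by blast
  have "AE \<omega> in M. Y t \<omega> = ma_field c1 c2 c3 Z t \<omega> + d"
    using d summable causal_solution_expansion[OF Y, of t]
  proof eventually_elim
    case (elim \<omega>)
    have "(\<lambda>n. Y t \<omega> - ma_partial t n \<omega>) \<longlonglongrightarrow> Y t \<omega> - ma_field c1 c2 c3 Z t \<omega>"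
      by (intro tendsto_intros ma_partial_tendsto elim)
    moreover have "Y t \<omega> - ma_partial t n \<omega> = R n \<omega>" for n
      using elim(3) by (metis R_def add_diff_cancel_left')
    ultimately have "D \<omega> = Y t \<omega> - ma_field c1 c2 c3 Z t \<omega>" by (simp add: D_def limI)
    with elim show ?case by (simp add: algebra_simps)
  qed
  then show ?thesis by blast
qed

text \<open>The constant d may depend on t, so stationarity first carries the symmetry of Y at the
  origin to \<open>Y t\<close>, which is then compared with the moving average at the same
  t.\<close>

lemma symmetric_causal_solution_unique:
  assumes Y: "causal_solution M c1 c2 c3 Z Y" "symmetric_rv M (Y (0, 0))"
    and summable: "AE \<omega> in M. ma_term c1 c2 c3 Z t \<omega> summable_on UNIV"
    and sym: "symmetric_rv M (Z (0, 0))"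
  shows "AE \<omega> in M. Y t \<omega> = ma_field c1 c2 c3 Z t \<omega>"
proof -
  obtain d where d: "AE \<omega> in M. Y t \<omega> = ma_field c1 c2 c3 Z t \<omega> + d"
    using causal_solution_eq_ma_plus_const[OF Y(1) summable] by blast
  have stat: "strictly_stationary M Y" using Y by (simp add: causal_solution_def)
  then have meas: "Y s \<in> borel_measurable M" for s unfolding strictly_stationary_def by blast
  have "symmetric_rv M (Y t)"
    using symmetric_rv_cong_distr[OF distr_stationary[OF stat] meas meas] Y(2) by blast
  then have "symmetric_rv M (\<lambda>\<omega>. ma_field c1 c2 c3 Z t \<omega> + d)"
    using symmetric_rv_cong_AE[OF d meas] by simp
  then have "d = 0"
    by (rule symmetric_shift_eq_0[OF ma_field_measurable ma_field_symmetric[OF sym]])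
  with d show ?thesis by simp
qed

end

theorem theorem4p4:
  fixes M :: "'w measure"
    and Z :: "int \<times> int \<Rightarrow> 'w \<Rightarrow> complex"
    and \<phi>1 \<phi>2 \<phi>3 :: real
  assumes "prob_space M"
    and "iid_field M Z"
    and "(\<phi>1, \<phi>2, \<phi>3) \<noteq> (0, 0, 0)"
  shows
    "(nondeterministic M (Z (0, 0)) \<longrightarrow>
        ((\<exists>Y. causal_solution M \<phi>1 \<phi>2 \<phi>3 Z Y) \<longleftrightarrow>
           no_zero_on_closed_bidisc \<phi>1 \<phi>2 \<phi>3 \<and>
           log_moment_condition M \<phi>1 \<phi>2 \<phi>3 (Z (0, 0)))) \<and>
     (no_zero_on_closed_bidisc \<phi>1 \<phi>2 \<phi>3 \<and>
      log_moment_condition M \<phi>1 \<phi>2 \<phi>3 (Z (0, 0)) \<longrightarrow>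
        (\<exists>Y. causal_solution M \<phi>1 \<phi>2 \<phi>3 Z Y)) \<and>
     (no_zero_on_closed_bidisc \<phi>1 \<phi>2 \<phi>3 \<and>
      log_moment_condition M \<phi>1 \<phi>2 \<phi>3 (Z (0, 0)) \<and>
      symmetric_rv M (Z (0, 0)) \<longrightarrow>
        (\<forall>t. AE \<omega> in M. ma_term \<phi>1 \<phi>2 \<phi>3 Z t \<omega> summable_on UNIV) \<and>
        causal_solution M \<phi>1 \<phi>2 \<phi>3 Z (ma_field \<phi>1 \<phi>2 \<phi>3 Z) \<and>
        symmetric_rv M (ma_field \<phi>1 \<phi>2 \<phi>3 Z (0, 0)) \<and>
        (\<forall>Y. causal_solution M \<phi>1 \<phi>2 \<phi>3 Z Y \<and> symmetric_rv M (Y (0, 0)) \<longrightarrow>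
           (\<forall>t. AE \<omega> in M. Y t \<omega> = ma_field \<phi>1 \<phi>2 \<phi>3 Z t \<omega>)))"
proof -
  interpret noise_field M Z \<phi>1 \<phi>2 \<phi>3
    using assms by (simp add: noise_field_def noise_field_axioms_def)
  have summable: "AE \<omega> in M. ma_term \<phi>1 \<phi>2 \<phi>3 Z t \<omega> summable_on UNIV"
    and causal: "causal_solution M \<phi>1 \<phi>2 \<phi>3 Z (ma_field \<phi>1 \<phi>2 \<phi>3 Z)"
    if "no_zero_on_closed_bidisc \<phi>1 \<phi>2 \<phi>3 \<and> log_moment_condition M \<phi>1 \<phi>2 \<phi>3 (Z (0, 0))" for t
    using that assms(3) by (auto intro: ma_field_causal_solution ma_term_summable)
  have necessary: "no_zero_on_closed_bidisc \<phi>1 \<phi>2 \<phi>3 \<and> log_moment_condition M \<phi>1 \<phi>2 \<phi>3 (Z (0, 0))"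
    if "nondeterministic M (Z (0, 0))" "causal_solution M \<phi>1 \<phi>2 \<phi>3 Z Y" for Y
    using that assms(3) by (auto intro: causal_solution_imp_no_zero causal_solution_imp_log_moment)
  show ?thesis
    using summable causal necessary ma_field_symmetric symmetric_causal_solution_unique by blast
qed

end
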